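(* Let $p\ge 2$ and $k\ge p+1$ be integers, and put $s=2\left\lfloor \frac{k}{p+1}\right\rfloor+j$, where $j=1$ if $k\equiv p \pmod{p+1}$ and $j=0$ otherwise. Then there is $N=N(k,p)$ such that for every $n\ge N$, $$\mathrm{ex}(n,P_k^p)=\max\left\{\mathrm{ex}(a,P_s)+ab+t(b,p-1)\;:\; a,b\ge 0 \text{ integers},\ a+b=n\right\}.$$
   Context: $P_m$ denotes the path on $m$ vertices. For integers $k,p\ge1$, the $p$-th power $P_k^p$ of the path $P_k$ is the graph on the vertex set of $P_k$ in which two distinct vertices are adjacent if and only if their distance in $P_k$ is at most $p$. For a graph $H$, $\mathrm{ex}(n,H)$ is the maximum number of edges of an $n$-vertex graph containing no subgraph isomorphic to $H$ (with $\mathrm{ex}(0,H)=0$). $T(n,q)$ is the complete $q$-partite graph on $n$ vertices whose part sizes differ by at most one, and $t(n,q)$ is its number of edges (with $t(n,1)=0$). *)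

theory Defs
  imports "HOL-Number_Theory.Cong" "HOL-Library.Extended_Nat"
begin

type_synonym 'a graph = "'a set \<times> 'a set set"

abbreviation verts :: "'a graph \<Rightarrow> 'a set" where "verts \<equiv> fst"
abbreviation edges :: "'a graph \<Rightarrow> 'a set set" where "edges \<equiv> snd"

definition simple_graph :: "'a graph \<Rightarrow> bool" where
  "simple_graph G \<longleftrightarrow> finite (verts G) \<and> (\<forall>e\<in>edges G. e \<subseteq> verts G \<and> card e = 2)"

definition subgraph :: "'a graph \<Rightarrow> 'a graph \<Rightarrow> bool" where
  "subgraph S G \<longleftrightarrow> simple_graph S \<and> verts S \<subseteq> verts G \<and> edges S \<subseteq> edges G"

definition isomorphic :: "'a graph \<Rightarrow> 'b graph \<Rightarrow> bool" where
  "isomorphic G H \<longleftrightarrow>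
     (\<exists>f. bij_betw f (verts G) (verts H) \<and>
        (\<forall>u\<in>verts G. \<forall>v\<in>verts G. {u, v} \<in> edges G \<longleftrightarrow> {f u, f v} \<in> edges H))"

definition contains_copy :: "'a graph \<Rightarrow> 'b graph \<Rightarrow> bool" where
  "contains_copy G H \<longleftrightarrow> (\<exists>S. subgraph S G \<and> isomorphic S H)"

text \<open>Every finite graph is isomorphic to one whose vertices are natural numbers, so
  letting the host graphs range over \<open>nat graph\<close> loses no generality.
  If \<open>n > 0\<close> and every \<open>n\<close>-vertex graph contains \<open>H\<close> (which forces \<open>H\<close> to have
  no edges), the maximum is over the empty set and hence unspecified.\<close>

definition ex_num :: "nat \<Rightarrow> 'b graph \<Rightarrow> nat" where
  "ex_num n H =
     (if n = 0 then 0
      else Max {card (edges G) | G :: nat graph.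
                  simple_graph G \<and> card (verts G) = n \<and> \<not> contains_copy G H})"

definition walk_between :: "'a graph \<Rightarrow> 'a \<Rightarrow> 'a \<Rightarrow> 'a list \<Rightarrow> bool" where
  "walk_between G u v xs \<longleftrightarrow>
     xs \<noteq> [] \<and> hd xs = u \<and> last xs = v \<and> set xs \<subseteq> verts G \<and>
     successively (\<lambda>x y. {x, y} \<in> edges G) xs"

text \<open>The distance is \<open>\<infinity>\<close> if there is no walk.\<close>

definition graph_dist :: "'a graph \<Rightarrow> 'a \<Rightarrow> 'a \<Rightarrow> enat" where
  "graph_dist G u v = (INF xs\<in>{xs. walk_between G u v xs}. enat (length xs - 1))"

definition graph_power :: "'a graph \<Rightarrow> nat \<Rightarrow> 'a graph" where
  "graph_power G p =
     (verts G,
      {{u, v} | u v. u \<in> verts G \<and> v \<in> verts G \<and> u \<noteq> v \<and> graph_dist G u v \<le> enat p})"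

definition path_graph :: "nat \<Rightarrow> nat graph" where
  "path_graph m = ({..<m}, {{i, Suc i} | i. Suc i < m})"

definition complete_multipartite :: "'a set \<Rightarrow> ('a \<Rightarrow> 'c) \<Rightarrow> 'a graph" where
  "complete_multipartite V part =
     (V, {{u, v} | u v. u \<in> V \<and> v \<in> V \<and> part u \<noteq> part v})"

text \<open>The parts are the \<open>q\<close> residue classes modulo \<open>q\<close> (some are empty if \<open>n < q\<close>);
  \<open>turan_parts_balanced\<close> below shows that their sizes differ by at most one.
  Only \<open>q \<ge> 1\<close> is meaningful.\<close>

definition turan_graph :: "nat \<Rightarrow> nat \<Rightarrow> nat graph" where
  "turan_graph n q = complete_multipartite {..<n} (\<lambda>i. i mod q)"

definition turan_num :: "nat \<Rightarrow> nat \<Rightarrow> nat" where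
  "turan_num n q = card (edges (turan_graph n q))"

lemma residue_class_card:
  fixes n q i :: nat
  assumes "i < q"
  shows "card {x. x < n \<and> x mod q = i} = n div q + (if i < n mod q then 1 else 0)"
proof (induction n)
  case 0
  then show ?case by simp
next
  case (Suc n)
  have q: "q > 0" using assms by simp
  have split: "{x. x < Suc n \<and> x mod q = i} =
      (if n mod q = i then insert n {x. x < n \<and> x mod q = i} else {x. x < n \<and> x mod q = i})"
    by (auto simp: less_Suc_eq)
  have nm: "n mod q < q" using q by simp
  show ?case
    unfolding split using Suc assms nm by (auto simp: div_Suc mod_Suc split: if_splits)
qed

lemma turan_parts_balanced:
  fixes n q i j :: nat
  assumes "i < q" "j < q"
  shows "card {x \<in> verts (turan_graph n q). x mod q = i}
         \<le> card {x \<in> verts (turan_graph n q). x mod q = j} + 1"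
  using residue_class_card[OF assms(1), of n] residue_class_card[OF assms(2), of n]
  by (simp add: turan_graph_def complete_multipartite_def)

lemma turan_num_1: "turan_num n 1 = 0"
  by (simp add: turan_num_def turan_graph_def complete_multipartite_def)

lemma path_walk_length:
  assumes "successively (\<lambda>x y. {x, y} \<in> edges (path_graph k)) xs" "xs \<noteq> []"
  shows "hd xs \<le> last xs + (length xs - 1) \<and> last xs \<le> hd xs + (length xs - 1)"
  using assms
proof (induction xs rule: induct_list012)
  case (3 x y zs)
  then have "{x, y} \<in> edges (path_graph k)" by simp
  then have "x = Suc y \<or> y = Suc x"
    by (auto simp: path_graph_def doubleton_eq_iff)
  with 3 show ?case by auto
qed auto

lemma path_graph_dist:
  assumes "i \<le> j" "j < k"
  shows "graph_dist (path_graph k) i j = enat (j - i)"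
proof (rule antisym)
  have "successively (\<lambda>x y. {x, y} \<in> edges (path_graph k)) [i..<Suc j]"
    using assms by (auto simp: successively_conv_nth path_graph_def simp del: upt_Suc)
  then have "walk_between (path_graph k) i j [i..<Suc j]"
    using assms hd_upt[of i "Suc j"] last_upt[of i "Suc j"]
    by (auto simp: walk_between_def path_graph_def simp del: upt_Suc)
  then show "graph_dist (path_graph k) i j \<le> enat (j - i)"
    unfolding graph_dist_def using assms by (intro INF_lower2[of "[i..<Suc j]"]) auto
  show "enat (j - i) \<le> graph_dist (path_graph k) i j"
    unfolding graph_dist_def
  proof (rule INF_greatest)
    fix xs assume "xs \<in> {xs. walk_between (path_graph k) i j xs}"
    then show "enat (j - i) \<le> enat (length xs - 1)"
      using path_walk_length[of k xs] by (auto simp: walk_between_def)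
  qed
qed

lemma edge_path_power_iff:
  assumes "i < j" "j < k"
  shows "{i, j} \<in> edges (graph_power (path_graph k) p) \<longleftrightarrow> j - i \<le> p"
proof -
  have sym: "walk_between G u v xs \<Longrightarrow> walk_between G v u (rev xs)"
    for G :: "nat graph" and u v xs
    by (auto simp: walk_between_def hd_rev last_rev insert_commute)
  have "graph_dist G v u \<le> graph_dist G u v" for G :: "nat graph" and u v
    unfolding graph_dist_def
  proof (rule INF_greatest)
    fix xs assume "xs \<in> {xs. walk_between G u v xs}"
    then show "(INF xs\<in>{xs. walk_between G v u xs}. enat (length xs - 1)) \<le> enat (length xs - 1)"
      by (intro INF_lower2[of "rev xs"]) (auto intro: sym)
  qed
  then have "graph_dist (path_graph k) j i = graph_dist (path_graph k) i j"
    by (meson antisym)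
  with assms path_graph_dist[of i j k]
  have d: "graph_dist (path_graph k) i j = enat (j - i)"
    "graph_dist (path_graph k) j i = enat (j - i)" by simp_all
  have v: "i \<in> verts (path_graph k)" "j \<in> verts (path_graph k)"
    using assms by (auto simp: path_graph_def)
  show ?thesis
  proof
    assume "{i, j} \<in> edges (graph_power (path_graph k) p)"
    then show "j - i \<le> p"
      using d by (auto simp: graph_power_def doubleton_eq_iff)
  next
    assume "j - i \<le> p"
    with assms d v show "{i, j} \<in> edges (graph_power (path_graph k) p)"
      unfolding graph_power_def snd_conv
      by (intro CollectI exI[of _ i] exI[of _ j]) simp
  qed
qed

end

theory Submission
  imports Defs "HOL-Combinatorics.Transposition" "HOL-Library.FuncSet"
begin

text \<open>
  Lower bound: in a copy of \<open>P\<^sub>k\<^sup>p\<close> inside the join of \<open>A\<close> with a complete \<open>(p - 1)\<close>-partite graph, any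
  \<open>p + 1\<close> consecutive vertices include two in \<open>A\<close>, which produces a path \<open>P\<^sub>s\<close> in \<open>A\<close>.

  Upper bound: if \<open>ex(n, P\<^sub>k\<^sup>p)\<close> exceeds the maximum infinitely often, then for arbitrarily large \<open>n\<close> it
  also grows at least as fast as the maximum, so that all extremal graphs have minimum degree about
  \<open>(1 - 1/p) n\<close>. Such a graph is, up to boundedly many vertices, almost complete \<open>p\<close>-partite, with
  classes that contain no \<open>P\<^sub>s\<close>. Two classes with many disjoint edges of low degree would give a copy
  of \<open>P\<^sub>k\<^sup>p\<close> of larger period, so all classes but one are nearly independent. Replacing vertices by
  clones of suitable vertices turns large parts of these \<open>p - 1\<close> classes into twin classes while
  keeping the graph extremal. The twin classes determine a partition of all vertices, and counting
  edges by the Erdos-Gallai argument yields either at most as many edges as in a join or two paths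
  in different classes that can be linked to form a \<open>P\<^sub>k\<^sup>p\<close>.\<close>

subsection \<open>Paths and powers of paths\<close>

text \<open>The formula is exact, while stability arguments control a graph only up to a small
  proportion of its vertices. Twin classes bridge this gap: a vertex sees all or nothing of a class
  of twins, so large twin classes define a partition without exceptional vertices, and edges can be
  compared with those of a join term by term. Creating twins changes the graph; therefore the
  minimum degree condition is derived for every extremal graph on the given vertex set and not for
  one fixed graph. The length enters only through \<open>s\<close>. The upper bound is proved for
  the largest length \<open>K = q * (p + 1) + p - 1 + j\<close> with the same \<open>s\<close>,
  where \<open>q = k div (p + 1)\<close>: a path on \<open>s\<close> vertices inside one of
  \<open>p\<close> richly connected classes already yields the power of this length. Two suitably
  linked paths in different classes do the same if their orders add up to \<open>s + 1\<close>. This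
  is the exchange rate of the final count: a path on \<open>r\<close> vertices in one class makes
  paths on \<open>s + 1 - r\<close> vertices in the other dangerous.\<close>

definition graph_rel :: "('a \<Rightarrow> 'a \<Rightarrow> bool) \<Rightarrow> bool" where
  "graph_rel E \<longleftrightarrow> (\<forall>u v. E u v \<longrightarrow> E v u) \<and> (\<forall>u. \<not> E u u)"

text \<open>A graph is a set \<open>V\<close> with a relation \<open>E\<close> on the whole type, of
  which only the values on \<open>V\<close> count. An induced subgraph is the same \<open>E\<close>
  with a smaller \<open>V\<close>, and \<open>nbh A E v\<close> makes sense for \<open>v\<close>
  outside \<open>A\<close>.\<close>

definition nbh :: "'a set \<Rightarrow> ('a \<Rightarrow> 'a \<Rightarrow> bool) \<Rightarrow> 'a \<Rightarrow> 'a set" where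
  "nbh V E v = {u \<in> V. E v u}"

text \<open>Twice the number of edges; the factor two is kept throughout to avoid halving.\<close>

definition degsum :: "'a set \<Rightarrow> ('a \<Rightarrow> 'a \<Rightarrow> bool) \<Rightarrow> nat" where
  "degsum V E = (\<Sum>v\<in>V. card (nbh V E v))"

definition has_power :: "nat \<Rightarrow> nat \<Rightarrow> 'a set \<Rightarrow> ('a \<Rightarrow> 'a \<Rightarrow> bool) \<Rightarrow> bool" where
  "has_power p k V E \<longleftrightarrow> (\<exists>\<phi>. inj_on \<phi> {..<k} \<and> \<phi> ` {..<k} \<subseteq> V \<and>
     (\<forall>i j. i < j \<longrightarrow> j < k \<longrightarrow> j \<le> i + p \<longrightarrow> E (\<phi> i) (\<phi> j)))"

definition gpath :: "'a set \<Rightarrow> ('a \<Rightarrow> 'a \<Rightarrow> bool) \<Rightarrow> 'a list \<Rightarrow> bool" where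
  "gpath V E xs \<longleftrightarrow> distinct xs \<and> set xs \<subseteq> V \<and> successively E xs"

text \<open>Vertices are counted, not edges, so an isolated vertex has order 1; this is why
  \<open>path_order V E v - 1\<close> takes the place of a degree in the estimates.\<close>

definition path_order :: "'a set \<Rightarrow> ('a \<Rightarrow> 'a \<Rightarrow> bool) \<Rightarrow> 'a \<Rightarrow> nat" where
  "path_order V E v = Max {length xs | xs. gpath V E xs \<and> xs \<noteq> [] \<and> hd xs = v}"

lemma graph_relD: "graph_rel E \<Longrightarrow> E u v \<Longrightarrow> E v u" "graph_rel E \<Longrightarrow> \<not> E u u"
  by (auto simp: graph_rel_def)

lemma graph_rel_sym: "graph_rel E \<Longrightarrow> E u v \<longleftrightarrow> E v u"
  by (auto simp: graph_rel_def)

lemma finite_nbh [simp]: "finite V \<Longrightarrow> finite (nbh V E v)"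
  by (simp add: nbh_def)

lemma nbh_subset: "nbh V E v \<subseteq> V"
  by (auto simp: nbh_def)

lemma has_power_mono:
  assumes "has_power p k V E" "V \<subseteq> V'" "k' \<le> k"
  shows "has_power p k' V' E"
proof -
  obtain \<phi> where \<phi>: "inj_on \<phi> {..<k}" "\<phi> ` {..<k} \<subseteq> V"
      "\<forall>i j. i < j \<longrightarrow> j < k \<longrightarrow> j \<le> i + p \<longrightarrow> E (\<phi> i) (\<phi> j)"
    using assms(1) by (auto simp: has_power_def)
  have "{..<k'} \<subseteq> {..<k}" using assms(3) by auto
  then have "inj_on \<phi> {..<k'}" "\<phi> ` {..<k'} \<subseteq> V'"
    using \<phi>(2) assms(2,3) inj_on_subset[OF \<phi>(1)] by (auto simp: image_subset_iff subset_iff)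
  with \<phi>(3) assms(3) show ?thesis unfolding has_power_def by (intro exI[of _ \<phi>]) auto
qed

lemma gpath_length: "finite V \<Longrightarrow> gpath V E xs \<Longrightarrow> length xs \<le> card V"
  unfolding gpath_def by (metis card_mono distinct_card)

lemma finite_gpaths: "finite V \<Longrightarrow> finite {xs. gpath V E xs}"
  by (rule finite_subset[OF _ finite_lists_length_le[of V "card V"]])
     (auto simp: gpath_length, auto simp: gpath_def)

lemma finite_path_lengths: "finite V \<Longrightarrow> finite {length xs | xs. gpath V E xs \<and> P xs}"
  by (rule finite_subset[of _ "length ` {xs. gpath V E xs}"]) (auto simp: finite_gpaths)

lemma path_order_ge:
  assumes "finite V" "gpath V E xs" "xs \<noteq> []"
  shows "length xs \<le> path_order V E (hd xs)"
  unfolding path_order_def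
  using finite_path_lengths[OF assms(1), of E "\<lambda>ys. ys \<noteq> [] \<and> hd ys = hd xs"] assms
  by (intro Max_ge) auto

lemma path_order_attained:
  assumes "finite V" "v \<in> V"
  obtains xs where "gpath V E xs" "xs \<noteq> []" "hd xs = v" "length xs = path_order V E v"
proof -
  have "gpath V E [v]" using assms by (simp add: gpath_def)
  then have "{length xs | xs. gpath V E xs \<and> xs \<noteq> [] \<and> hd xs = v} \<noteq> {}" by force
  then have "path_order V E v \<in> {length xs | xs. gpath V E xs \<and> xs \<noteq> [] \<and> hd xs = v}"
    unfolding path_order_def
    using finite_path_lengths[OF assms(1), of E "\<lambda>ys. ys \<noteq> [] \<and> hd ys = v"] by (intro Max_in) auto
  then show ?thesis using that by auto
qed

lemma gpath_mono: "gpath V E xs \<Longrightarrow> V \<subseteq> W \<Longrightarrow> gpath W E xs"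
  by (auto simp: gpath_def)

lemma path_order_mono:
  assumes "finite W" "V \<subseteq> W" "v \<in> V"
  shows "path_order V E v \<le> path_order W E v"
proof -
  have "finite V" using assms finite_subset by blast
  then obtain xs where "gpath V E xs" "xs \<noteq> []" "hd xs = v" "length xs = path_order V E v"
    using path_order_attained assms(3) by metis
  then show ?thesis using path_order_ge[OF assms(1) gpath_mono[OF _ assms(2)]] by metis
qed

lemma gpath_take: "gpath V E xs \<Longrightarrow> gpath V E (take n xs)"
  unfolding gpath_def by (auto simp: successively_conv_nth dest: in_set_takeD)

lemma gpath_rev:
  assumes "graph_rel E" "gpath V E xs" shows "gpath V E (rev xs)"
proof -
  have eq: "(\<lambda>x y. E y x) = E" using assms(1) by (auto simp: graph_rel_def fun_eq_iff)
  have "successively E (rev xs) = successively E xs" unfolding successively_rev eq ..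
  then show ?thesis using assms by (simp add: gpath_def)
qed

lemma path_order_bound:
  assumes "finite V" "v \<in> V" "\<And>xs. gpath V E xs \<Longrightarrow> length xs \<noteq> s"
  shows "path_order V E v < s"
proof -
  obtain xs where xs: "gpath V E xs" "length xs = path_order V E v"
    using path_order_attained assms(1,2) by metis
  show ?thesis
  proof (rule ccontr)
    assume "\<not> ?thesis"
    then have "length (take s xs) = s" using xs by simp
    then show False using assms(3) gpath_take[OF xs(1)] by blast
  qed
qed

section \<open>Degree sums and the Erdos-Gallai bound\<close>

lemma degsum_split:
  assumes "finite V" "A \<subseteq> V" "\<And>u v. u \<in> A \<Longrightarrow> v \<in> V - A \<Longrightarrow> \<not> E u v \<and> \<not> E v u"
  shows "degsum V E = degsum A E + degsum (V - A) E"
proof -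
  have "degsum V E = (\<Sum>v\<in>A. card (nbh V E v)) + (\<Sum>v\<in>V-A. card (nbh V E v))"
    unfolding degsum_def using sum.subset_diff[OF assms(2,1)] by (simp add: add.commute)
  moreover have "(\<Sum>v\<in>A. card (nbh V E v)) = degsum A E" unfolding degsum_def
    using assms(2,3) by (intro sum.cong refl arg_cong[of _ _ card]) (auto simp: nbh_def)
  moreover have "(\<Sum>v\<in>V-A. card (nbh V E v)) = degsum (V-A) E" unfolding degsum_def
    using assms(2,3) by (intro sum.cong refl arg_cong[of _ _ card]) (auto simp: nbh_def)
  ultimately show ?thesis by simp
qed

lemma degsum_remove:
  assumes "finite V" "graph_rel E" "v \<in> V"
  shows "degsum V E = degsum (V - {v}) E + 2 * card (nbh V E v)"
proof -
  let ?W = "V - {v}"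
  have N: "card (nbh V E u) = card (nbh ?W E u) + (if E u v then 1 else 0)" if "u \<in> ?W" for u
  proof -
    have "nbh V E u = (if E u v then insert v (nbh ?W E u) else nbh ?W E u)"
      using assms(3) by (auto simp: nbh_def)
    moreover have "v \<notin> nbh ?W E u" by (auto simp: nbh_def)
    ultimately show ?thesis using assms(1) by auto
  qed
  have "degsum V E = card (nbh V E v) + (\<Sum>u\<in>?W. card (nbh V E u))"
    unfolding degsum_def by (rule sum.remove[OF assms(1,3)])
  also have "(\<Sum>u\<in>?W. card (nbh V E u)) = (\<Sum>u\<in>?W. card (nbh ?W E u) + (if E u v then 1 else 0))"
    by (rule sum.cong[OF refl N])
  also have "\<dots> = degsum ?W E + (\<Sum>u\<in>?W. if E u v then 1 else 0)"
    unfolding degsum_def by (rule sum.distrib)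
  also have "(\<Sum>u\<in>?W. if E u v then 1 else 0 :: nat) = card (nbh V E v)"
  proof -
    have "(\<Sum>u\<in>?W. if E u v then 1 else 0 :: nat) = card {u\<in>?W. E u v}"
      using assms(1) by (subst card_eq_sum) (rule sum.inter_filter[symmetric], simp)
    also have "{u\<in>?W. E u v} = nbh V E v"
      using assms by (auto simp: nbh_def graph_rel_def)
    finally show ?thesis .
  qed
  finally show ?thesis by simp
qed

lemma degsum_le: "finite V \<Longrightarrow> graph_rel E \<Longrightarrow> degsum V E \<le> card V * (card V - 1)"
proof -
  assume a: "finite V" "graph_rel E"
  have "card (nbh V E v) \<le> card V - 1" if "v \<in> V" for v
  proof -
    have "nbh V E v \<subseteq> V - {v}" using a by (auto simp: nbh_def graph_rel_def)
    then show ?thesis using a that by (metis card_Diff_singleton card_mono finite_Diff)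
  qed
  then show ?thesis unfolding degsum_def using sum_bounded_above[of V "\<lambda>v. card (nbh V E v)" "card V - 1"]
    by simp
qed

text \<open>The argument of Erdos and Gallai: for a longest path, either its two ends have degree
  sum less than its order, so that one of them can be deleted, or its vertex set carries a
  spanning cycle and hence is a union of components.\<close>

lemma degsum_le_path_order:
  assumes "finite V" "graph_rel E"
  shows "degsum V E \<le> (\<Sum>v\<in>V. path_order V E v - 1)"
  using assms(1)
proof (induction "card V" arbitrary: V rule: less_induct)
  case less
  show ?case
  proof (cases "V = {}")
    case True then show ?thesis by (simp add: degsum_def)
  next
    case False
    define k where "k = Max {length xs | xs. gpath V E xs \<and> True}"
    have fin: "finite {length xs | xs. gpath V E xs \<and> True}" by (rule finite_path_lengths[OF less.prems])
    obtain v0 where "v0 \<in> V" using False by auto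
    then have gp0: "gpath V E [v0]" by (simp add: gpath_def)
    then have "k \<in> {length xs | xs. gpath V E xs \<and> True}" unfolding k_def using fin by (intro Max_in) auto
    then obtain xs where xs: "gpath V E xs" "length xs = k" by auto
    have kmax: "length ys \<le> k" if "gpath V E ys" for ys
      unfolding k_def using fin that by (intro Max_ge) auto
    have k1: "1 \<le> k" using kmax[OF gp0] by simp
    let ?f = "\<lambda>i. xs ! i"
    have inj: "?f i = ?f j \<longleftrightarrow> i = j" if "i < k" "j < k" for i j
      using that xs by (auto simp: gpath_def nth_eq_iff_index_eq)
    have inV: "?f i \<in> V" if "i < k" for i using that xs by (auto simp: gpath_def)
    have adj: "E (?f i) (?f (Suc i))" if "Suc i < k" for i
      using that xs by (auto simp: gpath_def successively_conv_nth)
    have sym: "E u v \<longleftrightarrow> E v u" for u v using assms(2) by (auto simp: graph_rel_def)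
    have irr: "\<not> E u u" for u using assms(2) by (auto simp: graph_rel_def)
    have ne: "xs \<noteq> []" using xs k1 by auto
    have lastxs: "last xs = ?f (k-1)" using xs ne by (simp add: last_conv_nth)
    have setxs: "set xs = ?f ` {..<k}" using xs by (auto simp: set_conv_nth)
    have nb1: "u \<in> set xs" if "u \<in> nbh V E (?f 0)" for u
    proof (rule ccontr)
      assume "u \<notin> set xs"
      moreover have "successively E (u # xs)"
      proof -
        have "E u (hd xs)" using that sym[of u "hd xs"] ne by (simp add: nbh_def hd_conv_nth)
        then show ?thesis using xs(1) ne by (cases xs) (simp_all add: gpath_def)
      qed
      ultimately have "gpath V E (u # xs)" using that xs by (auto simp: gpath_def nbh_def)
      then show False using kmax[of "u # xs"] xs by simp
    qed
    have nb2: "u \<in> set xs" if "u \<in> nbh V E (?f (k-1))" for u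
    proof (rule ccontr)
      assume "u \<notin> set xs"
      moreover have "successively E (xs @ [u])"
        using xs that ne lastxs by (simp add: gpath_def nbh_def successively_append_iff)
      ultimately have "gpath V E (xs @ [u])" using that xs by (auto simp: gpath_def nbh_def)
      then show False using kmax[of "xs @ [u]"] xs by simp
    qed
    show ?thesis
    \<comment> \<open>If the first vertex is adjacent to number \<open>i + 1\<close> and the last
      one to number \<open>i\<close>, then following the path up to \<open>i\<close>, jumping to its
      end and returning to \<open>i + 1\<close> closes a cycle on the same vertices.\<close>
    proof (cases "\<exists>i. Suc i < k \<and> E (?f 0) (?f (Suc i)) \<and> E (?f (k-1)) (?f i)")
      case True
      then obtain i where i: "Suc i < k" "E (?f 0) (?f (Suc i))" "E (?f (k-1)) (?f i)" by blast
      define c where "c = take (Suc i) xs @ rev (drop (Suc i) xs)"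
      have lenc: "length c = k" using xs i by (simp add: c_def)
      have setc: "set c = set xs" unfolding c_def by (metis append_take_drop_id set_append set_rev)
      have cn: "c ! j = (if j \<le> i then xs ! j else xs ! (k - (j - i)))" if "j < k" for j
      proof (cases "j \<le> i")
        case False
        then show ?thesis using that i xs
          by (simp add: c_def nth_append rev_nth) (rule arg_cong[of _ _ "(!) xs"], simp)
      qed (use that xs i in \<open>simp add: c_def nth_append\<close>)
      have cadj: "E (c ! j) (c ! (Suc j mod k))" if j: "j < k" for j
      proof -
        consider "j < i" | "j = i" | "i < j" "Suc j < k" | "i < j" "Suc j = k" using j by linarith
        then show ?thesis
        proof cases
          case 1 then show ?thesis using i adj[of j] by (simp add: cn)
        next
          case 2 then show ?thesis using i sym by (simp add: cn)
        next
          case 3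
          then have e: "k - (j - i) = Suc (k - (Suc j - i))" by simp
          have "E (?f (k - (Suc j - i))) (?f (k - (j - i)))" unfolding e using 3 by (intro adj) simp
          moreover have "c ! j = ?f (k - (j - i))" "c ! Suc j = ?f (k - (Suc j - i))"
            using 3 cn[of j] cn[of "Suc j"] by auto
          ultimately show ?thesis using 3 sym by simp
        next
          case 4
          then have e: "k - (j - i) = Suc i" by simp
          have "c ! j = ?f (Suc i)" using cn[of j] 4 e by simp
          moreover have "c ! 0 = ?f 0" using cn[of 0] k1 by simp
          ultimately show ?thesis using i 4 sym by simp
        qed
      qed
      have dc: "distinct c" using lenc setc xs by (metis card_distinct distinct_card gpath_def)
      \<comment> \<open>Opening the cycle at \<open>u\<close> and appending \<open>v\<close> would
        give a path on \<open>k + 1\<close> vertices, against the choice of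
        \<open>k\<close>.\<close>
      have closed: "\<not> E u v" if u: "u \<in> set xs" and v: "v \<in> V - set xs" for u v
      proof
        assume "E u v"
        obtain j where j: "j < k" "c ! j = u" using u lenc setc by (metis in_set_conv_nth)
        define w where "w = rotate (Suc j) c"
        have lw: "length w = k" by (simp add: w_def lenc)
        have wn: "w ! n = c ! ((Suc j + n) mod k)" if "n < k" for n
          using that lenc by (simp add: w_def nth_rotate del: rotate_Suc)
        have "successively E w" unfolding successively_conv_nth
        proof (intro allI impI)
          fix n assume n: "Suc n < length w"
          then show "E (w ! n) (w ! Suc n)" using lw k1 cadj[of "(Suc j + n) mod k"]
            by (simp add: wn mod_Suc_eq)
        qed
        moreover have "last w = u"
        proof -
          have "last w = w ! (k - 1)" using lw k1 by (simp add: last_conv_nth flip: length_greater_0_conv)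
          also have "\<dots> = c ! ((Suc j + (k - 1)) mod k)" using k1 by (intro wn) simp
          also have "Suc j + (k - 1) = j + k" using k1 by simp
          finally show ?thesis using j by simp
        qed
        moreover have "distinct w" "set w = set xs" using dc setc by (simp_all add: w_def)
        ultimately have "gpath V E (w @ [v])" using \<open>E u v\<close> v xs lw k1
          by (auto simp: gpath_def successively_append_iff)
        then show False using kmax[of "w @ [v]"] lw by simp
      qed
      let ?A = "set xs"
      have AV: "?A \<subseteq> V" using xs by (simp add: gpath_def)
      have cA: "card ?A = k" using xs by (metis distinct_card gpath_def)
      have split: "degsum V E = degsum ?A E + degsum (V - ?A) E"
        by (intro degsum_split less.prems AV) (use closed graph_relD(1)[OF assms(2)] in blast)
      \<comment> \<open>The cycle can be opened at any vertex, so each of its \<open>k\<close>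
        vertices contributes at least \<open>k - 1\<close> on the right, the largest possible degree
        within \<open>k\<close> vertices.\<close>
      have "path_order V E u \<ge> k" if u: "u \<in> ?A" for u
      proof -
        obtain j where j: "j < k" "c ! j = u" using u lenc setc by (metis in_set_conv_nth)
        define w where "w = rotate j c"
        have lw: "length w = k" by (simp add: w_def lenc)
        have wn: "w ! n = c ! ((j + n) mod k)" if "n < k" for n
          using that lenc by (simp add: w_def nth_rotate del: rotate_Suc)
        have "successively E w" unfolding successively_conv_nth
        proof (intro allI impI)
          fix n assume n: "Suc n < length w"
          then show "E (w ! n) (w ! Suc n)" using lw k1 cadj[of "(j + n) mod k"]
            by (simp add: wn mod_Suc_eq)
        qed
        moreover have "hd w = u" using lw k1 wn[of 0] j by (simp add: hd_conv_nth flip: length_greater_0_conv)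
        moreover have "distinct w" "set w = set xs" using dc setc by (simp_all add: w_def)
        moreover have "w \<noteq> []" using lw k1 by auto
        ultimately show ?thesis using path_order_ge[OF less.prems, of E w] lw AV by (auto simp: gpath_def)
      qed
      then have "(\<Sum>v\<in>?A. k - 1) \<le> (\<Sum>v\<in>?A. path_order V E v - 1)" by (intro sum_mono) (simp add: diff_le_mono)
      then have 1: "degsum ?A E \<le> (\<Sum>v\<in>?A. path_order V E v - 1)"
        using degsum_le[of ?A E] assms(2) cA by simp
      have "V - ?A \<subset> V" using AV ne by (cases xs) auto
      then have "card (V - ?A) < card V" using less.prems by (rule psubset_card_mono[rotated])
      then have "degsum (V - ?A) E \<le> (\<Sum>v\<in>V-?A. path_order (V-?A) E v - 1)"
        by (intro less.hyps) (use less.prems in auto)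
      also have "\<dots> \<le> (\<Sum>v\<in>V-?A. path_order V E v - 1)"
        using path_order_mono[OF less.prems, of "V - ?A"] by (intro sum_mono diff_le_mono) auto
      finally show ?thesis using split 1 sum.subset_diff[OF AV less.prems, of "\<lambda>v. path_order V E v - 1"] by simp
    next
      case False
      \<comment> \<open>\<open>I\<close> holds the predecessors, along the path, of the neighbours
        of the first vertex, and \<open>J\<close> the neighbours of the last one. By maximality all
        these neighbours lie on the path; without the crossing pair of the other case,
        \<open>I\<close> and \<open>J\<close> are disjoint subsets of \<open>{..<k-1}\<close>, so
        one end has degree at most \<open>(k - 1) / 2\<close>.\<close>
      define I where "I = {i. Suc i < k \<and> E (?f 0) (?f (Suc i))}"
      define J where "J = {i. i < k \<and> E (?f (k-1)) (?f i)}"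
      have "nbh V E (?f 0) = (\<lambda>i. ?f (Suc i)) ` I"
      proof (intro set_eqI iffI)
        fix u assume u: "u \<in> nbh V E (?f 0)"
        then obtain j where j: "j < k" "u = ?f j" using nb1 setxs by auto
        have "j \<noteq> 0" using u j irr by (cases j) (auto simp: nbh_def)
        then obtain i where "j = Suc i" using not0_implies_Suc by blast
        then show "u \<in> (\<lambda>i. ?f (Suc i)) ` I" using j u by (auto simp: I_def nbh_def)
      qed (auto simp: I_def nbh_def inV)
      moreover have "inj_on (\<lambda>i. ?f (Suc i)) I" by (auto simp: inj_on_def I_def inj)
      ultimately have cI: "card (nbh V E (?f 0)) = card I" by (simp add: card_image)
      have "nbh V E (?f (k-1)) = ?f ` J"
        using nb2 setxs by (auto simp: J_def nbh_def inV)
      moreover have "inj_on ?f J" by (auto simp: inj_on_def J_def inj)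
      ultimately have cJ: "card (nbh V E (?f (k-1))) = card J" by (simp add: card_image)
      have "I \<inter> J = {}" using False by (auto simp: I_def J_def)
      moreover have "I \<union> J \<subseteq> {..<k-1}"
      proof
        fix x assume "x \<in> I \<union> J"
        then show "x \<in> {..<k-1}" using irr[of "?f (k-1)"]
          by (auto simp: I_def J_def) (metis Suc_pred k1 less_Suc_eq less_le_trans zero_less_one)
      qed
      moreover have "finite I" "finite J"
        by (auto simp: I_def J_def intro: finite_subset[of _ "{..<k}"])
      ultimately have "card I + card J \<le> k - 1"
        by (metis card_Un_disjoint card_lessThan card_mono finite_lessThan)
      then obtain v ys where v: "v \<in> V" "2 * card (nbh V E v) \<le> k - 1"
          "gpath V E ys" "ys \<noteq> []" "hd ys = v" "length ys = k"
      proof -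
        assume *: "card I + card J \<le> k - 1"
          "\<And>v ys. v \<in> V \<Longrightarrow> 2 * card (nbh V E v) \<le> k - 1 \<Longrightarrow> gpath V E ys \<Longrightarrow> ys \<noteq> [] \<Longrightarrow> hd ys = v \<Longrightarrow> length ys = k \<Longrightarrow> thesis"
        show thesis
        proof (cases "2 * card I \<le> k - 1")
          case True
          show ?thesis by (rule *(2)[of "?f 0" xs]) (use True cI k1 inV xs ne in \<open>auto simp: hd_conv_nth\<close>)
        next
          case False
          then show ?thesis using *(1)
            by (intro *(2)[of "?f (k-1)" "rev xs"])
               (use cJ k1 inV xs ne gpath_rev[OF assms(2)] in \<open>auto simp: hd_rev last_conv_nth\<close>)
        qed
      qed
      \<comment> \<open>Deleting \<open>v\<close> costs at most \<open>k - 1\<close>, and its own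
        term on the right is at least \<open>k - 1\<close>, since \<open>v\<close> starts a path on
        \<open>k\<close> vertices.\<close>
      have lv: "k \<le> path_order V E v" using path_order_ge[OF less.prems v(3,4)] v(5,6) by simp
      have "degsum V E = degsum (V - {v}) E + 2 * card (nbh V E v)"
        by (rule degsum_remove[OF less.prems assms(2) v(1)])
      moreover have "degsum (V - {v}) E \<le> (\<Sum>u\<in>V-{v}. path_order (V-{v}) E u - 1)"
        by (rule less.hyps[OF card_Diff1_less[OF less.prems v(1)]]) (simp add: less.prems)
      moreover have "\<dots> \<le> (\<Sum>u\<in>V-{v}. path_order V E u - 1)"
        using path_order_mono[OF less.prems, of "V - {v}"] by (intro sum_mono diff_le_mono) auto
      moreover have "(\<Sum>u\<in>V. path_order V E u - 1) = (path_order V E v - 1) + (\<Sum>u\<in>V-{v}. path_order V E u - 1)"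
        by (rule sum.remove[OF less.prems v(1)])
      ultimately show ?thesis using v(2) lv by linarith
    qed
  qed
qed

subsection \<open>Embedding powers of paths\<close>

text \<open>Vertices of a power of a path that are placed in class \<open>i\<close> can be chosen greedily inside \<open>F i\<close>,
  as any \<open>K\<close> vertices of the other classes have \<open>K\<close> common neighbours there.\<close>

definition richsys :: "('a \<Rightarrow> 'a \<Rightarrow> bool) \<Rightarrow> nat \<Rightarrow> nat \<Rightarrow> (nat \<Rightarrow> 'a set) \<Rightarrow> (nat \<Rightarrow> 'a set) \<Rightarrow> bool" where
  "richsys E c K V F \<longleftrightarrow>
     (\<forall>i<c. F i \<subseteq> V i \<and> finite (F i)) \<and> (\<forall>i<c. \<forall>j<c. i \<noteq> j \<longrightarrow> V i \<inter> V j = {}) \<and>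
     (\<forall>i<c. \<forall>Q. finite Q \<longrightarrow> card Q \<le> K \<longrightarrow> (\<forall>q\<in>Q. \<exists>j<c. j \<noteq> i \<and> q \<in> V j) \<longrightarrow>
        K \<le> card {x \<in> F i. \<forall>q\<in>Q. E q x})"

text \<open>Allows the distinguished classes to be moved to the indices 0 and 1.\<close>

lemma richsys_permute:
  assumes "richsys E c K V F" "inj_on \<tau> {..<c}" "\<tau> ` {..<c} \<subseteq> {..<c}"
  shows "richsys E c K (V \<circ> \<tau>) (F \<circ> \<tau>)"
proof -
  have lt: "\<tau> i < c" if "i < c" for i using that assms(3) by auto
  have ne: "\<tau> i \<noteq> \<tau> j" if "i < c" "j < c" "i \<noteq> j" for i j using that assms(2) by (auto simp: inj_on_def)
  have 1: "\<forall>i<c. F (\<tau> i) \<subseteq> V (\<tau> i) \<and> finite (F (\<tau> i))" using assms(1) lt by (auto simp: richsys_def)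
  have 2: "\<forall>i<c. \<forall>j<c. i \<noteq> j \<longrightarrow> V (\<tau> i) \<inter> V (\<tau> j) = {}"
    using assms(1) lt ne unfolding richsys_def by meson
  have "K \<le> card {x \<in> F (\<tau> i). \<forall>q\<in>Q. E q x}"
    if "i < c" "finite Q" "card Q \<le> K" "\<forall>q\<in>Q. \<exists>j<c. j \<noteq> i \<and> q \<in> V (\<tau> j)" for i Q
  proof -
    have "\<forall>q\<in>Q. \<exists>j<c. j \<noteq> \<tau> i \<and> q \<in> V j" using that lt ne by metis
    then show ?thesis using assms(1) that lt[OF that(1)] by (simp add: richsys_def)
  qed
  with 1 2 show ?thesis by (simp add: richsys_def)
qed

text \<open>Induction over the positions outside \<open>P\<close>. By \<open>sep\<close>, the
  occupied positions near a new position \<open>x\<close> lie in other classes, so their images have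
  \<open>K\<close> common neighbours in \<open>F (\<kappa> x)\<close>; fewer than \<open>K\<close>
  vertices are in use so far, hence one of these is free.\<close>

lemma richsys_embed:
  fixes p K c :: nat
  assumes E: "graph_rel E" and rs: "richsys E c K V F"
    and I: "finite I" "card I \<le> K" "P \<subseteq> I" and \<kappa>: "\<And>i. i \<in> I \<Longrightarrow> \<kappa> i < c"
    and \<sigma>: "\<And>i. i \<in> P \<Longrightarrow> \<sigma> i \<in> V (\<kappa> i)" "inj_on \<sigma> P"
      "\<And>i j. i \<in> P \<Longrightarrow> j \<in> P \<Longrightarrow> i < j \<Longrightarrow> j \<le> i + p \<Longrightarrow> E (\<sigma> i) (\<sigma> j)"
    and sep: "\<And>i j. i \<in> I \<Longrightarrow> j \<in> I \<Longrightarrow> i < j \<Longrightarrow> j \<le> i + p \<Longrightarrow> \<kappa> i = \<kappa> j \<Longrightarrow> i \<in> P \<and> j \<in> P"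
  shows "\<exists>\<phi>. inj_on \<phi> I \<and> (\<forall>i\<in>I. \<phi> i \<in> V (\<kappa> i)) \<and>
    (\<forall>i\<in>I. \<forall>j\<in>I. i < j \<longrightarrow> j \<le> i + p \<longrightarrow> E (\<phi> i) (\<phi> (j::nat)))"
proof -
  have ext: "\<exists>\<phi>. inj_on \<phi> (P \<union> R) \<and> (\<forall>i\<in>P\<union>R. \<phi> i \<in> V (\<kappa> i)) \<and>
    (\<forall>i\<in>P\<union>R. \<forall>j\<in>P\<union>R. i < j \<longrightarrow> j \<le> i + p \<longrightarrow> E (\<phi> i) (\<phi> j))" if "finite R" "R \<subseteq> I - P" for R
    using that
  proof (induction R rule: finite_induct)
    case empty
    show ?case using \<sigma> by (intro exI[of _ \<sigma>]) auto
  next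
    case (insert x R)
    then obtain \<phi> where \<phi>: "inj_on \<phi> (P \<union> R)" "\<forall>i\<in>P\<union>R. \<phi> i \<in> V (\<kappa> i)"
      "\<forall>i\<in>P\<union>R. \<forall>j\<in>P\<union>R. i < j \<longrightarrow> j \<le> i + p \<longrightarrow> E (\<phi> i) (\<phi> j)" by auto
    define S where "S = P \<union> R"
    have xS: "x \<in> I" "x \<notin> P" "x \<notin> S" using insert by (auto simp: S_def)
    have SI: "insert x S \<subseteq> I" using insert I by (auto simp: S_def)
    have fS: "finite S" using finite_subset[OF _ I(1), of S] SI by simp
    have cS: "card S < K" using card_mono[OF I(1) SI] I(2) fS xS by simp
    define N where "N = {i\<in>S. i < x \<and> x \<le> i + p \<or> x < i \<and> i \<le> x + p}"
    define Q where "Q = \<phi> ` N"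
    have NS: "N \<subseteq> S" by (auto simp: N_def)
    have fQ: "finite Q" using finite_subset[OF NS fS] by (simp add: Q_def)
    have "card Q \<le> card S" unfolding Q_def
      by (rule le_trans[OF card_image_le[OF finite_subset[OF NS fS]] card_mono[OF fS NS]])
    then have cQ: "card Q \<le> K" using cS by simp
    have "\<forall>q\<in>Q. \<exists>j<c. j \<noteq> \<kappa> x \<and> q \<in> V j"
    proof
      fix q assume "q \<in> Q"
      then obtain i where i: "i \<in> N" "q = \<phi> i" by (auto simp: Q_def)
      then have "i \<in> S" "i \<in> I" using NS SI by auto
      moreover have "\<kappa> i \<noteq> \<kappa> x"
        using sep[of i x] sep[of x i] i \<open>i \<in> I\<close> xS by (auto simp: N_def)
      ultimately show "\<exists>j<c. j \<noteq> \<kappa> x \<and> q \<in> V j" using \<kappa>[of i] \<phi>(2) i by (auto simp: S_def)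
    qed
    then have "K \<le> card {x' \<in> F (\<kappa> x). \<forall>q\<in>Q. E q x'}"
      using rs \<kappa>[OF xS(1)] fQ cQ by (simp add: richsys_def)
    moreover have "card (\<phi> ` S) < K" using cS card_image_le[OF fS, of \<phi>] by simp
    ultimately have "\<not> {x' \<in> F (\<kappa> x). \<forall>q\<in>Q. E q x'} \<subseteq> \<phi> ` S"
      using card_mono[of "\<phi> ` S" "{x' \<in> F (\<kappa> x). \<forall>q\<in>Q. E q x'}"] fS by auto
    then obtain y where y: "y \<in> F (\<kappa> x)" "\<forall>q\<in>Q. E q y" "y \<notin> \<phi> ` S" by auto
    have yV: "y \<in> V (\<kappa> x)" using y rs \<kappa>[OF xS(1)] by (auto simp: richsys_def)
    have eq: "P \<union> insert x R = insert x S" by (auto simp: S_def)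
    let ?\<psi> = "\<phi>(x := y)"
    have A: "inj_on ?\<psi> (insert x S)" using \<phi>(1) y(3) xS(3)
      by (auto simp: S_def[symmetric] inj_on_fun_updI)
    have B: "?\<psi> i \<in> V (\<kappa> i)" if "i \<in> insert x S" for i using that \<phi>(2) yV xS(3) by (auto simp: S_def)
    have C: "E (?\<psi> i) (?\<psi> j)" if ij: "i \<in> insert x S" "j \<in> insert x S" "i < j" "j \<le> i + p" for i j
    proof -
      consider "i = x" "j \<in> S" | "j = x" "i \<in> S" | "i \<in> S" "j \<in> S" using ij by auto
      then show ?thesis
      proof cases
        case 1
        then have "\<phi> j \<in> Q" using ij by (auto simp: Q_def N_def)
        then show ?thesis using y 1 xS ij graph_relD(1)[OF E] by auto
      next
        case 2
        then have "\<phi> i \<in> Q" using ij by (auto simp: Q_def N_def)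
        then show ?thesis using y 2 xS ij by auto
      next
        case 3
        then show ?thesis using \<phi>(3) xS ij by (auto simp: S_def)
      qed
    qed
    show ?case unfolding eq by (intro exI[of _ ?\<psi>] conjI ballI impI A B C)
  qed
  have eq: "P \<union> (I - P) = I" using I(3) by auto
  show ?thesis by (rule ext[of "I - P", unfolded eq]) (use I in auto)
qed

text \<open>The positions in \<open>P\<close> are embedded by hand through \<open>\<sigma>\<close>, all others greedily into the class
  given by \<open>\<kappa>\<close>.\<close>

lemma richsys_has_power:
  assumes E: "graph_rel E" and rs: "richsys E c k V F" and I: "I = {e..<e+k}" "P \<subseteq> I"
    and \<kappa>: "\<And>i. i \<in> I \<Longrightarrow> \<kappa> i < c"
    and \<sigma>: "\<And>i. i \<in> P \<Longrightarrow> \<sigma> i \<in> V (\<kappa> i)" "inj_on \<sigma> P"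
      "\<And>i j. i \<in> P \<Longrightarrow> j \<in> P \<Longrightarrow> i < j \<Longrightarrow> j \<le> i + p \<Longrightarrow> E (\<sigma> i) (\<sigma> j)"
    and sep: "\<And>i j. i \<in> I \<Longrightarrow> j \<in> I \<Longrightarrow> i < j \<Longrightarrow> j \<le> i + p \<Longrightarrow> \<kappa> i = \<kappa> j \<Longrightarrow> i \<in> P \<and> j \<in> P"
  shows "has_power p k (\<Union>i<c. V i) E"
proof -
  obtain \<phi> where \<phi>: "inj_on \<phi> I" "\<forall>i\<in>I. \<phi> i \<in> V (\<kappa> i)"
    "\<forall>i\<in>I. \<forall>j\<in>I. i < j \<longrightarrow> j \<le> i + p \<longrightarrow> E (\<phi> i) (\<phi> j)"
  proof -
    have "finite I" "card I \<le> k" using I(1) by simp_all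
    from richsys_embed[OF E rs this I(2) \<kappa> \<sigma> sep] show thesis using that by blast
  qed
  let ?\<psi> = "\<lambda>i. \<phi> (e + i)"
  have "inj_on ?\<psi> {..<k}"
    by (rule inj_onI) (use inj_onD[OF \<phi>(1)] in \<open>force simp: I\<close>)
  moreover have "?\<psi> ` {..<k} \<subseteq> (\<Union>i<c. V i)" using \<phi>(2) \<kappa> by (force simp: I)
  ultimately show ?thesis unfolding has_power_def using \<phi>(3) by (intro exI[of _ ?\<psi>]) (auto simp: I)
qed

text \<open>Cut into blocks of length \<open>d > p\<close>, positions at distance at most
  \<open>p\<close> lie in the same or in consecutive blocks, and in the latter case the residue
  drops by at least \<open>d - p\<close>. Every periodic choice of classes is verified through this
  distinction.\<close>

lemma near_divmod:
  fixes i j d p :: nat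
  assumes "i < j" "j \<le> i + p" "p < d"
  shows "(j div d = i div d \<and> i mod d < j mod d) \<or> (j div d = Suc (i div d) \<and> j mod d + d \<le> i mod d + p)"
proof -
  define a r where "a = i div d" and "r = i mod d"
  define b r' where "b = j div d" and "r' = j mod d"
  have i: "i = a * d + r" and j: "j = b * d + r'" by (simp_all add: a_def r_def b_def r'_def)
  have d: "d > 0" using assms by simp
  have "a \<le> b" unfolding a_def b_def using assms by (simp add: div_le_mono)
  moreover have "b \<le> (i + d) div d" unfolding b_def using assms by (intro div_le_mono) simp
  then have "b \<le> Suc a" using d by (simp add: a_def)
  ultimately consider "b = a" | "b = Suc a" by linarith
  then have "(b = a \<and> r < r') \<or> (b = Suc a \<and> r' + d \<le> r + p)"
  proof cases
    case 1 then show ?thesis using assms(1) i j by simp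
  next
    case 2
    then have "a * d + d + r' \<le> a * d + r + p" using assms(2) i j by simp
    then show ?thesis using 2 by simp
  qed
  then show ?thesis by (simp add: a_def b_def r_def r'_def)
qed

text \<open>Residues modulo \<open>p + 1\<close> colour the power properly, so with
  \<open>p + 1\<close> classes nothing is embedded by hand and \<open>P\<close> is empty.\<close>

lemma richsys_Suc_has_power:
  assumes "graph_rel E" "richsys E (p + 1) k V F"
  shows "has_power p k (\<Union>i<p+1. V i) E"
proof (rule richsys_has_power[OF assms, where e = 0 and P = "{}" and \<kappa> = "\<lambda>i. i mod (p+1)" and I = "{0..<0+k}" and \<sigma> = "\<lambda>_. undefined"])
  fix i j assume "i < j" "j \<le> i + p" "i mod (p + 1) = j mod (p + 1)"
  then show "i \<in> {} \<and> j \<in> {}" using near_divmod[of i j p "p+1"] by auto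
qed auto

text \<open>Position \<open>i\<close> goes to the class of the path if \<open>i mod (p + 1)\<close> is \<open>p - 1\<close> or \<open>p\<close>, so that
  every period takes up two vertices of the path.\<close>

lemma richsys_path_has_power:
  fixes p q k b :: nat
  assumes E: "graph_rel E" and rs: "richsys E p k V F" and p: "p \<ge> 2" and c: "c < p" and b: "b \<le> 1"
    and k: "k + 1 = q * (p + 1) + p + b" and xs: "gpath (V c) E xs" "length xs = 2 * q + b"
  shows "has_power p k (\<Union>i<p. V i) E"
proof -
  define \<tau> where "\<tau> = transpose 0 c"
  have \<tau>: "inj_on \<tau> {..<p}" "\<tau> ` {..<p} \<subseteq> {..<p}" "\<tau> 0 = c"
    using c p by (auto simp: \<tau>_def transpose_def inj_on_def)
  define d where "d = p + 1"
  \<comment> \<open>After relabelling by \<tau>, class 0 contains the path; the residues below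
    \<open>p - 1\<close> occupy the other \<open>p - 1\<close> classes, one each.\<close>
  define \<kappa> where "\<kappa> = (\<lambda>i. if p - 1 \<le> i mod d then 0 else i mod d + 1)"
  define \<sigma> where "\<sigma> = (\<lambda>i. xs ! (2 * (i div d) + (i mod d - (p - 1))))"
  define P where "P = {i. i < k \<and> p - 1 \<le> i mod d}"
  have md: "i mod d < d" for i using p by (simp add: d_def)
  \<comment> \<open>As \<open>k = q * (p + 1) + (p - 1 + b)\<close>, the \<open>q\<close> full
    periods use two vertices of the path each, and the incomplete one has exactly \<open>b\<close>
    residues from \<open>p - 1\<close> on; in total \<open>2 * q + b\<close>.\<close>
  have idx: "2 * (i div d) + (i mod d - (p - 1)) < length xs" if i: "i \<in> P" for i
  proof -
    define n r where "n = i div d" and "r = i mod d"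
    have inr: "i = n * d + r" by (simp add: n_def r_def)
    have r: "p - 1 \<le> r" "r < d" using i md by (auto simp: P_def r_def)
    have lt: "n * d + r + 1 < q * d + p + b" using i k inr by (simp add: P_def d_def)
    have "n \<le> q"
    proof (rule ccontr)
      assume "\<not> n \<le> q"
      then have "(q + 1) * d \<le> n * d" by (intro mult_le_mono1) simp
      then show False using lt r b p by (simp add: d_def)
    qed
    moreover have "n < q" if "n \<noteq> q" using that calculation by simp
    moreover have "r < p - 1 + b" if "n = q" using lt that by simp
    ultimately have "2 * n + (r - (p - 1)) < 2 * q + b" using r p b
      by (cases "n = q") (auto simp: d_def)
    then show ?thesis by (simp add: n_def r_def xs)
  qed
  have inj: "inj_on \<sigma> P"
  proof (rule inj_onI)
    fix i j assume i: "i \<in> P" and j: "j \<in> P" and "\<sigma> i = \<sigma> j"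
    then have "2 * (i div d) + (i mod d - (p - 1)) = 2 * (j div d) + (j mod d - (p - 1))"
      using idx xs by (simp add: \<sigma>_def gpath_def nth_eq_iff_index_eq)
    note e = this
    have gen: "a = a' \<and> x = y" if "2 * a + x = 2 * a' + y" "x < 2" "y < 2" for a a' x y :: nat
      using that by presburger
    have "i mod d - (p-1) < 2" "j mod d - (p-1) < 2" using md[of i] md[of j] p d_def by linarith+
    then have "i div d = j div d" "i mod d - (p - 1) = j mod d - (p - 1)" using gen[OF e] by blast+
    moreover have "p - 1 \<le> i mod d" "p - 1 \<le> j mod d" using i j by (auto simp: P_def)
    ultimately show "i = j" by (metis div_mod_decomp le_add_diff_inverse)
  qed
  have inV: "\<sigma> i \<in> (V \<circ> \<tau>) (\<kappa> i)" if "i \<in> P" for i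
    using idx[OF that] that xs \<tau> by (auto simp: \<sigma>_def P_def \<kappa>_def gpath_def)
  have adj: "E (\<sigma> i) (\<sigma> j)" if ij: "i \<in> P" "j \<in> P" "i < j" "j \<le> i + p" for i j
  proof -
    \<comment> \<open>The only pairs of positions in \<open>P\<close> at distance at most
      \<open>p\<close> are residues \<open>p - 1\<close> and \<open>p\<close> of one period, and
      residue \<open>p\<close> with residue \<open>p - 1\<close> of the next; in both cases the
      index on the path grows by one.\<close>
    have "2 * (j div d) + (j mod d - (p - 1)) = Suc (2 * (i div d) + (i mod d - (p - 1)))"
    proof -
      have "i mod d \<le> p" "j mod d \<le> p" using md[of i] md[of j] d_def by linarith+
      moreover have "p - 1 \<le> i mod d" "p - 1 \<le> j mod d" using ij(1,2) by (simp_all add: P_def)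
      moreover have "j div d = i div d \<and> i mod d < j mod d \<or> j div d = Suc (i div d) \<and> j mod d + 1 \<le> i mod d"
        using near_divmod[OF ij(3,4), of d] d_def by linarith
      ultimately show ?thesis using p by arith
    qed
    then show ?thesis using idx[OF ij(2)] xs by (simp add: \<sigma>_def gpath_def successively_conv_nth)
  qed
  have "has_power p k (\<Union>i<p. (V \<circ> \<tau>) i) E"
  proof (rule richsys_has_power[OF E richsys_permute[OF rs \<tau>(1,2)], where e = 0 and P = P and \<kappa> = \<kappa> and \<sigma> = \<sigma> and I = "{0..<0+k}"])
    fix i j assume "i \<in> {0..<0+k}" "j \<in> {0..<0+k}" "i < j" "j \<le> i + p" "\<kappa> i = \<kappa> j"
    then show "i \<in> P \<and> j \<in> P" using near_divmod[of i j p d] by (auto simp: P_def d_def \<kappa>_def split: if_splits)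
  qed (use inV inj adj p in \<open>auto simp: P_def \<kappa>_def\<close>)
  then show ?thesis by (rule has_power_mono) (use \<tau> in auto)
qed

lemma exists_relabelling:
  fixes p c c' :: nat
  assumes "2 \<le> p" "c < p" "c' < p" "c \<noteq> c'"
  obtains \<tau> where "inj_on \<tau> {..<p}" "\<tau> ` {..<p} \<subseteq> {..<p}" "\<tau> 0 = c" "\<tau> 1 = c'"
proof -
  define x where "x = transpose 0 c c'"
  have x: "x < p" "x \<noteq> 0" "transpose 0 c x = c'"
    using assms by (auto simp: x_def transpose_def)
  define \<tau> where "\<tau> = transpose 0 c \<circ> transpose 1 x"
  have "inj \<tau>" unfolding \<tau>_def by (intro inj_compose inj_transpose)
  then have 1: "inj_on \<tau> {..<p}" by (rule inj_on_subset) simp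
  have "transpose a b i < p" if "a < p" "b < p" "i < p" for a b i :: nat
    using that by (auto simp: transpose_def)
  then have 2: "\<tau> ` {..<p} \<subseteq> {..<p}" using assms x by (auto simp: \<tau>_def)
  have 3: "\<tau> 0 = c" "\<tau> 1 = c'" using x by (auto simp: \<tau>_def transpose_def)
  from that[OF 1 2 3] show thesis .
qed

text \<open>With edges in two classes the period can be \<open>p + 2\<close>: two vertices in each of these two classes
  and one in every other class.\<close>

lemma richsys_edges_has_power:
  fixes p k :: nat
  assumes E: "graph_rel E" and rs: "richsys E p k V F" and p: "p \<ge> 2"
    and c: "c < p" "c' < p" "c \<noteq> c'"
    and A: "\<And>n. n < k \<Longrightarrow> a n \<in> V c \<and> a' n \<in> V c \<and> E (a n) (a' n)"
    and B: "\<And>n. n < k \<Longrightarrow> b n \<in> V c' \<and> b' n \<in> V c' \<and> E (b n) (b' n)"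
    and inj: "inj_on a {..<k}" "inj_on a' {..<k}" "a ` {..<k} \<inter> a' ` {..<k} = {}"
             "inj_on b {..<k}" "inj_on b' {..<k}" "b ` {..<k} \<inter> b' ` {..<k} = {}"
    and cross: "\<And>m n. m < k \<Longrightarrow> n < k \<Longrightarrow> E (a m) (b n) \<and> E (a m) (b' n) \<and> E (a' m) (b n) \<and> E (a' m) (b' n)"
  shows "has_power p k (\<Union>i<p. V i) E"
proof -
  obtain \<tau> where \<tau>: "inj_on \<tau> {..<p}" "\<tau> ` {..<p} \<subseteq> {..<p}" "\<tau> 0 = c" "\<tau> 1 = c'"
    using exists_relabelling[OF p c] .
  \<comment> \<open>Residues 0 and 1 form an edge in class 0, residues 2 and 3 one in class 1, and
    the residues from 4 to \<open>p + 1\<close> take up the classes from 2 to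
    \<open>p - 1\<close>.\<close>
  define d where "d = p + 2"
  define \<kappa> where "\<kappa> = (\<lambda>i. if i mod d < 2 then 0 else if i mod d < 4 then 1 else i mod d - 2)"
  define \<sigma> where "\<sigma> = (\<lambda>i. if i mod d = 0 then a (i div d) else if i mod d = 1 then a' (i div d)
     else if i mod d = 2 then b (i div d) else b' (i div d))"
  define P where "P = {i. i < k \<and> i mod d < 4}"
  have md: "i mod d < d" for i using p by (simp add: d_def)
  have nk: "i div d < k" if "i < k" for i using that div_le_dividend[of i d] by linarith
  have sym: "E u v \<Longrightarrow> E v u" for u v using graph_relD(1)[OF E] .
  have disj: "V c \<inter> V c' = {}" using rs c by (simp add: richsys_def)
  have i4: "i mod d = 0 \<or> i mod d = 1 \<or> i mod d = 2 \<or> i mod d = 3" if "i \<in> P" for i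
    using that by (auto simp: P_def)
  have injP: "inj_on \<sigma> P"
  proof (rule inj_onI)
    fix i j assume i: "i \<in> P" and j: "j \<in> P" and eq: "\<sigma> i = \<sigma> j"
    have ik: "i div d < k" "j div d < k" using i j nk by (auto simp: P_def)
    have ne: "a m \<noteq> a' n" "b m \<noteq> b' n" "a m \<noteq> b n" "a m \<noteq> b' n" "a' m \<noteq> b n" "a' m \<noteq> b' n" if "m < k" "n < k" for m n
      using that inj A[of m] A[of n] B[of n] disj by auto
    have "i mod d = j mod d \<and> i div d = j div d"
      using i4[OF i] i4[OF j] eq ik ne[of "i div d" "j div d"] ne[of "j div d" "i div d"] inj
      by (elim disjE) (auto simp: \<sigma>_def inj_on_def)
    then show "i = j" by (metis div_mod_decomp)
  qed
  have inV: "\<sigma> i \<in> (V \<circ> \<tau>) (\<kappa> i)" if "i \<in> P" for i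
    using i4[OF that] A[of "i div d"] B[of "i div d"] nk[of i] that \<tau>
    by (elim disjE) (auto simp: \<sigma>_def P_def \<kappa>_def)
  have adj: "E (\<sigma> i) (\<sigma> j)" if ij: "i \<in> P" "j \<in> P" "i < j" "j \<le> i + p" for i j
  proof -
    have ik: "i div d < k" "j div d < k" using ij nk by (auto simp: P_def)
    \<comment> \<open>Between consecutive periods the residue must drop by at least 2, so residue 1
      and the next 0, or residue 3 and the next 2, are too far apart to require an edge. This is why
      disjoint edges suffice instead of paths.\<close>
    have nd: "(j div d = i div d \<and> i mod d < j mod d) \<or> (j div d = Suc (i div d) \<and> j mod d + 2 \<le> i mod d)"
      using near_divmod[OF ij(3,4), of d] by (auto simp: d_def)
    consider "i mod d = 0" "j mod d = 1" "j div d = i div d" | "i mod d = 2" "j mod d = 3" "j div d = i div d"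
      | "i mod d < 2" "2 \<le> j mod d" | "2 \<le> i mod d" "j mod d < 2"
      using i4[OF ij(1)] i4[OF ij(2)] nd by linarith
    then show ?thesis
    proof cases
      case 1 then show ?thesis using A[OF ik(1)] by (simp add: \<sigma>_def)
    next
      case 2 then show ?thesis using B[OF ik(1)] by (simp add: \<sigma>_def)
    next
      case 3
      then have "\<sigma> i = a (i div d) \<or> \<sigma> i = a' (i div d)" "\<sigma> j = b (j div d) \<or> \<sigma> j = b' (j div d)"
        by (auto simp: \<sigma>_def)
      then show ?thesis using cross[OF ik] by auto
    next
      case 4
      then have "\<sigma> j = a (j div d) \<or> \<sigma> j = a' (j div d)" "\<sigma> i = b (i div d) \<or> \<sigma> i = b' (i div d)"
        by (auto simp: \<sigma>_def)
      then have "E (\<sigma> j) (\<sigma> i)" using cross[OF ik(2,1)] by auto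
      then show ?thesis by (rule sym)
    qed
  qed
  have "has_power p k (\<Union>i<p. (V \<circ> \<tau>) i) E"
  proof (rule richsys_has_power[OF E richsys_permute[OF rs \<tau>(1,2)], where e = 0 and P = P and \<kappa> = \<kappa> and \<sigma> = \<sigma> and I = "{0..<0+k}"])
    fix i j assume ij: "i \<in> {0..<0+k}" "j \<in> {0..<0+k}" "i < j" "j \<le> i + p" "\<kappa> i = \<kappa> j"
    have "(j div d = i div d \<and> i mod d < j mod d) \<or> (j div d = Suc (i div d) \<and> j mod d + 2 \<le> i mod d)"
      using near_divmod[OF ij(3,4), of d] by (auto simp: d_def)
    then show "i \<in> P \<and> j \<in> P" using ij by (auto simp: P_def \<kappa>_def split: if_splits)
  next
    fix i
    have "i mod d < p + 2" using md[of i] d_def by linarith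
    then show "\<kappa> i < p" using p by (auto simp: \<kappa>_def)
  qed (use inV injP adj in \<open>auto simp: P_def\<close>)
  then show ?thesis by (rule has_power_mono) (use \<tau> in auto)
qed

text \<open>The periods up to number \<open>h\<close> traverse \<open>xs\<close> backwards (residues \<open>p\<close> and \<open>0\<close>), the later ones
  traverse \<open>ys\<close> (residues \<open>p - 1\<close> and \<open>p\<close>); both paths meet in period \<open>h\<close>, where the edges in
  \<open>link\<close> are used. If \<open>xs\<close> has even length, the first position is cut off (\<open>e = 1\<close>).\<close>

lemma richsys_link_has_power:
  fixes p q k b :: nat
  assumes E: "graph_rel E" and rs: "richsys E p k V F" and p: "p \<ge> 2"
    and c: "c < p" "c' < p" "c \<noteq> c'" and b: "b \<le> 1"
    and k: "k + 1 = q * (p + 1) + p + b"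
    and xs: "gpath (V c) E xs" "2 \<le> length xs" and ys: "gpath (V c') E ys" "2 \<le> length ys"
    and len: "length xs + length ys = 2 * q + b + 1"
    and link: "E (xs ! 0) (ys ! 0)" "E (xs ! 1) (ys ! 0)" "E (xs ! 0) (ys ! 1)"
  shows "has_power p k (\<Union>i<p. V i) E"
proof -
  obtain \<tau> where \<tau>: "inj_on \<tau> {..<p}" "\<tau> ` {..<p} \<subseteq> {..<p}" "\<tau> 0 = c" "\<tau> 1 = c'"
    using exists_relabelling[OF p c] .
  define d where "d = p + 1"
  \<comment> \<open>\<open>xs\<close> has \<open>2 * h\<close> or \<open>2 * h + 1\<close> vertices.
    Position 0 would carry \<open>xs ! (2 * h)\<close>, which is missing exactly for even length;
    then the embedding starts at \<open>e = 1\<close>.\<close>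
  define h where "h = length xs div 2"
  define e where "e = (if even (length xs) then 1 else 0 :: nat)"
  have lx: "length xs + e = 2 * h + 1" by (auto simp: h_def e_def)
  have ly: "length ys + 2 * h = 2 * q + b + e" using len lx by simp
  have e1: "e \<le> 1" by (simp add: e_def)
  define \<kappa> where "\<kappa> = (\<lambda>i. let n = i div d; r = i mod d in
     if r = 0 then 0 else if r = p - 1 then 1 else if r = p then (if n < h then 0 else 1) else r + 1)"
  \<comment> \<open>At the switch, \<open>xs ! 1\<close> sits at residue \<open>p\<close> of period
    \<open>h - 1\<close>, and \<open>xs ! 0\<close>, \<open>ys ! 0\<close>, \<open>ys ! 1\<close>
    sit at residues 0, \<open>p - 1\<close> and \<open>p\<close> of period \<open>h\<close>. Of the
    four pairs between the two paths only \<open>xs ! 1\<close> and \<open>ys ! 1\<close> are more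
    than \<open>p\<close> apart, which explains the three edges in \<open>link\<close>.\<close>
  define \<sigma> where "\<sigma> = (\<lambda>i. let n = i div d; r = i mod d in
     if r = 0 then xs ! (2 * (h - n)) else if r = p \<and> n < h then xs ! (2 * (h - n) - 1)
     else if r = p - 1 then ys ! (2 * (n - h)) else ys ! (2 * (n - h) + 1))"
  \<comment> \<open>Residue 0 after period \<open>h\<close> and residue \<open>p - 1\<close> before
    it keep their classes but are filled greedily, since the path in that class has ended or has not
    begun.\<close>
  define P where "P = {i. e \<le> i \<and> i < e + k \<and>
     (i mod d = 0 \<and> i div d \<le> h \<or> i mod d = p - 1 \<and> h \<le> i div d \<or> i mod d = p)}"
  have md: "i mod d < d" for i by (simp add: d_def)
  have pp: "p \<noteq> p - Suc 0" "p - Suc 0 \<noteq> p" "p - Suc 0 \<noteq> 0" "p \<noteq> 0" using p by auto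
  have sym: "E u v \<Longrightarrow> E v u" for u v using graph_relD(1)[OF E] .
  have disj: "V c \<inter> V c' = {}" using rs c by (simp add: richsys_def)
  have adjx: "E (xs ! m) (xs ! Suc m)" if "Suc m < length xs" for m
    using xs that by (auto simp: gpath_def successively_conv_nth)
  have adjy: "E (ys ! m) (ys ! Suc m)" if "Suc m < length ys" for m
    using ys that by (auto simp: gpath_def successively_conv_nth)
  have Pcases: thesis if i: "i \<in> P"
    and 1: "i mod d = 0 \<Longrightarrow> i div d \<le> h \<Longrightarrow> \<sigma> i = xs ! (2 * (h - i div d)) \<Longrightarrow>
              2 * (h - i div d) < length xs \<Longrightarrow> \<kappa> i = 0 \<Longrightarrow> thesis"
    and 2: "i mod d = p \<Longrightarrow> i div d < h \<Longrightarrow> \<sigma> i = xs ! (2 * (h - i div d) - 1) \<Longrightarrow>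
              2 * (h - i div d) - 1 < length xs \<Longrightarrow> \<kappa> i = 0 \<Longrightarrow> thesis"
    and 3: "i mod d = p - 1 \<Longrightarrow> h \<le> i div d \<Longrightarrow> \<sigma> i = ys ! (2 * (i div d - h)) \<Longrightarrow>
              2 * (i div d - h) < length ys \<Longrightarrow> \<kappa> i = 1 \<Longrightarrow> thesis"
    and 4: "i mod d = p \<Longrightarrow> h \<le> i div d \<Longrightarrow> \<sigma> i = ys ! (2 * (i div d - h) + 1) \<Longrightarrow>
              2 * (i div d - h) + 1 < length ys \<Longrightarrow> \<kappa> i = 1 \<Longrightarrow> thesis"
    for i thesis
  proof -
    define n r where "n = i div d" and "r = i mod d"
    have inr: "i = n * d + r" by (simp add: n_def r_def)
    have lo: "e \<le> n * d + r" and hi: "n * d + r + 1 < e + q * d + p + b"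
      using i k inr by (auto simp: P_def d_def)
    have nq: "n \<le> q" if "n * d < q * d + d"
    proof (rule ccontr)
      assume "\<not> n \<le> q"
      then have "(q + 1) * d \<le> n * d" by (intro mult_le_mono1) simp
      then show False using that by simp
    qed
    have nq': "n < q" if "n * d < q * d" using that by simp
    consider "r = 0" "n \<le> h" | "r = p" "n < h" | "r = p - 1" "h \<le> n" | "r = p" "h \<le> n"
      using i by (auto simp: P_def n_def r_def) linarith
    then show ?thesis
    proof cases
      case 1
      then have "2 * (h - n) < length xs" using lx lo e1 by (cases "n = 0") auto
      then show ?thesis using that(2) 1 by (simp add: \<sigma>_def \<kappa>_def Let_def n_def r_def)
    next
      case 2
      then have "2 * (h - n) - 1 < length xs" using lx e1 by simp
      then show ?thesis using that(3) 2 pp by (simp add: \<sigma>_def \<kappa>_def Let_def n_def r_def)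
    next
      case 3
      have "2 * n < 2 * q + b + e"
      proof (cases "b + e = 0")
        case True
        then have "n * d < q * d" using hi 3 p by linarith
        then have "n < q" by (rule nq')
        then show ?thesis by linarith
      next
        case False
        have "n * d < q * d + d" using hi 3 p b e1 d_def by linarith
        then have "n \<le> q" by (rule nq)
        then show ?thesis using False by linarith
      qed
      then have "2 * (n - h) < length ys" using ly 3 by simp
      then show ?thesis using that(4) 3 pp by (simp add: \<sigma>_def \<kappa>_def Let_def n_def r_def)
    next
      case 4
      have "2 * n + 1 < 2 * q + b + e"
      proof (cases "b + e = 2")
        case True
        have "n * d < q * d + d" using hi 4 p b e1 d_def by linarith
        then have "n \<le> q" by (rule nq)
        then show ?thesis using True by linarith
      next
        case False
        then have "b + e \<le> 1" using b e1 by simp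
        then have "n * d < q * d" using hi 4 p by linarith
        then have "n < q" by (rule nq')
        then show ?thesis by linarith
      qed
      then have "2 * (n - h) + 1 < length ys" using ly 4 by simp
      then show ?thesis using that(5) 4 pp by (simp add: \<sigma>_def \<kappa>_def Let_def n_def r_def)
    qed
  qed
  have xnth: "xs ! m \<in> V c" if "m < length xs" for m using xs that by (auto simp: gpath_def)
  have ynth: "ys ! m \<in> V c'" if "m < length ys" for m using ys that by (auto simp: gpath_def)
  have xeq: "xs ! m = xs ! n \<longleftrightarrow> m = n" if "m < length xs" "n < length xs" for m n
    using xs that by (simp add: gpath_def nth_eq_iff_index_eq)
  have yeq: "ys ! m = ys ! n \<longleftrightarrow> m = n" if "m < length ys" "n < length ys" for m n
    using ys that by (simp add: gpath_def nth_eq_iff_index_eq)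
  have xy: "xs ! m \<noteq> ys ! n" if "m < length xs" "n < length ys" for m n
    using xnth[OF that(1)] ynth[OF that(2)] disj by auto
  have key: "(\<exists>m<length xs. \<sigma> i = xs ! m \<and> i mod d = (if even m then 0 else p) \<and> i div d = h - (m + 1) div 2) \<or>
      (\<exists>m<length ys. \<sigma> i = ys ! m \<and> i mod d = (if even m then p - 1 else p) \<and> i div d = h + m div 2)"
    if i: "i \<in> P" for i
  proof (cases rule: Pcases[OF i])
    case 1
    then show ?thesis by (intro disjI1 exI[of _ "2 * (h - i div d)"]) simp
  next
    case 2
    then have "odd (2 * (h - i div d) - 1)" "(2 * (h - i div d) - 1 + 1) div 2 = h - i div d" by auto
    then show ?thesis using 2 by (intro disjI1 exI[of _ "2 * (h - i div d) - 1"]) simp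
  next
    case 3
    then show ?thesis by (intro disjI2 exI[of _ "2 * (i div d - h)"]) simp
  next
    case 4
    then show ?thesis by (intro disjI2 exI[of _ "2 * (i div d - h) + 1"]) simp
  qed
  have injP: "inj_on \<sigma> P"
  proof (rule inj_onI)
    fix i j assume i: "i \<in> P" and j: "j \<in> P" and eq: "\<sigma> i = \<sigma> j"
    have "i mod d = j mod d \<and> i div d = j div d"
      using key[OF i] key[OF j] eq xeq yeq xy by metis
    then show "i = j" by (metis div_mod_decomp)
  qed
  have inV: "\<sigma> i \<in> (V \<circ> \<tau>) (\<kappa> i)" if i: "i \<in> P" for i
    using \<tau> xnth ynth by (cases rule: Pcases[OF i]) auto
  have adj: "E (\<sigma> i) (\<sigma> j)" if ij: "i \<in> P" "j \<in> P" "i < j" "j \<le> i + p" for i j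
  proof -
    have nd: "(j div d = i div d \<and> i mod d < j mod d) \<or> (j div d = Suc (i div d) \<and> j mod d < i mod d)"
      using near_divmod[OF ij(3,4), of d] by (auto simp: d_def)
    define m where "m = i div d"
    have x1: "E (xs ! (2 * (h - m))) (xs ! (2 * (h - m) - 1))"
      if "m < h" "2 * (h - m) < length xs"
    proof -
      have e: "2 * (h - m) = Suc (2 * (h - m) - 1)" using that by simp
      show ?thesis using adjx[of "2 * (h - m) - 1"] that sym e by metis
    qed
    have x2: "E (xs ! (2 * (h - m) - 1)) (xs ! (2 * (h - Suc m)))"
      if "m < h" "2 * (h - m) - 1 < length xs"
    proof -
      have "2 * (h - m) - 1 = Suc (2 * (h - Suc m))" using that by simp
      then show ?thesis using adjx[of "2 * (h - Suc m)"] that sym by metis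
    qed
    have y1: "E (ys ! (2 * (m - h))) (ys ! (2 * (m - h) + 1))" if "2 * (m - h) + 1 < length ys"
      using adjy[of "2 * (m - h)"] that by simp
    have y2: "E (ys ! (2 * (m - h) + 1)) (ys ! (2 * (Suc m - h)))"
      if "h \<le> m" "2 * (Suc m - h) < length ys"
    proof -
      have "2 * (Suc m - h) = Suc (2 * (m - h) + 1)" using that by simp
      then show ?thesis using adjy[of "2 * (m - h) + 1"] that by metis
    qed
    have l: "xs ! (2 * (h - m) - 1) = xs ! 1 \<and> ys ! (2 * (Suc m - h)) = ys ! 0" if "m < h" "h \<le> Suc m"
    proof -
      have "h - m = 1" "Suc m - h = 0" using that by auto
      then show ?thesis by simp
    qed
    show ?thesis
    proof (cases rule: Pcases[OF ij(1)])
      case 1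
      note i = this
      show ?thesis
      proof (cases rule: Pcases[OF ij(2)])
        case 1 then show ?thesis using i nd by auto
      next
        case 2
        then have "j div d = m" using i nd by (auto simp: m_def)
        then show ?thesis using 2 i x1 by (simp add: m_def)
      next
        case 3
        then have "j div d = m" "m = h" using i nd by (auto simp: m_def)
        then show ?thesis using 3 i link by (simp add: m_def)
      next
        case 4
        then have "j div d = m" "m = h" using i nd by (auto simp: m_def)
        then show ?thesis using 4 i link by (simp add: m_def)
      qed
    next
      case 2
      note i = this
      show ?thesis
      proof (cases rule: Pcases[OF ij(2)])
        case 1
        then have "j div d = Suc m" using i nd p by (auto simp: m_def)
        then show ?thesis using 1 i x2 by (simp add: m_def)
      next
        case 2 then show ?thesis using i nd by auto
      next
        case 3
        then have "j div d = Suc m" using i nd p by (auto simp: m_def)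
        then show ?thesis using 3 i link l by (simp add: m_def)
      next
        case 4 then show ?thesis using i nd by auto
      qed
    next
      case 3
      note i = this
      show ?thesis
      proof (cases rule: Pcases[OF ij(2)])
        case 1 then show ?thesis using i nd by auto
      next
        case 2 then show ?thesis using i nd p by auto
      next
        case 3 then show ?thesis using i nd by auto
      next
        case 4
        then have "j div d = m" using i nd p by (auto simp: m_def)
        then show ?thesis using 4 i y1 by (simp add: m_def)
      qed
    next
      case 4
      note i = this
      show ?thesis
      proof (cases rule: Pcases[OF ij(2)])
        case 1 then show ?thesis using i nd by auto
      next
        case 2 then show ?thesis using i nd by auto
      next
        case 3
        then have "j div d = Suc m" using i nd p by (auto simp: m_def)
        then show ?thesis using 3 i y2 by (simp add: m_def)
      next
        case 4 then show ?thesis using i nd by auto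
      qed
    qed
  qed
  \<comment> \<open>\<open>cl\<close> and \<open>sp\<close> express \<kappa> and membership in
    \<open>P\<close> by period and residue alone. Equal classes can then occur only between residue
    \<open>p\<close> and residue 0 or \<open>p - 1\<close>, and the position of the period relative
    to \<open>h\<close> makes both of them hand-placed.\<close>
  define cl where "cl n r = (if r = 0 then 0 else if r = p - 1 then 1 else if r = p then if n < h then 0 else 1 else r + 1)" for n r
  define sp where "sp n r \<longleftrightarrow> r = 0 \<and> n \<le> h \<or> r = p - 1 \<and> h \<le> n \<or> r = p" for n r
  have cl0: "cl n 0 = 0" "cl n (p - 1) = 1" "cl n p = (if n < h then 0 else 1)" for n
    using pp by (simp_all add: cl_def)
  have cl1: "cl n r = r + 1" if "0 < r" "r < p - 1" for n r using that by (simp add: cl_def)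
  have sepgen: "sp n r \<and> sp n' r'"
    if H: "cl n r = cl n' r'" "n' = n \<and> r < r' \<or> n' = Suc n \<and> r' < r" "r \<le> p" "r' \<le> p" for n r n' r'
  proof -
    have r4: "r = 0 \<or> (0 < r \<and> r < p - 1) \<or> r = p - 1 \<or> r = p" using H(3) by linarith
    have r4': "r' = 0 \<or> (0 < r' \<and> r' < p - 1) \<or> r' = p - 1 \<or> r' = p" using H(4) by linarith
    have A: "\<not> (0 < r \<and> r < p - 1)"
    proof
      assume r: "0 < r \<and> r < p - 1"
      then have "cl n' r' = r + 1" using cl1 H(1) by simp
      then show False using r4' r cl0[of n'] cl1[of r' n'] H(2) by (elim disjE) (auto split: if_splits)
    qed
    have B: "\<not> (0 < r' \<and> r' < p - 1)"
    proof
      assume r: "0 < r' \<and> r' < p - 1"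
      then have "cl n r = r' + 1" using cl1 H(1) by simp
      then show False using r4 r cl0[of n] cl1[of r n] H(2) by (elim disjE) (auto split: if_splits)
    qed
    have "r = 0 \<or> r = p - 1 \<or> r = p" "r' = 0 \<or> r' = p - 1 \<or> r' = p" using r4 r4' A B by blast+
    moreover have "r \<noteq> r'" using H(2) by blast
    ultimately have "r = 0 \<and> r' = p \<or> r = p - 1 \<and> r' = p \<or> r = p \<and> r' = 0 \<or> r = p \<and> r' = p - 1 \<or>
        r = 0 \<and> r' = p - 1 \<or> r = p - 1 \<and> r' = 0"
      by (elim disjE) simp_all
    then consider "r = 0" "r' = p" | "r = p - 1" "r' = p" | "r = p" "r' = 0" | "r = p" "r' = p - 1"
      | "r = 0" "r' = p - 1" | "r = p - 1" "r' = 0"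
      by blast
    then show ?thesis
    proof cases
      case 1
      have n': "n' = n" using H(2) 1 by linarith
      have "cl n 0 = cl n p" using H(1) unfolding 1 n' .
      then have "n < h" unfolding cl0 by (metis zero_neq_one)
      then show ?thesis unfolding 1 n' sp_def by simp
    next
      case 2
      have n': "n' = n" using H(2) 2 p by linarith
      have "cl n (p - 1) = cl n p" using H(1) unfolding 2 n' .
      then have "h \<le> n" unfolding cl0 by (metis not_le zero_neq_one)
      then show ?thesis unfolding 2 n' sp_def by simp
    next
      case 3
      have n': "n' = Suc n" using H(2) 3 by linarith
      have "cl n p = cl (Suc n) 0" using H(1) unfolding 3 n' .
      then have "n < h" unfolding cl0 by (metis zero_neq_one)
      then show ?thesis unfolding 3 n' sp_def by simp
    next
      case 4
      have n': "n' = Suc n" using H(2) 4 p by linarith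
      have "cl n p = cl (Suc n) (p - 1)" using H(1) unfolding 4 n' .
      then have "h \<le> n" unfolding cl0 by (metis not_le zero_neq_one)
      then show ?thesis unfolding 4 n' sp_def by simp
    next
      case 5
      have "cl n r = 0" "cl n' r' = 1" unfolding 5 by (rule cl0)+
      then have False using H(1) by linarith
      then show ?thesis ..
    next
      case 6
      have "cl n r = 1" "cl n' r' = 0" unfolding 6 by (rule cl0)+
      then have False using H(1) by linarith
      then show ?thesis ..
    qed
  qed
  have "has_power p k (\<Union>i<p. (V \<circ> \<tau>) i) E"
  proof (rule richsys_has_power[OF E richsys_permute[OF rs \<tau>(1,2)], where e = e and P = P and \<kappa> = \<kappa> and \<sigma> = \<sigma> and I = "{e..<e+k}"])
    fix i j assume ij: "i \<in> {e..<e+k}" "j \<in> {e..<e+k}" "i < j" "j \<le> i + p" "\<kappa> i = \<kappa> j"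
    have "(j div d = i div d \<and> i mod d < j mod d) \<or> (j div d = Suc (i div d) \<and> j mod d < i mod d)"
      using near_divmod[OF ij(3,4), of d] by (auto simp: d_def)
    moreover have "i mod d \<le> p" "j mod d \<le> p" using md[of i] md[of j] d_def by linarith+
    ultimately show "i \<in> P \<and> j \<in> P"
      using ij(1,2) sepgen[of "i div d" "i mod d" "j div d" "j mod d"] ij(5)
      by (simp add: P_def \<kappa>_def Let_def cl_def sp_def)
  next
    fix i
    have "i mod d < p + 1" using md[of i] d_def by linarith
    then show "\<kappa> i < p" using p by (auto simp: \<kappa>_def Let_def)
  qed (use inV injP adj in \<open>auto simp: P_def\<close>)
  then show ?thesis by (rule has_power_mono) (use \<tau> in auto)
qed

subsection \<open>Extremal numbers and the lower bound\<close>

abbreviation adj :: "'a graph \<Rightarrow> 'a \<Rightarrow> 'a \<Rightarrow> bool" where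
  "adj G u v \<equiv> {u, v} \<in> edges G"

abbreviation (input) path_power :: "nat \<Rightarrow> nat \<Rightarrow> nat graph" where
  "path_power p k \<equiv> graph_power (path_graph k) p"

lemma graph_rel_adj: "simple_graph G \<Longrightarrow> graph_rel (adj G)"
  by (auto simp: graph_rel_def simple_graph_def insert_commute)

lemma degsum_eq_card_edges:
  assumes "finite V" "graph_rel E"
  shows "degsum V E = 2 * card {{u, v} | u v. u \<in> V \<and> v \<in> V \<and> E u v}"
proof -
  let ?Ed = "{{u, v} | u v. u \<in> V \<and> v \<in> V \<and> E u v}"
  have "?Ed \<subseteq> Pow V" by auto
  then have fin: "finite ?Ed" by (rule finite_subset) (simp add: assms)
  have deg: "card (nbh V E v) = card {e \<in> ?Ed. v \<in> e}" if "v \<in> V" for v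
  proof (rule bij_betw_same_card[of "\<lambda>u. {v, u}"])
    show "bij_betw (\<lambda>u. {v, u}) (nbh V E v) {e \<in> ?Ed. v \<in> e}"
      unfolding bij_betw_def
    proof
      show "inj_on (\<lambda>u. {v, u}) (nbh V E v)" by (auto simp: inj_on_def doubleton_eq_iff)
      show "(\<lambda>u. {v, u}) ` nbh V E v = {e \<in> ?Ed. v \<in> e}"
      proof (intro set_eqI iffI)
        fix e assume "e \<in> (\<lambda>u. {v, u}) ` nbh V E v"
        then show "e \<in> {e \<in> ?Ed. v \<in> e}" using that by (auto simp: nbh_def)
      next
        fix e assume "e \<in> {e \<in> ?Ed. v \<in> e}"
        then obtain a b where ab: "e = {a, b}" "a \<in> V" "b \<in> V" "E a b" "v \<in> e" by blast
        then consider "v = a" | "v = b" by auto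
        then show "e \<in> (\<lambda>u. {v, u}) ` nbh V E v"
        proof cases
          case 1 then show ?thesis using ab by (auto simp: nbh_def)
        next
          case 2
          then have "e = {v, a}" "a \<in> nbh V E v" using ab graph_relD(1)[OF assms(2)]
            by (auto simp: nbh_def)
          then show ?thesis by blast
        qed
      qed
    qed
  qed
  have "degsum V E = (\<Sum>v\<in>V. card {e \<in> ?Ed. v \<in> e})"
    unfolding degsum_def by (rule sum.cong[OF refl deg])
  also have "\<dots> = (\<Sum>e\<in>?Ed. 2)"
  proof (rule sum_multicount_gen[OF assms(1) fin])
    show "\<forall>e\<in>?Ed. card {v \<in> V. v \<in> e} = 2"
    proof
      fix e assume "e \<in> ?Ed"
      then obtain a b where ab: "e = {a, b}" "a \<in> V" "b \<in> V" "E a b" by blast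
      then have "{v \<in> V. v \<in> e} = {a, b}" "a \<noteq> b" using graph_relD(2)[OF assms(2)] by auto
      then show "card {v \<in> V. v \<in> e} = 2" by simp
    qed
  qed
  finally show ?thesis by (simp add: mult.commute)
qed

lemma degsum_adj:
  assumes "simple_graph G"
  shows "degsum (verts G) (adj G) = 2 * card (edges G)"
proof -
  have "{{u, v} | u v. u \<in> verts G \<and> v \<in> verts G \<and> adj G u v} = edges G"
  proof (intro set_eqI iffI)
    fix e assume "e \<in> edges G"
    then have "e \<subseteq> verts G" "card e = 2" using assms by (auto simp: simple_graph_def)
    then obtain a b where "e = {a, b}" by (meson card_2_iff)
    then show "e \<in> {{u, v} | u v. u \<in> verts G \<and> v \<in> verts G \<and> adj G u v}"
      using \<open>e \<in> edges G\<close> \<open>e \<subseteq> verts G\<close> by auto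
  qed auto
  then show ?thesis using degsum_eq_card_edges[of "verts G" "adj G"] assms graph_rel_adj[OF assms]
    by (simp add: simple_graph_def)
qed

lemma edges_path_power:
  "edges (path_power p k) = {{i, j} | i j. i < j \<and> j < k \<and> j \<le> i + p}"
proof (intro set_eqI iffI)
  fix e assume e: "e \<in> edges (path_power p k)"
  then obtain u v where uv: "e = {u, v}" "u < k" "v < k" "u \<noteq> v"
    by (auto simp: graph_power_def path_graph_def)
  define i j where "i = min u v" and "j = max u v"
  have "e = {i, j}" "i < j" "j < k" using uv by (auto simp: i_def j_def min_def max_def)
  moreover have "j - i \<le> p" using edge_path_power_iff[of i j k p] e calculation by simp
  ultimately have "e = {i, j} \<and> i < j \<and> j < k \<and> j \<le> i + p" by simp
  then show "e \<in> {{i, j} | i j. i < j \<and> j < k \<and> j \<le> i + p}" by blast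
next
  fix e assume "e \<in> {{i, j} | i j. i < j \<and> j < k \<and> j \<le> i + p}"
  then show "e \<in> edges (path_power p k)" using edge_path_power_iff by fastforce
qed

lemma verts_path_power: "verts (path_power p k) = {..<k}"
  by (simp add: graph_power_def path_graph_def)

text \<open>Paths are first powers, so both kinds of extremal number in the theorem become instances
  of \<open>exn\<close>.\<close>

lemma path_power_1: "path_power 1 s = path_graph s"
proof (rule prod_eqI)
  show "fst (path_power 1 s) = fst (path_graph s)" by (simp only: verts_path_power) (simp add: path_graph_def)
  have "i < j \<and> j < s \<and> j \<le> i + 1 \<longleftrightarrow> j = Suc i \<and> Suc i < s" for i j by auto
  then show "snd (path_power 1 s) = snd (path_graph s)" unfolding edges_path_power
    by (auto simp: path_graph_def)
qed

lemma contains_path_power_iff: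
  assumes "simple_graph G"
  shows "contains_copy G (path_power p k) \<longleftrightarrow> has_power p k (verts G) (adj G)"
proof
  assume "contains_copy G (path_power p k)"
  then obtain S f where S: "subgraph S G" and f: "bij_betw f (verts S) {..<k}"
    and iso: "\<forall>u\<in>verts S. \<forall>v\<in>verts S. {u, v} \<in> edges S \<longleftrightarrow> {f u, f v} \<in> edges (path_power p k)"
    by (auto simp: contains_copy_def isomorphic_def verts_path_power)
  define \<phi> where "\<phi> = inv_into (verts S) f"
  have \<phi>: "bij_betw \<phi> {..<k} (verts S)" unfolding \<phi>_def by (rule bij_betw_inv_into[OF f])
  have f\<phi>: "f (\<phi> i) = i" if "i < k" for i
    using f that by (simp add: \<phi>_def bij_betw_inv_into_right)
  have "adj G (\<phi> i) (\<phi> j)" if ij: "i < j" "j < k" "j \<le> i + p" for i j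
  proof -
    have "{i, j} \<in> edges (path_power p k)" using ij by (auto simp: edges_path_power)
    moreover have "\<phi> i \<in> verts S" "\<phi> j \<in> verts S" using ij \<phi> by (auto simp: bij_betw_def)
    ultimately have "{\<phi> i, \<phi> j} \<in> edges S" using iso f\<phi> ij by simp
    then show ?thesis using S by (auto simp: subgraph_def)
  qed
  then show "has_power p k (verts G) (adj G)" unfolding has_power_def
    using \<phi> S by (intro exI[of _ \<phi>]) (auto simp: bij_betw_def subgraph_def)
next
  assume "has_power p k (verts G) (adj G)"
  then obtain \<phi> where \<phi>: "inj_on \<phi> {..<k}" "\<phi> ` {..<k} \<subseteq> verts G"
    "\<And>i j. i < j \<Longrightarrow> j < k \<Longrightarrow> j \<le> i + p \<Longrightarrow> adj G (\<phi> i) (\<phi> j)"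
    by (auto simp: has_power_def)
  define S where "S = (\<phi> ` {..<k}, (`) \<phi> ` edges (path_power p k))"
  have eS: "edges S \<subseteq> edges G" using \<phi>(3) by (auto simp: S_def edges_path_power)
  have "simple_graph S" unfolding simple_graph_def
  proof (intro conjI ballI)
    fix e assume e: "e \<in> edges S"
    then show "card e = 2" using eS assms by (auto simp: simple_graph_def)
    show "e \<subseteq> verts S" using e by (auto simp: S_def edges_path_power)
  qed (simp add: S_def)
  then have sub: "subgraph S G" using \<phi>(2) eS by (simp add: subgraph_def S_def)
  define f where "f = inv_into {..<k} \<phi>"
  have f\<phi>: "f (\<phi> i) = i" if "i < k" for i using \<phi>(1) that by (simp add: f_def)
  have bij: "bij_betw f (verts S) {..<k}" unfolding f_def S_def fst_conv
    by (rule bij_betw_inv_into) (use \<phi>(1) in \<open>simp add: bij_betw_def\<close>)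
  have "{\<phi> i, \<phi> j} \<in> edges S \<longleftrightarrow> {i, j} \<in> edges (path_power p k)" if ij: "i < k" "j < k" for i j
  proof
    assume "{\<phi> i, \<phi> j} \<in> edges S"
    then obtain e where e: "e \<in> edges (path_power p k)" "\<phi> ` {i, j} = \<phi> ` e" by (auto simp: S_def)
    have "e \<subseteq> {..<k}" using e by (auto simp: edges_path_power)
    then have "{i, j} = e" using e(2) ij \<phi>(1) inj_on_image_eq_iff[of \<phi> "{..<k}" "{i,j}" e] by simp
    then show "{i, j} \<in> edges (path_power p k)" using e by simp
  next
    assume "{i, j} \<in> edges (path_power p k)"
    then have "\<phi> ` {i, j} \<in> edges S" unfolding S_def snd_conv by (rule imageI)
    then show "{\<phi> i, \<phi> j} \<in> edges S" by simp
  qed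
  then have "isomorphic S (path_power p k)" unfolding isomorphic_def
    using bij f\<phi> by (intro exI[of _ f]) (auto simp: verts_path_power S_def)
  then show "contains_copy G (path_power p k)" using sub unfolding contains_copy_def by blast
qed

definition exn :: "nat \<Rightarrow> nat \<Rightarrow> nat \<Rightarrow> nat" where "exn p k n = ex_num n (path_power p k)"

lemma has_power_cong:
  assumes "\<And>u v. u \<in> V \<Longrightarrow> v \<in> V \<Longrightarrow> E u v \<longleftrightarrow> E' u v"
  shows "has_power p k V E \<longleftrightarrow> has_power p k V E'"
  unfolding has_power_def
proof (intro iff_exI conj_cong refl)
  fix \<phi> assume "\<phi> ` {..<k} \<subseteq> V"
  then have "E (\<phi> i) (\<phi> j) = E' (\<phi> i) (\<phi> j)" if "i < j" "j < k" for i j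
    using assms[of "\<phi> i" "\<phi> j"] that by (auto simp: image_subset_iff)
  then show "(\<forall>i j. i < j \<longrightarrow> j < k \<longrightarrow> j \<le> i + p \<longrightarrow> E (\<phi> i) (\<phi> j)) =
        (\<forall>i j. i < j \<longrightarrow> j < k \<longrightarrow> j \<le> i + p \<longrightarrow> E' (\<phi> i) (\<phi> j))" by blast
qed

lemma degsum_cong:
  assumes "\<And>u v. u \<in> V \<Longrightarrow> v \<in> V \<Longrightarrow> E u v \<longleftrightarrow> E' u v"
  shows "degsum V E = degsum V E'"
  unfolding degsum_def nbh_def using assms by (intro sum.cong refl arg_cong[of _ _ card]) auto

lemma finite_ex_set:
  "finite {card (edges G) | G :: nat graph. simple_graph G \<and> card (verts G) = n \<and> \<not> contains_copy G H}"
proof (rule finite_subset[of _ "{..n * (n - 1)}"])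
  show "{card (edges G) | G :: nat graph. simple_graph G \<and> card (verts G) = n \<and> \<not> contains_copy G H} \<subseteq> {..n * (n - 1)}"
  proof
    fix x assume "x \<in> {card (edges G) | G :: nat graph. simple_graph G \<and> card (verts G) = n \<and> \<not> contains_copy G H}"
    then obtain G :: "nat graph" where G: "x = card (edges G)" "simple_graph G" "card (verts G) = n" by auto
    have "2 * x \<le> n * (n - 1)" using degsum_adj[OF G(2)] degsum_le[of "verts G" "adj G"] graph_rel_adj[OF G(2)] G
      by (simp add: simple_graph_def)
    then show "x \<in> {..n * (n - 1)}" by simp
  qed
qed simp

lemma degsum_le_exn:
  fixes V :: "nat set"
  assumes "finite V" "graph_rel E" "\<not> has_power p k V E"
  shows "degsum V E \<le> 2 * exn p k (card V)"
proof (cases "card V = 0")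
  case True
  then show ?thesis using assms(1) by (simp add: degsum_def)
next
  case False
  define G :: "nat graph" where "G = (V, {{u, v} | u v. u \<in> V \<and> v \<in> V \<and> E u v})"
  have adjG: "adj G u v \<longleftrightarrow> u \<in> V \<and> v \<in> V \<and> E u v" for u v
    using graph_relD(1)[OF assms(2)] by (auto simp: G_def doubleton_eq_iff)
  have sG: "simple_graph G" unfolding simple_graph_def using assms(1) graph_relD(2)[OF assms(2)]
    by (auto simp: G_def card_insert_if)
  have "has_power p k V (adj G) \<longleftrightarrow> has_power p k V E" by (rule has_power_cong) (simp add: adjG)
  then have "\<not> contains_copy G (path_power p k)" using contains_path_power_iff[OF sG] assms(3)
    by (simp add: G_def)
  then have mem: "card (edges G) \<in> {card (edges G) | G :: nat graph. simple_graph G \<and> card (verts G) = card V \<and> \<not> contains_copy G (path_power p k)}"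
    using sG by (auto simp: G_def)
  have "card (edges G) \<le> exn p k (card V)" unfolding exn_def ex_num_def if_not_P[OF False]
    by (rule Max_ge[OF finite_ex_set mem])
  moreover have "degsum V E = 2 * card (edges G)" using degsum_eq_card_edges[OF assms(1,2)]
    by (simp add: G_def)
  ultimately show ?thesis by simp
qed

lemma not_has_power_empty:
  assumes "1 \<le> p" "2 \<le> k"
  shows "\<not> has_power p k V (\<lambda>_ _. False)"
proof
  assume "has_power p k V (\<lambda>_ _. False)"
  then have "\<And>i j :: nat. i < j \<Longrightarrow> j < k \<Longrightarrow> j \<le> i + p \<Longrightarrow> False" by (auto simp: has_power_def)
  from this[of 0 1] show False using assms by simp
qed

text \<open>The hypotheses give the forbidden graph an edge; the edgeless graph then shows that the
  maximum in \<open>ex_num\<close> is taken over a nonempty set.\<close>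

lemma exn_attained:
  assumes "1 \<le> p" "2 \<le> k"
  obtains V :: "nat set" and E where "finite V" "card V = n" "graph_rel E" "\<not> has_power p k V E"
    "degsum V E = 2 * exn p k n"
proof (cases "n = 0")
  case True
  have "\<not> has_power p k ({} :: nat set) (\<lambda>_ _. False)" using not_has_power_empty[OF assms] .
  then show ?thesis using that[of "{}" "\<lambda>_ _. False"] True
    by (auto simp: degsum_def graph_rel_def exn_def ex_num_def)
next
  case False
  let ?S = "{card (edges G) | G :: nat graph. simple_graph G \<and> card (verts G) = n \<and> \<not> contains_copy G (path_power p k)}"
  define G0 :: "nat graph" where "G0 = ({..<n}, {})"
  have s0: "simple_graph G0" by (simp add: G0_def simple_graph_def)
  have "\<not> has_power p k (verts G0) (adj G0)" using not_has_power_empty[OF assms] by (simp add: G0_def)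
  then have "0 \<in> ?S" using contains_path_power_iff[OF s0] s0
    by (intro CollectI exI[of _ G0]) (auto simp: G0_def)
  then have "?S \<noteq> {}" by blast
  then have "Max ?S \<in> ?S" by (rule Max_in[OF finite_ex_set])
  then obtain G :: "nat graph" where G: "Max ?S = card (edges G)" "simple_graph G" "card (verts G) = n"
    "\<not> contains_copy G (path_power p k)" by auto
  have "degsum (verts G) (adj G) = 2 * exn p k n"
    using degsum_adj[OF G(2)] G(1) False by (simp add: exn_def ex_num_def)
  then show ?thesis using that[of "verts G" "adj G"] G contains_path_power_iff[OF G(2)] graph_rel_adj[OF G(2)]
    by (simp add: simple_graph_def)
qed

section \<open>Turan graphs and disjoint cliques\<close>

lemma turan_num_degsum: "2 * turan_num n q = degsum {..<n} (\<lambda>u v. u mod q \<noteq> v mod q)"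
  using degsum_eq_card_edges[of "{..<n}" "\<lambda>u v. u mod q \<noteq> v mod q"]
  by (simp add: turan_num_def turan_graph_def complete_multipartite_def graph_rel_def)

text \<open>The new vertex \<open>n\<close> is joined to all earlier ones except the
  \<open>n div q\<close> members of its residue class.\<close>

lemma turan_num_Suc:
  assumes "1 \<le> q"
  shows "turan_num (Suc n) q + n div q = turan_num n q + n"
proof -
  let ?E = "\<lambda>u v :: nat. u mod q \<noteq> v mod q"
  have "degsum {..<Suc n} ?E = degsum ({..<Suc n} - {n}) ?E + 2 * card (nbh {..<Suc n} ?E n)"
    by (rule degsum_remove) (auto simp: graph_rel_def)
  moreover have "{..<Suc n} - {n} = {..<n}" by auto
  moreover have "card (nbh {..<Suc n} ?E n) + n div q = n"
  proof -
    have "nbh {..<Suc n} ?E n = {..<n} - {x. x < n \<and> x mod q = n mod q}"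
      by (auto simp: nbh_def less_Suc_eq)
    moreover have "card {x. x < n \<and> x mod q = n mod q} = n div q"
      using residue_class_card[of "n mod q" q n] assms by simp
    moreover have "card {x. x < n \<and> x mod q = n mod q} \<le> card {..<n}" by (rule card_mono) auto
    moreover have "card ({..<n} - {x. x < n \<and> x mod q = n mod q}) = n - card {x. x < n \<and> x mod q = n mod q}"
      by (subst card_Diff_subset) auto
    ultimately show ?thesis by simp
  qed
  ultimately show ?thesis using turan_num_degsum[of n q] turan_num_degsum[of "Suc n" q] by simp
qed

text \<open>Turan's bound for arbitrary parts. Among \<open>m + 1\<close> vertices, a part of at
  least average size has more than \<open>m div q\<close> of them, so deleting one of its vertices
  costs at most the increment in \<open>turan_num_Suc\<close>.\<close>

lemma degsum_multipartite_le:
  assumes "1 \<le> q" "finite B" "\<And>v. v \<in> B \<Longrightarrow> part v < q"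
  shows "degsum B (\<lambda>u v. part u \<noteq> part v) \<le> 2 * turan_num (card B) q"
  using assms(2,3)
proof (induction "card B" arbitrary: B)
  case 0
  then show ?case by (simp add: degsum_def)
next
  case (Suc m)
  let ?E = "\<lambda>u v. part u \<noteq> part v"
  define c where "c i = card {v\<in>B. part v = i}" for i
  have "(\<Sum>i<q. c i) = card B"
  proof -
    have "card B = card (\<Union>i<q. {v\<in>B. part v = i})" using Suc.prems(2) by (intro arg_cong[of _ _ card]) auto
    also have "\<dots> = (\<Sum>i<q. c i)" unfolding c_def using Suc.prems(1)
      by (intro card_UN_disjoint) auto
    finally show ?thesis by simp
  qed
  have "\<exists>i<q. card B \<le> q * c i"
  proof (rule ccontr)
    assume "\<not> ?thesis"
    then have "(\<Sum>i<q. q * c i) < (\<Sum>i<q. card B)" using assms(1) by (intro sum_strict_mono) (auto simp: not_le lessThan_empty_iff)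
    then show False using \<open>(\<Sum>i<q. c i) = card B\<close> by (simp add: sum_distrib_left[symmetric])
  qed
  then obtain i where i: "i < q" "Suc m \<le> q * c i" using Suc(2) by auto
  have "q * (m div q) < q * c i" using i(2) by (metis Suc_le_lessD le_less_trans mult.commute div_times_less_eq_dividend)
  then have ci: "m div q < c i" by simp
  then have "{v\<in>B. part v = i} \<noteq> {}" unfolding c_def by force
  then obtain v where v: "v \<in> B" "part v = i" by auto
  have "nbh B ?E v = B - {v\<in>B. part v = i}" using v by (auto simp: nbh_def)
  then have deg: "card (nbh B ?E v) = Suc m - c i"
    using Suc.prems(1) Suc(2) by (simp add: c_def card_Diff_subset)
  have "degsum B ?E = degsum (B - {v}) ?E + 2 * card (nbh B ?E v)"
    using Suc.prems(1) v(1) by (intro degsum_remove) (auto simp: graph_rel_def)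
  moreover have cm: "card (B - {v}) = m" using Suc.prems(1) Suc(2) v(1) by simp
  moreover have "degsum (B - {v}) ?E \<le> 2 * turan_num (card (B - {v})) q"
    using Suc.prems v(1) Suc(2) by (intro Suc(1)) auto
  then have "degsum (B - {v}) ?E \<le> 2 * turan_num m q" unfolding cm .
  moreover have "m div q \<le> m" by simp
  ultimately show ?case using turan_num_Suc[OF assms(1), of m] deg ci unfolding Suc(2)[symmetric] by linarith
qed

text \<open>Disjoint cliques on \<open>s - 1\<close> vertices contain no path on \<open>s\<close>
  vertices. Vertices of full cliques have degree \<open>s - 2\<close>; at most \<open>s - 2\<close>
  vertices lie in an incomplete clique, and the term \<open>(s - 2) * (s - 2)\<close> pays for
  them.\<close>

lemma exn_path_ge:
  assumes "2 \<le> s"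
  shows "(s - 2) * a \<le> 2 * exn 1 s a + (s - 2) * (s - 2)"
proof -
  define d where "d = s - 1"
  have d: "1 \<le> d" "s = Suc d" using assms by (auto simp: d_def)
  define E where "E u v \<longleftrightarrow> u \<noteq> v \<and> u div d = v div d" for u v :: nat
  have gE: "graph_rel E" by (auto simp: graph_rel_def E_def)
  have "\<not> has_power 1 s {..<a} E"
  proof
    assume "has_power 1 s {..<a} E"
    then obtain \<phi> where \<phi>: "inj_on \<phi> {..<s}" "\<And>i j. i < j \<Longrightarrow> j < s \<Longrightarrow> j \<le> i + 1 \<Longrightarrow> E (\<phi> i) (\<phi> j)"
      by (auto simp: has_power_def)
    have same: "\<phi> i div d = \<phi> 0 div d" if "i < s" for i using that
    proof (induction i)
      case (Suc i) then show ?case using \<phi>(2)[of i "Suc i"] by (simp add: E_def)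
    qed simp
    have "\<phi> ` {..<s} \<subseteq> {\<phi> 0 div d * d..<\<phi> 0 div d * d + d}"
    proof
      fix x assume "x \<in> \<phi> ` {..<s}"
      then have "x div d = \<phi> 0 div d" using same by auto
      moreover have "x = x div d * d + x mod d" by simp
      moreover have "x mod d < d" using d by simp
      ultimately show "x \<in> {\<phi> 0 div d * d..<\<phi> 0 div d * d + d}" by (metis atLeastLessThan_iff le_add1 nat_add_left_cancel_less)
    qed
    then have "card (\<phi> ` {..<s}) \<le> d" using card_mono[of "{\<phi> 0 div d * d..<\<phi> 0 div d * d + d}"] by fastforce
    then show False using \<phi>(1) d by (simp add: card_image)
  qed
  then have ub: "degsum {..<a} E \<le> 2 * exn 1 s a" using degsum_le_exn[of "{..<a}"] gE by simp
  let ?W = "{..<d * (a div d)}"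
  have Wa: "?W \<subseteq> {..<a}" by (auto intro: less_le_trans)
  have "s - 2 \<le> card (nbh {..<a} E v)" if "v \<in> ?W" for v
  proof -
    define I where "I = {v div d * d..<v div d * d + d}"
    have "v < a div d * d" using that by (simp add: mult.commute)
    then have "v div d < a div d" using d less_mult_imp_div_less by auto
    then have "(v div d + 1) * d \<le> a div d * d" by (intro mult_le_mono1) simp
    also have "\<dots> \<le> a" by simp
    finally have Ia: "I \<subseteq> {..<a}" by (auto simp: I_def)
    have "x div d = v div d" if "x \<in> I" for x
      using that d div_nat_eqI[of d "v div d" x] by (auto simp: I_def algebra_simps)
    then have "I - {v} \<subseteq> nbh {..<a} E v" using Ia by (auto simp: nbh_def E_def)
    then have "card (I - {v}) \<le> card (nbh {..<a} E v)" by (intro card_mono) auto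
    moreover have "d - 1 \<le> card (I - {v})" using diff_card_le_card_Diff[of "{v}" I] by (simp add: I_def)
    ultimately show ?thesis using d by simp
  qed
  then have "card ?W * (s - 2) \<le> (\<Sum>v\<in>?W. card (nbh {..<a} E v))" using sum_bounded_below[of ?W "s - 2"] by simp
  also have "\<dots> \<le> degsum {..<a} E" unfolding degsum_def using Wa by (intro sum_mono2) auto
  finally have "d * (a div d) * (s - 2) \<le> 2 * exn 1 s a" using ub by simp
  moreover have "a mod d * (s - 2) \<le> (s - 2) * (s - 2)" using d mod_less_divisor[of d a] by (intro mult_le_mono1) linarith
  moreover have "(s - 2) * a = d * (a div d) * (s - 2) + a mod d * (s - 2)"
    by (metis add_mult_distrib mult.commute mult_div_mod_eq)
  ultimately show ?thesis by linarith
qed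

section \<open>Counting across disjoint unions, and joins\<close>

lemma card_nbh_eq_sum: "finite V \<Longrightarrow> card (nbh V E v) = (\<Sum>u\<in>V. if E v u then 1 else 0)"
  unfolding nbh_def by (subst card_eq_sum) (rule sum.inter_filter)

lemma sum_card_nbh_swap:
  assumes "finite A" "finite B" "graph_rel E"
  shows "(\<Sum>v\<in>A. card (nbh B E v)) = (\<Sum>v\<in>B. card (nbh A E v))"
proof -
  have "(\<Sum>v\<in>A. card (nbh B E v)) = (\<Sum>v\<in>A. \<Sum>u\<in>B. if E v u then 1 else 0)"
    using assms(2) by (intro sum.cong refl card_nbh_eq_sum)
  also have "\<dots> = (\<Sum>u\<in>B. \<Sum>v\<in>A. if E v u then 1 else 0)" by (rule sum.swap)
  also have "\<dots> = (\<Sum>u\<in>B. \<Sum>v\<in>A. if E u v then 1 else 0)"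
    by (intro sum.cong refl) (simp add: graph_rel_sym[OF assms(3)])
  also have "\<dots> = (\<Sum>v\<in>B. card (nbh A E v))"
    using assms(1) by (intro sum.cong refl card_nbh_eq_sum[symmetric])
  finally show ?thesis .
qed

lemma card_nbh_Un:
  assumes "finite A" "finite B" "A \<inter> B = {}"
  shows "card (nbh (A \<union> B) E v) = card (nbh A E v) + card (nbh B E v)"
proof -
  have "nbh (A \<union> B) E v = nbh A E v \<union> nbh B E v" "nbh A E v \<inter> nbh B E v = {}"
    using assms by (auto simp: nbh_def)
  then show ?thesis using assms by (simp add: card_Un_disjoint)
qed

lemma degsum_Un:
  assumes "finite A" "finite B" "A \<inter> B = {}" "graph_rel E"
  shows "degsum (A \<union> B) E = degsum A E + degsum B E + 2 * (\<Sum>v\<in>B. card (nbh A E v))"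
proof -
  have "degsum (A \<union> B) E = (\<Sum>v\<in>A. card (nbh (A \<union> B) E v)) + (\<Sum>v\<in>B. card (nbh (A \<union> B) E v))"
    unfolding degsum_def by (rule sum.union_disjoint[OF assms(1-3)])
  also have "\<dots> = degsum A E + (\<Sum>v\<in>A. card (nbh B E v)) + ((\<Sum>v\<in>B. card (nbh A E v)) + degsum B E)"
    unfolding card_nbh_Un[OF assms(1-3)] degsum_def sum.distrib by simp
  finally show ?thesis using sum_card_nbh_swap[OF assms(1,2,4)] by simp
qed

lemma degsum_image:
  assumes "inj_on g V"
  shows "degsum (g ` V) E = degsum V (\<lambda>u v. E (g u) (g v))"
proof -
  have "card (nbh (g ` V) E (g v)) = card (nbh V (\<lambda>u v. E (g u) (g v)) v)" for v
  proof -
    have "nbh (g ` V) E (g v) = g ` nbh V (\<lambda>u v. E (g u) (g v)) v" by (auto simp: nbh_def)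
    moreover have "inj_on g (nbh V (\<lambda>u v. E (g u) (g v)) v)"
      by (rule inj_on_subset[OF assms nbh_subset])
    ultimately show ?thesis by (simp add: card_image)
  qed
  then show ?thesis unfolding degsum_def by (simp add: sum.reindex[OF assms])
qed

text \<open>In a copy of \<open>P\<^sub>k\<^sup>p\<close>, every \<open>p + 1\<close> consecutive vertices form a clique and so at least two of
  them lie in \<open>A\<close>; moreover consecutive vertices in \<open>A\<close> are adjacent.\<close>

lemma has_power_join:
  fixes part :: "'a \<Rightarrow> nat"
  assumes hp: "has_power p k (A \<union> B) E" and p: "2 \<le> p"
    and part: "\<And>v. v \<in> B \<Longrightarrow> part v < p - 1" "\<And>u v. u \<in> B \<Longrightarrow> v \<in> B \<Longrightarrow> E u v \<Longrightarrow> part u \<noteq> part v"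
    and s: "s = 2 * (k div (p + 1)) + (if k mod (p + 1) = p then 1 else 0)"
  shows "has_power 1 s A E"
proof -
  obtain \<phi> where \<phi>: "inj_on \<phi> {..<k}" "\<phi> ` {..<k} \<subseteq> A \<union> B"
    "\<And>i j. i < j \<Longrightarrow> j < k \<Longrightarrow> j \<le> i + p \<Longrightarrow> E (\<phi> i) (\<phi> j)"
    using hp by (auto simp: has_power_def)
  define I where "I = {i. i < k \<and> \<phi> i \<in> A}"
  have finI: "finite I" by (simp add: I_def)
  \<comment> \<open>The positions of the window form a clique, so those outside \<open>A\<close> lie
    in different ones of the \<open>p - 1\<close> parts.\<close>
  have window: "l \<le> card (I \<inter> {i..<i+l}) + (p - 1)" if "i + l \<le> k" "l \<le> p + 1" for i l
  proof -
    let ?J = "{i..<i+l} - I"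
    have JB: "\<phi> x \<in> B" if "x \<in> ?J" for x using that \<phi>(2) \<open>i + l \<le> k\<close> by (auto simp: I_def image_subset_iff)
    have "inj_on (\<lambda>x. part (\<phi> x)) ?J"
    proof (rule inj_onI, rule ccontr)
      fix x y assume xy: "x \<in> ?J" "y \<in> ?J" "part (\<phi> x) = part (\<phi> y)" "x \<noteq> y"
      have "E (\<phi> x) (\<phi> y) \<or> E (\<phi> y) (\<phi> x)"
        using xy \<phi>(3)[of x y] \<phi>(3)[of y x] that by (cases "x < y") auto
      then show False using part(2) JB[OF xy(1)] JB[OF xy(2)] xy(3) by metis
    qed
    moreover have "(\<lambda>x. part (\<phi> x)) ` ?J \<subseteq> {..<p-1}" using part(1) JB by auto
    ultimately have "card ?J \<le> card {..<p-1}" by (intro card_inj_on_le) auto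
    moreover have "card {i..<i+l} = card (I \<inter> {i..<i+l}) + card ?J"
      using card_Int_Diff[of "{i..<i+l}" I] by (simp add: Int_commute)
    ultimately show ?thesis by simp
  qed
  have split: "card (I \<inter> {..<x+l}) = card (I \<inter> {..<x}) + card (I \<inter> {x..<x+l})" for x l
  proof -
    have "I \<inter> {..<x+l} = I \<inter> {..<x} \<union> I \<inter> {x..<x+l}" by auto
    then show ?thesis by (simp add: card_Un_disjoint disjoint_iff)
  qed
  have cnt: "2 * n \<le> card (I \<inter> {..<n*(p+1)})" if "n * (p + 1) \<le> k" for n
    using that
  proof (induction n)
    case (Suc n)
    have e: "Suc n * (p + 1) = n * (p + 1) + (p + 1)" by simp
    have "p + 1 \<le> card (I \<inter> {n*(p+1)..<n*(p+1)+(p+1)}) + (p - 1)"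
      using Suc.prems unfolding e by (intro window) auto
    moreover have "2 * n \<le> card (I \<inter> {..<n*(p+1)})" by (rule Suc.IH) (use Suc.prems e in linarith)
    moreover have "2 * Suc n \<le> u + v" if "p + 1 \<le> v + (p - 1)" "2 * n \<le> u" for u v
      using that p by (simp add: algebra_simps)
    ultimately show ?case unfolding e split by blast
  qed simp
  have cs: "s \<le> card I"
  proof -
    define q where "q = k div (p + 1)"
    have kq: "k = q * (p + 1) + k mod (p + 1)" unfolding q_def by (rule div_mult_mod_eq[symmetric])
    then have c: "2 * q \<le> card (I \<inter> {..<q*(p+1)})" by (intro cnt) linarith
    show ?thesis
    proof (cases "k mod (p + 1) = p")
      case True
      then have k: "k = q * (p + 1) + p" using kq by simp
      have "p \<le> card (I \<inter> {q*(p+1)..<q*(p+1)+p}) + (p - 1)" using k by (intro window) auto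
      moreover have "card (I \<inter> {..<q*(p+1)+p}) \<le> card I" using finI by (intro card_mono) auto
      ultimately show ?thesis using True c p s split[of "q*(p+1)" p] by (simp add: q_def)
    next
      case False
      moreover have "card (I \<inter> {..<q*(p+1)}) \<le> card I" using finI by (intro card_mono) auto
      ultimately show ?thesis using c s by (simp add: q_def)
    qed
  qed
  define xs where "xs = sorted_list_of_set I"
  have xs: "set xs = I" "length xs = card I" "sorted_wrt (<) xs" using finI by (simp_all add: xs_def)
  have mono: "xs ! i < xs ! j \<longleftrightarrow> i < j" if "i < card I" "j < card I" for i j
    using sorted_wrt_nth_less[OF xs(3), of i j] sorted_wrt_nth_less[OF xs(3), of j i] that xs(2)
    by (cases i j rule: linorder_cases) auto
  have inI: "xs ! i \<in> I" if "i < card I" for i using xs that by auto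
  \<comment> \<open>A window of only \<open>p\<close> positions still meets \<open>I\<close>, so
    successive elements of \<open>I\<close> differ by at most \<open>p\<close> and carry adjacent
    vertices.\<close>
  have gap: "xs ! Suc i \<le> xs ! i + p" if i: "Suc i < card I" for i
  proof (rule ccontr)
    assume "\<not> ?thesis"
    then have big: "xs ! i + p < xs ! Suc i" by simp
    have "xs ! Suc i < k" using inI[OF i] by (simp add: I_def)
    then have "p \<le> card (I \<inter> {Suc (xs ! i)..<Suc (xs ! i)+p}) + (p - 1)" using big by (intro window) auto
    then have "I \<inter> {Suc (xs ! i)..<Suc (xs ! i)+p} \<noteq> {}" using p by (intro notI) simp
    then obtain z where z0: "z \<in> I" "Suc (xs ! i) \<le> z" "z < Suc (xs ! i) + p" by auto
    then have z: "z \<in> I" "xs ! i < z" "z < xs ! Suc i" using big by linarith+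
    then have "z \<in> set xs" using xs(1) by simp
    then obtain u where u: "u < card I" "z = xs ! u" using xs(2) by (auto simp: in_set_conv_nth)
    then have "i < u" "u < Suc i" using mono[of i u] mono[of u "Suc i"] i z by auto
    then show False by simp
  qed
  have "inj_on (\<lambda>i. \<phi> (xs ! i)) {..<s}"
  proof (rule inj_onI)
    fix i j assume ij: "i \<in> {..<s}" "j \<in> {..<s}" "\<phi> (xs ! i) = \<phi> (xs ! j)"
    then have "i < card I" "j < card I" using cs by auto
    moreover have "xs ! i = xs ! j" using inj_onD[OF \<phi>(1) ij(3)] inI[of i] inI[of j] calculation
      by (simp add: I_def)
    ultimately show "i = j" using mono[of i j] mono[of j i] by (metis less_irrefl linorder_neqE_nat)
  qed
  moreover have "(\<lambda>i. \<phi> (xs ! i)) ` {..<s} \<subseteq> A" using inI cs by (auto simp: I_def)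
  moreover have "E (\<phi> (xs ! i)) (\<phi> (xs ! j))" if "i < j" "j < s" "j \<le> i + 1" for i j
  proof -
    have j: "j = Suc i" "Suc i < card I" using that cs by auto
    then show ?thesis using \<phi>(3)[of "xs ! i" "xs ! j"] gap[of i] mono[of i "Suc i"] inI[of j]
      by (simp add: I_def)
  qed
  ultimately show ?thesis unfolding has_power_def by (intro exI[of _ "\<lambda>i. \<phi> (xs ! i)"]) blast
qed

text \<open>The witness is the join of an extremal graph without a path on \<open>s\<close> vertices
  and a Turan graph; shifting the labels of the latter by \<open>N\<close> keeps the two vertex sets
  disjoint within the natural numbers.\<close>

lemma exn_join_le:
  assumes p: "2 \<le> p" and k: "p + 1 \<le> k" and ab: "a + b = n"
    and s: "s = 2 * (k div (p + 1)) + (if k mod (p + 1) = p then 1 else 0)"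
  shows "exn 1 s a + a * b + turan_num b (p - 1) \<le> exn p k n"
proof -
  have "1 \<le> k div (p + 1)" using k p by (simp add: Suc_leI div_greater_zero_iff)
  then have s2: "2 \<le> s" using s by simp
  obtain VA :: "nat set" and EA where VA: "finite VA" "card VA = a" "graph_rel EA" "\<not> has_power 1 s VA EA"
    "degsum VA EA = 2 * exn 1 s a" using exn_attained[of 1 s a] s2 by auto
  obtain N where N: "\<forall>v\<in>VA. v < N" using VA(1) finite_nat_set_iff_bounded by auto
  define B where "B = (\<lambda>i. N + i) ` {..<b}"
  define part where "part v = (v - N) mod (p - 1)" for v
  define E where "E u v \<longleftrightarrow> u \<in> VA \<and> v \<in> VA \<and> EA u v \<or> u \<in> VA \<and> v \<in> B \<or> u \<in> B \<and> v \<in> VA \<or>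
     u \<in> B \<and> v \<in> B \<and> part u \<noteq> part v" for u v
  have disj: "VA \<inter> B = {}" using N by (fastforce simp: B_def)
  have finB: "finite B" by (simp add: B_def)
  have cB: "card B = b" by (simp add: B_def card_image)
  have gE: "graph_rel E" using VA(3) disj by (auto simp: graph_rel_def E_def)
  have EVA: "E u v \<longleftrightarrow> EA u v" if "u \<in> VA" "v \<in> VA" for u v using that disj by (auto simp: E_def)
  have EB: "E u v \<longleftrightarrow> part u \<noteq> part v" if "u \<in> B" "v \<in> B" for u v using that disj by (auto simp: E_def)
  have no: "\<not> has_power p k (VA \<union> B) E"
  proof
    assume "has_power p k (VA \<union> B) E"
    then have "has_power 1 s VA E"
      by (rule has_power_join[OF _ p _ _ s, where part = part]) (use p EB in \<open>auto simp: part_def\<close>)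
    then show False using VA(4) has_power_cong[of VA E EA 1 s] EVA by blast
  qed
  have "degsum VA E = 2 * exn 1 s a" using degsum_cong[of VA E EA] EVA VA(5) by simp
  moreover have "degsum B E = 2 * turan_num b (p - 1)"
  proof -
    have "degsum B E = degsum B (\<lambda>u v. part u \<noteq> part v)" by (rule degsum_cong) (rule EB)
    also have "\<dots> = degsum {..<b} (\<lambda>u v. part (N + u) \<noteq> part (N + v))" unfolding B_def
      by (rule degsum_image) simp
    also have "\<dots> = 2 * turan_num b (p - 1)" by (simp add: turan_num_degsum part_def)
    finally show ?thesis .
  qed
  moreover have "(\<Sum>v\<in>B. card (nbh VA E v)) = b * a"
  proof -
    have "nbh VA E v = VA" if "v \<in> B" for v using that by (auto simp: nbh_def E_def)
    then show ?thesis using cB VA(2) by simp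
  qed
  moreover have "degsum (VA \<union> B) E = degsum VA E + degsum B E + 2 * (\<Sum>v\<in>B. card (nbh VA E v))"
    by (rule degsum_Un[OF VA(1) finB disj gE])
  moreover have "card (VA \<union> B) = n" using card_Un_disjoint[OF VA(1) finB disj] cB VA(2) ab by simp
  then have "degsum (VA \<union> B) E \<le> 2 * exn p k n"
    using degsum_le_exn[OF _ gE no] VA(1) finB by simp
  ultimately show ?thesis by (simp add: mult.commute)
qed

text \<open>An isolated vertex is added. As \<open>2 \<le> s\<close>, every vertex of a path on
  \<open>s\<close> vertices lies on an edge, so the new vertex cannot occur in one.\<close>

lemma exn_mono:
  assumes "2 \<le> s"
  shows "exn 1 s a \<le> exn 1 s (Suc a)"
proof -
  obtain V :: "nat set" and E where V: "finite V" "card V = a" "graph_rel E" "\<not> has_power 1 s V E"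
    "degsum V E = 2 * exn 1 s a" using exn_attained[of 1 s a] assms by auto
  obtain N where N: "\<forall>v\<in>V. v < N" using V(1) finite_nat_set_iff_bounded by auto
  define E' where "E' u v \<longleftrightarrow> u \<in> V \<and> v \<in> V \<and> E u v" for u v
  have gE': "graph_rel E'" using V(3) by (auto simp: graph_rel_def E'_def)
  have NV: "N \<notin> V" using N by blast
  have no: "\<not> has_power 1 s (insert N V) E'"
  proof
    assume "has_power 1 s (insert N V) E'"
    then obtain \<phi> where \<phi>: "inj_on \<phi> {..<s}" "\<And>i j. i < j \<Longrightarrow> j < s \<Longrightarrow> j \<le> i + 1 \<Longrightarrow> E' (\<phi> i) (\<phi> j)"
      by (auto simp: has_power_def)
    have "\<phi> i \<in> V" if "i < s" for i
    proof (cases "Suc i < s")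
      case True then show ?thesis using \<phi>(2)[of i "Suc i"] by (simp add: E'_def)
    next
      case False
      then show ?thesis using \<phi>(2)[of "i - 1" i] that assms by (simp add: E'_def)
    qed
    then have "has_power 1 s V E" unfolding has_power_def using \<phi> by (intro exI[of _ \<phi>]) (auto simp: E'_def)
    then show False using V(4) by blast
  qed
  have "degsum (insert N V) E' = degsum (insert N V - {N}) E' + 2 * card (nbh (insert N V) E' N)"
    by (rule degsum_remove) (use V(1) gE' in auto)
  moreover have "insert N V - {N} = V" "nbh (insert N V) E' N = {}" using NV by (auto simp: nbh_def E'_def)
  moreover have "degsum V E' = degsum V E" by (rule degsum_cong) (simp add: E'_def)
  moreover have "degsum (insert N V) E' \<le> 2 * exn 1 s (Suc a)"
    using degsum_le_exn[OF _ gE' no] V(1,2) NV by simp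
  ultimately show ?thesis using V(5) by simp
qed

section \<open>The best join and its growth\<close>

definition join_opt :: "nat \<Rightarrow> nat \<Rightarrow> nat \<Rightarrow> nat" where
  "join_opt p s n = Max {exn 1 s a + a * b + turan_num b (p - 1) | a b. a + b = n}"

lemma finite_join_set: "finite {exn 1 s a + a * b + turan_num b (p - 1) | a b. a + b = n}"
proof -
  have "{exn 1 s a + a * b + turan_num b (p - 1) | a b. a + b = n} \<subseteq>
      (\<lambda>(a, b). exn 1 s a + a * b + turan_num b (p - 1)) ` ({..n} \<times> {..n})" by force
  then show ?thesis by (rule finite_subset) simp
qed

lemma join_opt_ge: "a + b = n \<Longrightarrow> exn 1 s a + a * b + turan_num b (p - 1) \<le> join_opt p s n"
  unfolding join_opt_def by (rule Max_ge[OF finite_join_set]) blast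

lemma join_opt_attained:
  obtains a b where "a + b = n" "join_opt p s n = exn 1 s a + a * b + turan_num b (p - 1)"
proof -
  have "\<exists>a b. a + b = n" by (intro exI[of _ 0] exI[of _ n]) simp
  then have "{exn 1 s a + a * b + turan_num b (p - 1) | a b. a + b = n} \<noteq> {}" by blast
  then have "join_opt p s n \<in> {exn 1 s a + a * b + turan_num b (p - 1) | a b. a + b = n}"
    unfolding join_opt_def by (rule Max_in[OF finite_join_set])
  then show ?thesis using that by blast
qed

text \<open>In an optimal join, enlarging the first part gains at least \<open>b\<close> and
  enlarging the Turan part gains \<open>m - b div (p - 1)\<close>. Taking the first with weight 1
  and the second with weight \<open>p - 1\<close> gives at least \<open>(p - 1) * m\<close>.\<close>

lemma join_opt_Suc:
  assumes "2 \<le> p" "2 \<le> s"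
  shows "p * join_opt p s m + (p - 1) * m \<le> p * join_opt p s (Suc m)"
proof -
  obtain a b where ab: "a + b = m" "join_opt p s m = exn 1 s a + a * b + turan_num b (p - 1)"
    using join_opt_attained .
  define q where "q = p - 1"
  have q: "1 \<le> q" "p = Suc q" using assms by (auto simp: q_def)
  have 1: "join_opt p s m + b \<le> join_opt p s (Suc m)"
    using join_opt_ge[of "Suc a" b "Suc m" s p] exn_mono[OF assms(2), of a] ab by simp
  have 2: "join_opt p s m + m \<le> join_opt p s (Suc m) + b div q"
    using join_opt_ge[of a "Suc b" "Suc m" s p] turan_num_Suc[OF q(1), of b] ab by (simp add: q_def)
  have "q * (b div q) \<le> b" by (rule times_div_less_eq_dividend)
  moreover have "q * (join_opt p s m + m) \<le> q * (join_opt p s (Suc m) + b div q)" by (rule mult_le_mono2[OF 2])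
  ultimately have "join_opt p s m + q * (join_opt p s m) + q * m \<le> join_opt p s (Suc m) + q * join_opt p s (Suc m)"
    using 1 unfolding distrib_left by linarith
  then show ?thesis using q by simp
qed

definition extremal :: "nat \<Rightarrow> nat \<Rightarrow> 'a set \<Rightarrow> ('a \<Rightarrow> 'a \<Rightarrow> bool) \<Rightarrow> bool" where
  "extremal p k V E \<longleftrightarrow> finite V \<and> graph_rel E \<and> \<not> has_power p k V E \<and> degsum V E = 2 * exn p k (card V)"

text \<open>If \<open>X > f\<close> infinitely often, the difference \<open>X - f\<close> does not decrease infinitely often at a
  point where it is positive. There, deleting a vertex of an extremal graph shows that its minimum
  degree is large.\<close>

lemma exists_nondecreasing_step:
  fixes X f :: "nat \<Rightarrow> nat"
  assumes "\<And>N. \<exists>n\<ge>N. f n < X n" "\<And>n. f n \<le> X n"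
  shows "\<exists>m\<ge>M. f (Suc m) < X (Suc m) \<and> X m + f (Suc m) \<le> X (Suc m) + f m"
proof (rule ccontr)
  assume "\<not> ?thesis"
  then have neg: "\<And>m. M \<le> m \<Longrightarrow> f (Suc m) < X (Suc m) \<Longrightarrow> X (Suc m) + f m < X m + f (Suc m)"
    by (meson not_le)
  \<comment> \<open>While the difference stays positive it has dropped by at least one in every step
    since \<open>M\<close>, and its value at \<open>M\<close> allows only finitely many such
    steps.\<close>
  have grow: "X (M + t) - f (M + t) + t \<le> X M - f M" if "f (M + t) < X (M + t)" for t
    using that
  proof (induction t)
    case (Suc t)
    then have "X (Suc (M + t)) + f (M + t) < X (M + t) + f (Suc (M + t))" using neg[of "M + t"] by simp
    then show ?case using Suc assms(2)[of "M + t"] by simp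
  qed simp
  obtain n where n: "n \<ge> M + (X M - f M)" "f n < X n" using assms(1) by blast
  then show False using grow[of "n - M"] by simp
qed

lemma exn_antimono_length:
  assumes "1 \<le> p" "2 \<le> k" "k \<le> k'"
  shows "exn p k n \<le> exn p k' n"
proof -
  obtain V :: "nat set" and E where V: "finite V" "card V = n" "graph_rel E" "\<not> has_power p k V E"
    "degsum V E = 2 * exn p k n" using exn_attained[of p k n] assms by auto
  then have "\<not> has_power p k' V E" using has_power_mono[of p k' V E V k] assms by blast
  then show ?thesis using degsum_le_exn[OF V(1,3)] V(2,5) by fastforce
qed

text \<open>At a step from \<open>exists_nondecreasing_step\<close>, a degree in an extremal graph
  is at least the increment of \<open>exn\<close>, hence at least that of \<open>join_opt\<close>,
  which \<open>join_opt_Suc\<close> bounds from below. This holds for every extremal graph on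
  \<open>V\<close>, and \<open>core\<close> receives it in this generality because symmetrisation
  will replace the graph.\<close>

lemma exn_eq_join_opt_of_core:
  assumes p: "2 \<le> p" and q: "1 \<le> q" and c: "c \<le> 1" and K: "K + 1 = q * (p + 1) + p + c" and s: "s = 2 * q + c"
    and core: "\<And>V E. M \<le> card V \<Longrightarrow> extremal p K (V :: nat set) E \<Longrightarrow> join_opt p s (card V) < exn p K (card V) \<Longrightarrow>
       (\<And>E' v. extremal p K V E' \<Longrightarrow> v \<in> V \<Longrightarrow> (p - 1) * (card V - 1) \<le> p * card (nbh V E' v)) \<Longrightarrow> False"
  shows "\<exists>N. \<forall>n\<ge>N. exn p K n = join_opt p s n"
proof (rule ccontr)
  assume neg: "\<not> ?thesis"
  have qp: "p + 1 \<le> q * (p + 1)" using mult_le_mono1[OF q, of "p + 1"] by simp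
  have K2: "p + 1 \<le> K" using qp K p by linarith
  have Kdm: "K div (p + 1) = q \<and> K mod (p + 1) = p - 1 + c"
  proof -
    have e: "K = q * (p + 1) + (p - 1 + c)" using K p by linarith
    have "p - 1 + c < p + 1" using p c by linarith
    moreover have "(a * d + b) div d = a \<and> (a * d + b) mod d = b" if "b < d" for a b d :: nat
      using that by simp
    ultimately show ?thesis unfolding e by blast
  qed
  have sK: "s = 2 * (K div (p + 1)) + (if K mod (p + 1) = p then 1 else 0)"
    using Kdm s c p by auto
  have low: "join_opt p s n \<le> exn p K n" for n
  proof -
    obtain a b where ab: "a + b = n" "join_opt p s n = exn 1 s a + a * b + turan_num b (p - 1)"
      using join_opt_attained .
    show ?thesis using exn_join_le[OF p K2 ab(1) sK] ab(2) by simp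
  qed
  have "\<exists>n\<ge>N. join_opt p s n < exn p K n" for N
  proof -
    obtain n where n: "n \<ge> N" "exn p K n \<noteq> join_opt p s n" using neg by blast
    then have "join_opt p s n < exn p K n" using low[of n] by linarith
    then show ?thesis using n by blast
  qed
  then obtain m where m: "M \<le> m" "join_opt p s (Suc m) < exn p K (Suc m)"
      "exn p K m + join_opt p s (Suc m) \<le> exn p K (Suc m) + join_opt p s m"
    using exists_nondecreasing_step[of "join_opt p s" "exn p K" M] low by blast
  obtain V :: "nat set" and E where V: "finite V" "card V = Suc m" "graph_rel E" "\<not> has_power p K V E"
    "degsum V E = 2 * exn p K (Suc m)" using exn_attained[of p K "Suc m"] p K2 by auto
  show False
  proof (rule core[of V E])
    show "M \<le> card V" using m V by simp
    show "extremal p K V E" using V by (simp add: extremal_def)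
    show "join_opt p s (card V) < exn p K (card V)" using m V by simp
    fix E' v assume ex: "extremal p K V E'" and v: "v \<in> V"
    have "degsum V E' = degsum (V - {v}) E' + 2 * card (nbh V E' v)"
      using ex v by (intro degsum_remove) (auto simp: extremal_def)
    moreover have "\<not> has_power p K (V - {v}) E'"
      using ex has_power_mono[of p K "V - {v}" E' V K] by (auto simp: extremal_def)
    then have "degsum (V - {v}) E' \<le> 2 * exn p K m"
      using degsum_le_exn[of "V - {v}" E' p K] ex v V by (simp add: extremal_def)
    ultimately have "exn p K (Suc m) \<le> exn p K m + card (nbh V E' v)" using ex V(2) by (simp add: extremal_def)
    then have "join_opt p s (Suc m) \<le> join_opt p s m + card (nbh V E' v)" using m(3) by linarith
    then have "p * join_opt p s (Suc m) \<le> p * join_opt p s m + p * card (nbh V E' v)"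
      by (metis distrib_left mult_le_mono2)
    then show "(p - 1) * (card V - 1) \<le> p * card (nbh V E' v)" using join_opt_Suc[of p s m] p s q V(2) by simp
  qed
qed

subsection \<open>Graphs with large twin classes\<close>

lemma no_path_imp_no_power:
  assumes "\<And>xs. gpath V E xs \<Longrightarrow> length xs \<noteq> s"
  shows "\<not> has_power 1 s V E"
proof
  assume "has_power 1 s V E"
  then obtain \<phi> where \<phi>: "inj_on \<phi> {..<s}" "\<phi> ` {..<s} \<subseteq> V"
    "\<And>i j. i < j \<Longrightarrow> j < s \<Longrightarrow> j \<le> i + 1 \<Longrightarrow> E (\<phi> i) (\<phi> j)" by (auto simp: has_power_def)
  have "gpath V E (map \<phi> [0..<s])" unfolding gpath_def
    using \<phi> by (auto simp: distinct_map successively_conv_nth atLeast0LessThan)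
  then show False using assms[of "map \<phi> [0..<s]"] by simp
qed

lemma degsum_diff_le:
  assumes "finite V" "S \<subseteq> V" "graph_rel E"
  shows "degsum V E \<le> degsum (V - S) E + 2 * card S * card V"
proof -
  let ?W = "V - S"
  have fin: "finite S" "finite ?W" using assms finite_subset by auto
  have "?W \<union> S = V" using assms(2) by auto
  then have "degsum V E = degsum ?W E + degsum S E + 2 * (\<Sum>v\<in>S. card (nbh ?W E v))"
    using degsum_Un[OF fin(2,1) _ assms(3)] by (metis Diff_disjoint Int_commute)
  moreover have "degsum S E + (\<Sum>v\<in>S. card (nbh ?W E v)) \<le> (\<Sum>v\<in>S. card V)"
    unfolding degsum_def sum.distrib[symmetric]
  proof (rule sum_mono)
    fix v
    have "card (nbh S E v) + card (nbh ?W E v) = card (nbh (S \<union> ?W) E v)"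
      using card_nbh_Un[OF fin, of E v] by (simp add: Diff_disjoint)
    also have "\<dots> \<le> card V" using assms(1,2) by (intro card_mono) (auto simp: nbh_def)
    finally show "card (nbh S E v) + card (nbh ?W E v) \<le> card V" .
  qed
  ultimately show ?thesis by simp
qed

text \<open>Let \<open>VV j\<close> be the set of vertices without neighbours in \<open>T j\<close>, and \<open>VV 0\<close> the set of those
  joined to all of every \<open>T j\<close>. As the graph beats every join, some vertex \<open>z\<close> of a class \<open>VV j\<close>
  starts a path longer than twice the number of vertices that \<open>z\<close> misses in \<open>VV 0\<close>. The remaining
  vertices of \<open>VV 0\<close> then contain a path that can be linked to it.\<close>

lemma twin_classes_contradiction:
  fixes V :: "nat set" and T :: "nat \<Rightarrow> nat set"
  assumes p: "2 \<le> p" and q: "1 \<le> q" and b: "b \<le> 1" and k: "k + 1 = q * (p + 1) + p + b" and s: "s = 2 * q + b"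
    and V: "finite V" "graph_rel E" "\<not> has_power p k V E"
    and md: "\<And>v. v \<in> V \<Longrightarrow> (p - 1) * (card V - 1) \<le> p * card (nbh V E v)"
    and T: "\<And>j. j \<in> {1..<p} \<Longrightarrow> T j \<subseteq> V" "\<And>j x y. j \<in> {1..<p} \<Longrightarrow> x \<in> T j \<Longrightarrow> y \<in> T j \<Longrightarrow> nbh V E x = nbh V E y"
      "\<And>i j. i \<in> {1..<p} \<Longrightarrow> j \<in> {1..<p} \<Longrightarrow> i \<noteq> j \<Longrightarrow> T i \<inter> T j = {}"
      "\<And>j. j \<in> {1..<p} \<Longrightarrow> card V \<le> p * card (T j) + \<delta>"
    and big: "p * p + p * s * (\<delta> + p) + p * s * s + k * (\<delta> + 2 * p) + 2 * \<delta> + p < card V"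
    and opt: "2 * join_opt p s (card V) < degsum V E"
  shows False
proof -
  define m where "m = card V"
  have sym: "E u v \<Longrightarrow> E v u" for u v using graph_relD(1)[OF V(2)] .
  have s2: "2 \<le> s" using q s by simp
  have pm: "p * m + 1 = (p - 1) * (m - 1) + m + p"
  proof -
    have "m \<ge> 1" using big by (simp add: m_def)
    then obtain m' where "m = Suc m'" using not0_implies_Suc by fastforce
    moreover obtain p' where "p = Suc p'" using p not0_implies_Suc by fastforce
    ultimately show ?thesis by simp
  qed
  \<comment> \<open>A vertex has at most \<open>(m + p - 1) / p\<close> non-neighbours, itself
    included. The size estimates below rest on this allowance.\<close>
  have nonnb: "p * card A + 1 \<le> m + p" if "v \<in> V" "A \<subseteq> V" "\<And>x. x \<in> A \<Longrightarrow> \<not> E v x" for v A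
  proof -
    have "nbh V E v \<subseteq> V - A" using that by (auto simp: nbh_def)
    then have "card (nbh V E v) \<le> card (V - A)" using V by (intro card_mono) auto
    also have "\<dots> = m - card A" using that V by (simp add: m_def card_Diff_subset finite_subset)
    finally have "card (nbh V E v) + card A \<le> m" using that V card_mono[of V A] by (simp add: m_def)
    then have "p * card (nbh V E v) + p * card A \<le> p * m" by (metis distrib_left mult_le_mono2)
    then show ?thesis using md[OF that(1)] pm unfolding m_def by linarith
  qed
  define VV where "VV i = (if i = 0 then {v \<in> V. \<forall>j\<in>{1..<p}. \<forall>x\<in>T j. E v x} else {v \<in> V. \<forall>x\<in>T i. \<not> E v x})" for i
  \<comment> \<open>Vertices of \<open>T j\<close> have equal neighbourhoods, so \<open>v\<close>
    sees all of them or none; this makes the sets \<open>VV i\<close> cover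
    \<open>V\<close>.\<close>
  have dich: "(\<forall>x\<in>T j. E v x) \<or> (\<forall>x\<in>T j. \<not> E v x)" if "v \<in> V" "j \<in> {1..<p}" for v j
  proof -
    have "E v x \<longleftrightarrow> E v y" if "x \<in> T j" "y \<in> T j" for x y
    proof -
      have "v \<in> nbh V E x \<longleftrightarrow> v \<in> nbh V E y" using T(2)[OF \<open>j \<in> {1..<p}\<close> that] by simp
      then show ?thesis using \<open>v \<in> V\<close> sym by (auto simp: nbh_def)
    qed
    then show ?thesis by blast
  qed
  have TV: "T j \<subseteq> VV j" if j: "j \<in> {1..<p}" for j
  proof
    fix x assume x: "x \<in> T j"
    have "\<not> E x y" if y: "y \<in> T j" for y
    proof
      assume "E x y"
      then have "y \<in> nbh V E x" using y T(1)[OF j] by (auto simp: nbh_def)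
      then have "y \<in> nbh V E y" using T(2)[OF j x y] by simp
      then show False using graph_relD(2)[OF V(2)] by (auto simp: nbh_def)
    qed
    then show "x \<in> VV j" using x T(1)[OF j] j by (auto simp: VV_def)
  qed
  have cT: "m \<le> p * card (T j) + \<delta>" if "j \<in> {1..<p}" for j using T(4)[OF that] by (simp add: m_def)
  have Tne: "T j \<noteq> {}" if "j \<in> {1..<p}" for j using cT[OF that] big by (auto simp: m_def)
  have VVsub: "VV i \<subseteq> V" for i by (auto simp: VV_def)
  have finVV: "finite (VV i)" for i using finite_subset[OF VVsub V(1)] .
  have finT: "finite (T j)" if "j \<in> {1..<p}" for j using finite_subset[OF T(1)[OF that] V(1)] .
  \<comment> \<open>Missing two twin classes of about \<open>m / p\<close> vertices each would
    exceed the allowance of non-neighbours.\<close>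
  have disj: "VV i \<inter> VV j = {}" if "i < p" "j < p" "i \<noteq> j" for i j
  proof (rule ccontr)
    assume "VV i \<inter> VV j \<noteq> {}"
    then obtain v where v: "v \<in> VV i" "v \<in> VV j" by auto
    show False
    proof (cases "i = 0 \<or> j = 0")
      case True
      define l where "l = (if i = 0 then j else i)"
      have l: "l \<in> {1..<p}" "v \<in> VV 0" "v \<in> VV l" using True that v by (auto simp: l_def)
      then obtain x where "x \<in> T l" using Tne by auto
      then show False using l by (auto simp: VV_def)
    next
      case False
      then have ij: "i \<in> {1..<p}" "j \<in> {1..<p}" using that by auto
      have "p * card (T i \<union> T j) + 1 \<le> m + p" using v False T(1)[OF ij(1)] T(1)[OF ij(2)]
        by (intro nonnb[of v]) (auto simp: VV_def)
      moreover have "card (T i \<union> T j) = card (T i) + card (T j)"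
        using T(3)[OF ij that(3)] finT ij by (simp add: card_Un_disjoint)
      ultimately show False using cT[OF ij(1)] cT[OF ij(2)] big by (simp add: m_def distrib_left)
    qed
  qed
  have cover: "(\<Union>i<p. VV i) = V"
  proof
    show "V \<subseteq> (\<Union>i<p. VV i)"
    proof
      fix v assume v: "v \<in> V"
      show "v \<in> (\<Union>i<p. VV i)"
      proof (cases "v \<in> VV 0")
        case True then show ?thesis using p by auto
      next
        case False
        then have "\<not> (\<forall>j\<in>{1..<p}. \<forall>x\<in>T j. E v x)" using v by (simp add: VV_def)
        then obtain j where j: "j \<in> {1..<p}" "\<not> (\<forall>x\<in>T j. E v x)" by blast
        then have "v \<in> VV j" using dich[OF v j(1)] v by (auto simp: VV_def)
        then show ?thesis using j by auto
      qed
    qed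
  qed (use VVsub in auto)
  define a where "a = card (VV 0)"
  define M where "M v = VV 0 - nbh (VV 0) E v" for v
  have VVub: "p * card (VV j) \<le> m + p" if j: "j \<in> {1..<p}" for j
  proof -
    obtain x where x: "x \<in> T j" using Tne[OF j] by auto
    have "p * card (VV j) + 1 \<le> m + p" using x T(1)[OF j] VVsub j
      by (intro nonnb[of x]) (auto simp: VV_def dest: sym)
    then show ?thesis by simp
  qed
  \<comment> \<open>The other classes have at most \<open>(m + p) / p\<close> vertices each, which
    leaves about \<open>m / p\<close> for class 0.\<close>
  have alb: "m \<le> p * a + p * p"
  proof -
    have "m = card (\<Union>i<p. VV i)" by (simp add: cover m_def)
    also have "\<dots> \<le> (\<Sum>i<p. card (VV i))" by (intro card_UN_le) simp
    also have "{..<p} = insert 0 {1..<p}" using p by auto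
    also have "(\<Sum>i\<in>insert 0 {1..<p}. card (VV i)) = a + (\<Sum>i\<in>{1..<p}. card (VV i))" by (simp add: a_def)
    finally have "p * m \<le> p * a + (\<Sum>i\<in>{1..<p}. p * card (VV i))"
      by (metis distrib_left mult_le_mono2 sum_distrib_left)
    also have "(\<Sum>i\<in>{1..<p}. p * card (VV i)) \<le> card {1..<p} * (m + p)"
      using sum_bounded_above[of "{1..<p}" "\<lambda>i. p * card (VV i)" "m + p"] VVub by simp
    also have "card {1..<p} * (m + p) = (p - 1) * (m + p)" by simp
    finally have 1: "p * m \<le> p * a + (p - 1) * (m + p)" by simp
    obtain p' where "p = Suc p'" using p not0_implies_Suc by fastforce
    then show ?thesis using 1 by (simp add: algebra_simps)
  qed
  \<comment> \<open>Missing \<open>T j\<close> nearly exhausts the allowance of \<open>v\<close>, so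
    few further misses remain for \<open>VV 0\<close>. The upper bound on \<open>VV j\<close>
    likewise leaves little room beside \<open>T j\<close>.\<close>
  have MTb: "p * card (M v) \<le> \<delta> + p \<and> p * card (VV j - T j) \<le> \<delta> + p" if j: "j \<in> {1..<p}" "v \<in> VV j" for j v
  proof
    have "p * card (T j \<union> M v) + 1 \<le> m + p" using j T(1)[OF j(1)] VVsub
      by (intro nonnb[of v]) (auto simp: VV_def M_def nbh_def)
    moreover have "T j \<inter> M v = {}" using TV[OF j(1)] disj[of 0 j] j by (auto simp: M_def)
    then have "card (T j \<union> M v) = card (T j) + card (M v)"
      using finT[OF j(1)] finVV[of 0] by (intro card_Un_disjoint) (auto simp: M_def)
    ultimately show "p * card (M v) \<le> \<delta> + p" using cT[OF j(1)] by (simp add: distrib_left)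
    have "card (VV j) = card (T j) + card (VV j - T j)"
      using TV[OF j(1)] finVV[of j] finT[OF j(1)] by (simp add: card_Diff_subset card_mono)
    then have "p * card (T j) + p * card (VV j - T j) \<le> m + p" using VVub[OF j(1)] by (metis distrib_left)
    then show "p * card (VV j - T j) \<le> \<delta> + p" using cT[OF j(1)] by simp
  qed
  \<comment> \<open>In the classes with positive index the twins serve as reservoir: every vertex of
    another class is adjacent to all of them.\<close>
  define F where "F i = (if i = 0 then VV 0 else T i)" for i
  have rs: "richsys E p k VV F" unfolding richsys_def
  proof (intro conjI allI impI)
    fix i assume i: "i < p"
    show "F i \<subseteq> VV i" "finite (F i)" using TV[of i] finVV finT[of i] i by (auto simp: F_def)
    show "VV i \<inter> VV j = {}" if "j < p" "i \<noteq> j" for j using disj i that by blast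
    fix Q :: "nat set" assume Q: "finite Q" "card Q \<le> k" "\<forall>q\<in>Q. \<exists>j<p. j \<noteq> i \<and> q \<in> VV j"
    show "k \<le> card {x \<in> F i. \<forall>q\<in>Q. E q x}"
    proof (cases "i = 0")
      case True
      have "VV 0 - (\<Union>q\<in>Q. M q) \<subseteq> {x \<in> F i. \<forall>q\<in>Q. E q x}" using True by (auto simp: F_def M_def nbh_def)
      then have "card (VV 0 - (\<Union>q\<in>Q. M q)) \<le> card {x \<in> F i. \<forall>q\<in>Q. E q x}"
        using finVV[of 0] True by (intro card_mono) (auto simp: F_def)
      moreover have "a \<le> card (VV 0 - (\<Union>q\<in>Q. M q)) + card (\<Union>q\<in>Q. M q)"
        unfolding a_def using diff_card_le_card_Diff[of "\<Union>q\<in>Q. M q" "VV 0"] Q(1) finVV[of 0] by (auto simp: M_def)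
      moreover have "p * card (\<Union>q\<in>Q. M q) \<le> k * (\<delta> + p)"
      proof -
        have "card (\<Union>q\<in>Q. M q) \<le> (\<Sum>q\<in>Q. card (M q))" using Q(1) by (rule card_UN_le)
        then have "p * card (\<Union>q\<in>Q. M q) \<le> (\<Sum>q\<in>Q. p * card (M q))"
          by (metis mult_le_mono2 sum_distrib_left)
        also have "\<dots> \<le> card Q * (\<delta> + p)"
        proof -
          have "p * card (M q) \<le> \<delta> + p" if qQ: "q \<in> Q" for q
          proof -
            obtain j where "j < p" "j \<noteq> 0" "q \<in> VV j" using Q(3)[rule_format, OF qQ] unfolding True by blast
            then show ?thesis using MTb[of j q] by auto
          qed
          then show ?thesis using sum_bounded_above[of Q "\<lambda>q. p * card (M q)" "\<delta> + p"] by simp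
        qed
        also have "\<dots> \<le> k * (\<delta> + p)" using Q(2) by simp
        finally show ?thesis .
      qed
      ultimately have 1: "p * a \<le> p * card {x \<in> F i. \<forall>q\<in>Q. E q x} + k * (\<delta> + p)"
      proof -
        assume "card (VV 0 - (\<Union>q\<in>Q. M q)) \<le> card {x \<in> F i. \<forall>q\<in>Q. E q x}"
          "a \<le> card (VV 0 - (\<Union>q\<in>Q. M q)) + card (\<Union>q\<in>Q. M q)" "p * card (\<Union>q\<in>Q. M q) \<le> k * (\<delta> + p)"
        then have "a \<le> card {x \<in> F i. \<forall>q\<in>Q. E q x} + card (\<Union>q\<in>Q. M q)" by linarith
        then have "p * a \<le> p * card {x \<in> F i. \<forall>q\<in>Q. E q x} + p * card (\<Union>q\<in>Q. M q)"
          by (metis distrib_left mult_le_mono2)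
        then show ?thesis using \<open>p * card (\<Union>q\<in>Q. M q) \<le> k * (\<delta> + p)\<close> by linarith
      qed
      have "p * k \<le> p * card {x \<in> F i. \<forall>q\<in>Q. E q x}"
      proof -
        have "k * (\<delta> + 2 * p) = k * (\<delta> + p) + p * k" by (simp add: algebra_simps)
        then show ?thesis using 1 alb big unfolding m_def by linarith
      qed
      then show ?thesis using p by simp
    next
      case False
      then have i': "i \<in> {1..<p}" using i by auto
      have "E q x" if qQ: "q \<in> Q" and xT: "x \<in> T i" for q x
      proof -
        obtain j where j: "j < p" "j \<noteq> i" "q \<in> VV j" using Q(3)[rule_format, OF qQ] by blast
        have "q \<notin> VV i" using disj[of i j] j i by auto
        then show ?thesis using dich[of q i] i' xT VVsub j False by (auto simp: VV_def)
      qed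
      then have eq: "{x \<in> F i. \<forall>q\<in>Q. E q x} = T i" using False by (auto simp: F_def)
      have "k * (\<delta> + 2 * p) = k * \<delta> + p * k + p * k" by (simp add: algebra_simps)
      then have "p * k \<le> p * card (T i)" using cT[OF i'] big unfolding m_def by linarith
      then show ?thesis unfolding eq using p by simp
    qed
  qed
  have nopath: "length xs \<noteq> s" if "i < p" "gpath (VV i) E xs" for i xs
    using richsys_path_has_power[OF V(2) rs p that(1) b k that(2)] V(3) s unfolding cover by auto
  have po: "path_order W E v \<le> s - 1" if "i < p" "W \<subseteq> VV i" "v \<in> W" for i W v
  proof -
    have "finite W" using that finVV finite_subset by blast
    then have "path_order W E v < s" using nopath[OF that(1)] gpath_mono[OF _ that(2)]
      by (intro path_order_bound that) blast+
    then show ?thesis by simp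
  qed
  define B where "B = (\<Union>j\<in>{1..<p}. VV j)"
  have finB: "finite B" by (simp add: B_def finVV)
  have V0B: "VV 0 \<union> B = V" "VV 0 \<inter> B = {}"
  proof -
    have "{..<p} = insert 0 {1..<p}" using p by auto
    then show "VV 0 \<union> B = V" using cover by (simp add: B_def)
    show "VV 0 \<inter> B = {}" using disj[of 0] p by (fastforce simp: B_def)
  qed
  define cl where "cl v = (SOME j. j \<in> {1..<p} \<and> v \<in> VV j)" for v
  have cl: "cl v = j" if "j \<in> {1..<p}" "v \<in> VV j" for v j
  proof -
    have "cl v \<in> {1..<p} \<and> v \<in> VV (cl v)" unfolding cl_def by (rule someI[of _ j]) (use that in blast)
    then show ?thesis using disj[of j "cl v"] that by auto
  qed
  have sumB: "(\<Sum>v\<in>B. g v) = (\<Sum>j\<in>{1..<p}. \<Sum>v\<in>VV j. g v)" for g :: "nat \<Rightarrow> nat"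
    unfolding B_def using finVV disj by (intro sum.UNION_disjoint) auto
  have degB: "degsum B E \<le> (\<Sum>j\<in>{1..<p}. degsum (VV j) E) + 2 * turan_num (card B) (p - 1)"
  proof -
    have "degsum B E \<le> (\<Sum>v\<in>B. card (nbh (VV (cl v)) E v) + card (nbh B (\<lambda>u v. cl u - 1 \<noteq> cl v - 1) v))"
      unfolding degsum_def
    proof (rule sum_mono)
      fix v assume v: "v \<in> B"
      then obtain j where j: "j \<in> {1..<p}" "v \<in> VV j" by (auto simp: B_def)
      have "nbh B E v \<subseteq> nbh (VV (cl v)) E v \<union> nbh B (\<lambda>u v. cl u - 1 \<noteq> cl v - 1) v"
      proof
        fix u assume u: "u \<in> nbh B E v"
        then obtain i where i: "i \<in> {1..<p}" "u \<in> VV i" by (auto simp: B_def nbh_def)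
        show "u \<in> nbh (VV (cl v)) E v \<union> nbh B (\<lambda>u v. cl u - 1 \<noteq> cl v - 1) v"
          using u i j cl[OF i] cl[OF j] by (cases "i = j") (auto simp: nbh_def)
      qed
      then have "card (nbh B E v) \<le> card (nbh (VV (cl v)) E v \<union> nbh B (\<lambda>u v. cl u - 1 \<noteq> cl v - 1) v)"
        using finVV finB by (intro card_mono) auto
      also have "\<dots> \<le> card (nbh (VV (cl v)) E v) + card (nbh B (\<lambda>u v. cl u - 1 \<noteq> cl v - 1) v)"
        by (rule card_Un_le)
      finally show "card (nbh B E v) \<le> card (nbh (VV (cl v)) E v) + card (nbh B (\<lambda>u v. cl u - 1 \<noteq> cl v - 1) v)" .
    qed
    also have "\<dots> = (\<Sum>v\<in>B. card (nbh (VV (cl v)) E v)) + degsum B (\<lambda>u v. cl u - 1 \<noteq> cl v - 1)"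
      by (simp add: degsum_def sum.distrib)
    also have "(\<Sum>v\<in>B. card (nbh (VV (cl v)) E v)) = (\<Sum>j\<in>{1..<p}. degsum (VV j) E)"
      unfolding sumB degsum_def using cl by (intro sum.cong refl) auto
    also have "degsum B (\<lambda>u v. cl u - 1 \<noteq> cl v - 1) \<le> 2 * turan_num (card B) (p - 1)"
    proof (rule degsum_multipartite_le[OF _ finB])
      fix v assume "v \<in> B"
      then obtain j where j: "j \<in> {1..<p}" "v \<in> VV j" by (auto simp: B_def)
      then show "cl v - 1 < p - 1" using cl[OF j] by auto
    qed (use p in simp)
    finally show ?thesis by simp
  qed
  have nb0: "card (nbh (VV 0) E v) + card (M v) = a" for v
    unfolding M_def a_def using finVV[of 0] card_Diff_subset[of "nbh (VV 0) E v" "VV 0"]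
      card_mono[OF finVV[of 0] nbh_subset] nbh_subset[of "VV 0" E v] by simp
  have "degsum V E = degsum (VV 0) E + degsum B E + 2 * (\<Sum>v\<in>B. card (nbh (VV 0) E v))"
    using degsum_Un[OF finVV[of 0] finB V0B(2) V(2)] V0B(1) by simp
  moreover have "(\<Sum>v\<in>B. card (nbh (VV 0) E v)) + (\<Sum>v\<in>B. card (M v)) = a * card B"
    unfolding sum.distrib[symmetric] nb0 by simp
  moreover have "exn 1 s a + a * card B + turan_num (card B) (p - 1) \<le> join_opt p s m"
    using card_Un_disjoint[OF finVV[of 0] finB V0B(2)] V0B(1) by (intro join_opt_ge) (simp add: a_def m_def)
  \<comment> \<open>Compared with the join on \<open>a\<close> and \<open>card B\<close> vertices,
    the graph lacks the pairs counted by \<open>M\<close>, and only edges inside the classes can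
    compensate. As it has more edges than the join, this gain outweighs the loss.\<close>
  ultimately have key: "2 * exn 1 s a + 2 * (\<Sum>v\<in>B. card (M v)) < degsum (VV 0) E + (\<Sum>j\<in>{1..<p}. degsum (VV j) E)"
    using degB opt unfolding m_def by linarith
  have "degsum (VV 0) E \<le> 2 * exn 1 s a" unfolding a_def
    using no_path_imp_no_power[of "VV 0" E s] nopath[of 0] p by (intro degsum_le_exn finVV V) auto
  then have keyA: "2 * (\<Sum>v\<in>B. card (M v)) < (\<Sum>j\<in>{1..<p}. degsum (VV j) E)" using key by linarith
  have keyB: "2 * exn 1 s a < degsum (VV 0) E + (\<Sum>j\<in>{1..<p}. degsum (VV j) E)" using key by linarith
  have "(\<Sum>j\<in>{1..<p}. degsum (VV j) E) \<le> (\<Sum>j\<in>{1..<p}. \<Sum>v\<in>VV j. path_order (VV (cl v)) E v - 1)"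
  proof (rule sum_mono)
    fix j assume j: "j \<in> {1..<p}"
    have "degsum (VV j) E \<le> (\<Sum>v\<in>VV j. path_order (VV j) E v - 1)"
      by (rule degsum_le_path_order[OF finVV V(2)])
    also have "\<dots> = (\<Sum>v\<in>VV j. path_order (VV (cl v)) E v - 1)" using cl[OF j] by simp
    finally show "degsum (VV j) E \<le> (\<Sum>v\<in>VV j. path_order (VV (cl v)) E v - 1)" .
  qed
  also have "\<dots> = (\<Sum>v\<in>B. path_order (VV (cl v)) E v - 1)" by (rule sumB[symmetric])
  finally have "(\<Sum>v\<in>B. 2 * card (M v)) < (\<Sum>v\<in>B. path_order (VV (cl v)) E v - 1)"
    using keyA by (simp add: sum_distrib_left)
  \<comment> \<open>The Erdos-Gallai bound distributes the edges inside the classes over single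
    vertices, so that some vertex gains more than it loses.\<close>
  then have "\<exists>z\<in>B. 2 * card (M z) < path_order (VV (cl z)) E z - 1"
    by (meson not_le sum_mono)
  then obtain z j where z: "j \<in> {1..<p}" "z \<in> VV j" "2 * card (M z) < path_order (VV j) E z - 1"
    using cl by (auto simp: B_def)
  define r where "r = path_order (VV j) E z"
  obtain ys where ys: "gpath (VV j) E ys" "ys \<noteq> []" "hd ys = z" "length ys = r"
    using path_order_attained[OF finVV z(2)] by (metis r_def)
  have r2: "2 \<le> r" "2 * card (M z) + 2 \<le> r" using z(3) by (auto simp: r_def)
  have rs1: "r \<le> s - 1" unfolding r_def using z by (intro po[of j]) auto
  \<comment> \<open>Linked paths need \<open>s + 1\<close> vertices together, so the path on
    \<open>r\<close> vertices at \<open>z\<close> calls for one on \<open>t\<close> vertices in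
    \<open>VV 0\<close>.\<close>
  define t where "t = s + 1 - r"
  have t: "2 \<le> t" "t + r = s + 1" using rs1 s2 r2 by (auto simp: t_def)
  define W where "W = nbh (VV 0) E z"
  define y where "y = ys ! 1"
  have yV: "y \<in> VV j" using ys r2 by (auto simp: y_def gpath_def)
  have WV: "W \<subseteq> VV 0" "finite W" using finVV[of 0] by (auto simp: W_def nbh_def)
  \<comment> \<open>Twins in \<open>T j\<close> are isolated within \<open>VV j\<close>; all edges
    there lie among its few remaining vertices.\<close>
  have smalldeg: "p * (\<Sum>j\<in>{1..<p}. degsum (VV j) E) \<le> (p - 1) * ((s - 1) * (\<delta> + p))"
  proof -
    have "p * degsum (VV j) E \<le> (s - 1) * (\<delta> + p)" if j: "j \<in> {1..<p}" for j
    proof -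
      have "degsum (VV j) E = degsum (T j) E + degsum (VV j - T j) E"
        using TV[OF j] j sym by (intro degsum_split finVV) (auto simp: VV_def)
      moreover have "degsum (T j) E = 0"
      proof -
        have "nbh (T j) E v = {}" if "v \<in> T j" for v using TV[OF j] that j by (auto simp: VV_def nbh_def)
        then show ?thesis by (simp add: degsum_def)
      qed
      moreover have "degsum (VV j - T j) E \<le> (\<Sum>v\<in>VV j - T j. path_order (VV j - T j) E v - 1)"
        using finVV by (intro degsum_le_path_order V) auto
      moreover have "\<dots> \<le> card (VV j - T j) * (s - 1)"
        using sum_bounded_above[of "VV j - T j" "\<lambda>v. path_order (VV j - T j) E v - 1" "s - 1"]
          po[of j "VV j - T j"] j by fastforce
      ultimately have "p * degsum (VV j) E \<le> p * (card (VV j - T j) * (s - 1))" by (intro mult_le_mono2) linarith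
      also have "\<dots> = (p * card (VV j - T j)) * (s - 1)" by simp
      also have "\<dots> \<le> (\<delta> + p) * (s - 1)"
        using MTb[OF j] Tne[OF j] TV[OF j] by (intro mult_le_mono1) blast
      finally show ?thesis by (simp add: mult.commute)
    qed
    then have "(\<Sum>j\<in>{1..<p}. p * degsum (VV j) E) \<le> card {1..<p} * ((s - 1) * (\<delta> + p))"
      using sum_bounded_above[of "{1..<p}" "\<lambda>j. p * degsum (VV j) E" "(s - 1) * (\<delta> + p)"] by simp
    then show ?thesis by (simp add: sum_distrib_left)
  qed
  \<comment> \<open>Otherwise the Erdos-Gallai bound gives \<open>W\<close> a degree sum of at most
    about \<open>a * (t - 2)\<close>, and putting back \<open>M z\<close> adds at most
    \<open>a * (r - 2)\<close>. Together this is about \<open>a * (s - 3)\<close>, whereas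
    \<open>keyB\<close> and the disjoint cliques of \<open>exn_path_ge\<close> demand nearly
    \<open>a * (s - 2)\<close>.\<close>
  have "\<exists>v\<in>W. v \<notin> M y \<and> t \<le> path_order W E v"
  proof (rule ccontr)
    assume neg: "\<not> ?thesis"
    have "degsum W E \<le> (\<Sum>v\<in>W. path_order W E v - 1)" by (rule degsum_le_path_order[OF WV(2) V(2)])
    also have "\<dots> \<le> (\<Sum>v\<in>W. (t - 2) + (if v \<in> M y then s - 2 else 0))"
    proof (rule sum_mono)
      fix v assume v: "v \<in> W"
      show "path_order W E v - 1 \<le> (t - 2) + (if v \<in> M y then s - 2 else 0)"
      proof (cases "v \<in> M y")
        case True
        then show ?thesis using po[OF _ WV(1) v] p by simp
      next
        case False
        then have "path_order W E v < t" using neg v by auto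
        then show ?thesis by simp
      qed
    qed
    also have "\<dots> = card W * (t - 2) + card (W \<inter> M y) * (s - 2)"
      using WV(2) by (simp add: sum.distrib sum.If_cases)
    also have "\<dots> \<le> a * (t - 2) + card (M y) * (s - 2)"
    proof -
      have "card W \<le> a" unfolding a_def by (rule card_mono[OF finVV WV(1)])
      moreover have "card (W \<inter> M y) \<le> card (M y)" using finVV[of 0] by (intro card_mono) (auto simp: M_def)
      ultimately show ?thesis by (intro add_mono mult_le_mono1)
    qed
    finally have 1: "degsum W E \<le> a * (t - 2) + card (M y) * (s - 2)" .
    have "VV 0 - M z = W" using WV(1) by (auto simp: M_def W_def)
    moreover have "degsum (VV 0) E \<le> degsum (VV 0 - M z) E + 2 * card (M z) * card (VV 0)"
      by (rule degsum_diff_le[OF finVV _ V(2)]) (simp add: M_def)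
    ultimately have 2: "degsum (VV 0) E \<le> degsum W E + a * (2 * card (M z))" by (simp add: a_def mult.commute)
    have "a * (2 * card (M z)) \<le> a * (r - 2)" using r2 by (intro mult_le_mono2) simp
    moreover have "a * (t - 2) + a * (r - 2) + a = a * (s - 2)"
    proof -
      have "(t - 2) + (r - 2) + 1 = s - 2" using t r2 by simp
      then show ?thesis by (metis distrib_left mult.right_neutral)
    qed
    moreover have "(s - 2) * a \<le> 2 * exn 1 s a + (s - 2) * (s - 2)" by (rule exn_path_ge[OF s2])
    ultimately have "a \<le> card (M y) * (s - 2) + (\<Sum>j\<in>{1..<p}. degsum (VV j) E) + (s - 2) * (s - 2)"
      using 1 2 keyB mult.commute[of a "s - 2"] by linarith
    then have "p * a \<le> p * (card (M y) * (s - 2) + (\<Sum>j\<in>{1..<p}. degsum (VV j) E) + (s - 2) * (s - 2))"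
      by (rule mult_le_mono2)
    also have "\<dots> = p * card (M y) * (s - 2) + p * (\<Sum>j\<in>{1..<p}. degsum (VV j) E) + p * ((s - 2) * (s - 2))"
      by (simp add: distrib_left)
    also have "\<dots> \<le> (\<delta> + p) * s + (p - 1) * (s * (\<delta> + p)) + p * (s * s)"
    proof -
      have "p * card (M y) * (s - 2) \<le> (\<delta> + p) * s" using MTb[OF z(1) yV] by (intro mult_le_mono) auto
      moreover have "(p - 1) * ((s - 1) * (\<delta> + p)) \<le> (p - 1) * (s * (\<delta> + p))" by (intro mult_le_mono) auto
      moreover have "p * ((s - 2) * (s - 2)) \<le> p * (s * s)" by (intro mult_le_mono) auto
      ultimately show ?thesis using smalldeg by linarith
    qed
    also have "\<dots> = p * s * (\<delta> + p) + p * s * s"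
    proof -
      obtain p' where "p = Suc p'" using p not0_implies_Suc by fastforce
      then show ?thesis by (simp add: algebra_simps)
    qed
    finally show False using alb big unfolding m_def by linarith
  qed
  then obtain v where v: "v \<in> W" "v \<notin> M y" "t \<le> path_order W E v" by blast
  obtain xs0 where xs0: "gpath W E xs0" "xs0 \<noteq> []" "hd xs0 = v" "length xs0 = path_order W E v"
    using path_order_attained[OF WV(2) v(1)] by metis
  define xs where "xs = take t xs0"
  have xs: "gpath W E xs" "length xs = t" "xs ! 0 = v"
    using gpath_take[OF xs0(1)] xs0 v(3) t by (auto simp: xs_def hd_conv_nth)
  have x1: "xs ! 1 \<in> W" using xs t by (auto simp: gpath_def)
  have y0: "ys ! 0 = z" using ys by (simp add: hd_conv_nth)
  have "has_power p k (\<Union>i<p. VV i) E"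
  proof (rule richsys_link_has_power[OF V(2) rs p _ _ _ b k, of 0 j xs ys])
    show "gpath (VV 0) E xs" using gpath_mono[OF xs(1) WV(1)] .
    show "E (xs ! 0) (ys ! 0)" "E (xs ! 1) (ys ! 0)" unfolding xs(3) y0 using v(1) x1 sym by (auto simp: W_def nbh_def)
    \<comment> \<open>The third link edge joins \<open>v\<close> to the second vertex
      \<open>y\<close> of \<open>ys\<close>; the other two come from \<open>W\<close> consisting of
      neighbours of \<open>z\<close>.\<close>
    have "v \<in> nbh (VV 0) E y" using v(1,2) WV(1) by (auto simp: M_def)
    then show "E (xs ! 0) (ys ! 1)" unfolding xs(3) using sym by (auto simp: y_def nbh_def)
  qed (use z p ys t r2 xs s in auto)
  then show False using V(3) unfolding cover by blast
qed

subsection \<open>Symmetrisation\<close>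

text \<open>The number \<open>2 * k\<close> is chosen because a copy of the power occupies at most
  \<open>k\<close> common neighbours, and at most \<open>k\<close> further ones are needed to
  replace the clones in it.\<close>

definition rich :: "nat \<Rightarrow> 'a set \<Rightarrow> ('a \<Rightarrow> 'a \<Rightarrow> bool) \<Rightarrow> 'a \<Rightarrow> bool" where
  "rich k V E y \<longleftrightarrow> (\<forall>Q\<subseteq>nbh V E y. card Q \<le> k \<longrightarrow> 2 * k \<le> card {x \<in> V. \<forall>q\<in>Q. E q x})"

text \<open>Zykov symmetrisation of a whole set at once.\<close>

definition clone :: "('a \<Rightarrow> 'a \<Rightarrow> bool) \<Rightarrow> 'a set \<Rightarrow> 'a \<Rightarrow> 'a \<Rightarrow> 'a \<Rightarrow> bool" where
  "clone E U y u v \<longleftrightarrow> (if u \<in> U then v \<notin> U \<and> E y v else if v \<in> U then E y u else E u v)"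

definition twins :: "'a set \<Rightarrow> ('a \<Rightarrow> 'a \<Rightarrow> bool) \<Rightarrow> 'a set \<Rightarrow> bool" where
  "twins V E A \<longleftrightarrow> (\<forall>x\<in>A. \<forall>y\<in>A. nbh V E x = nbh V E y)"

lemma graph_rel_clone: "graph_rel E \<Longrightarrow> graph_rel (clone E U y)"
  by (auto simp: graph_rel_def clone_def)

text \<open>In a copy of \<open>P\<^sub>k\<^sup>p\<close> the clones can be replaced by other common neighbours of the vertices
  that they are joined to.\<close>

lemma clone_no_power:
  assumes V: "finite V" "graph_rel E" "U \<subseteq> V" "y \<in> V" and rich: "rich k V E y"
    and no: "\<not> has_power p k V E"
  shows "\<not> has_power p k V (clone E U y)"
proof
  assume "has_power p k V (clone E U y)"
  then obtain \<phi> where \<phi>: "inj_on \<phi> {..<k}" "\<phi> ` {..<k} \<subseteq> V"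
    "\<And>i j. i < j \<Longrightarrow> j < k \<Longrightarrow> j \<le> i + p \<Longrightarrow> clone E U y (\<phi> i) (\<phi> j)" by (auto simp: has_power_def)
  define I where "I = {i. i < k \<and> \<phi> i \<in> U}"
  define Q where "Q = \<phi> ` {i. i < k \<and> E y (\<phi> i)}"
  \<comment> \<open>Replacements have to avoid the copy itself. As clones are pairwise non-adjacent,
    only their edges to the vertices in \<open>Q\<close> must be preserved.\<close>
  define C where "C = {x \<in> V. \<forall>q\<in>Q. E q x} - \<phi> ` {..<k}"
  have fin: "finite C" "finite I" using V by (auto simp: C_def I_def)
  have "card Q \<le> card {i. i < k \<and> E y (\<phi> i)}" unfolding Q_def by (rule card_image_le) simp
  also have "\<dots> \<le> card {..<k}" by (rule card_mono) auto
  finally have "card Q \<le> k" by simp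
  moreover have "Q \<subseteq> nbh V E y" using \<phi>(2) by (auto simp: Q_def nbh_def)
  ultimately have "2 * k \<le> card {x \<in> V. \<forall>q\<in>Q. E q x}" using rich by (auto simp: rich_def)
  moreover have "card {x \<in> V. \<forall>q\<in>Q. E q x} - card (\<phi> ` {..<k}) \<le> card C"
    unfolding C_def by (rule diff_card_le_card_Diff) simp
  moreover have "card (\<phi> ` {..<k}) = k" using \<phi>(1) by (simp add: card_image)
  moreover have "card I \<le> card {..<k}" by (rule card_mono) (auto simp: I_def)
  ultimately have "card I \<le> card C" by simp
  then obtain g where g: "g ` I \<subseteq> C" "inj_on g I" using card_le_inj[OF fin(2,1)] by auto
  define \<psi> where "\<psi> i = (if i \<in> I then g i else \<phi> i)" for i
  have gC: "g i \<in> C" if "i \<in> I" for i using g that by auto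
  have "inj_on \<psi> {..<k}"
  proof (rule inj_onI)
    fix i j assume ij: "i \<in> {..<k}" "j \<in> {..<k}" "\<psi> i = \<psi> j"
    consider "i \<in> I" "j \<in> I" | "i \<in> I" "j \<notin> I" | "i \<notin> I" "j \<in> I" | "i \<notin> I" "j \<notin> I" by blast
    then show "i = j"
    proof cases
      case 1 then show ?thesis using ij g(2) by (auto simp: \<psi>_def inj_on_def)
    next
      case 2 then show ?thesis using ij gC[of i] by (auto simp: \<psi>_def C_def)
    next
      case 3
      then have "\<phi> i = g j" using ij by (simp add: \<psi>_def)
      then show ?thesis using ij gC[of j] 3 by (force simp: C_def)
    next
      case 4 then show ?thesis using ij \<phi>(1) by (auto simp: \<psi>_def inj_on_def)
    qed
  qed
  moreover have "\<psi> ` {..<k} \<subseteq> V" using \<phi>(2) gC by (auto simp: \<psi>_def C_def)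
  moreover have "E (\<psi> i) (\<psi> j)" if ij: "i < j" "j < k" "j \<le> i + p" for i j
  proof -
    have c: "clone E U y (\<phi> i) (\<phi> j)" using \<phi>(3) ij .
    consider "i \<in> I" "j \<in> I" | "i \<in> I" "j \<notin> I" | "i \<notin> I" "j \<in> I" | "i \<notin> I" "j \<notin> I" by blast
    then show ?thesis
    proof cases
      case 1 then show ?thesis using c by (auto simp: clone_def I_def)
    next
      case 2
      then have "E y (\<phi> j)" using c by (auto simp: clone_def I_def)
      then have "\<phi> j \<in> Q" using ij by (auto simp: Q_def)
      then have "E (\<phi> j) (g i)" using gC[of i] 2 by (auto simp: C_def)
      then show ?thesis using 2 graph_relD(1)[OF V(2)] by (simp add: \<psi>_def)
    next
      case 3
      then have "E y (\<phi> i)" using c ij by (auto simp: clone_def I_def)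
      then have "\<phi> i \<in> Q" using ij by (auto simp: Q_def)
      then have "E (\<phi> i) (g j)" using gC[of j] 3 by (auto simp: C_def)
      then show ?thesis using 3 by (simp add: \<psi>_def)
    next
      case 4 then show ?thesis using c ij by (auto simp: \<psi>_def clone_def I_def)
    qed
  qed
  ultimately have "has_power p k V E" unfolding has_power_def by (intro exI[of _ \<psi>]) blast
  then show False using no by blast
qed

text \<open>Each clone sends \<open>card (nbh V E y)\<close> edges to the rest, at least the former
  degree of the vertex; former edges inside \<open>U\<close> were even counted at both ends in those
  degrees.\<close>

lemma degsum_clone_ge:
  assumes V: "finite V" "graph_rel E" "U \<subseteq> V" "U \<inter> nbh V E y = {}"
    and deg: "\<And>u. u \<in> U \<Longrightarrow> card (nbh V E u) \<le> card (nbh V E y)"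
  shows "degsum V E \<le> degsum V (clone E U y)"
proof -
  let ?W = "V - U" and ?E = "clone E U y"
  have fin: "finite ?W" "finite U" "?W \<inter> U = {}" "?W \<union> U = V" using V finite_subset by auto
  have "degsum U E + (\<Sum>v\<in>U. card (nbh ?W E v)) = (\<Sum>v\<in>U. card (nbh V E v))"
    unfolding degsum_def sum.distrib[symmetric]
    using card_nbh_Un[OF fin(1,2,3)] fin(4) by (intro sum.cong refl) simp
  also have "\<dots> \<le> (\<Sum>v\<in>U. card (nbh V E y))" by (rule sum_mono[OF deg])
  finally have 1: "degsum U E + 2 * (\<Sum>v\<in>U. card (nbh ?W E v)) \<le> 2 * (\<Sum>v\<in>U. card (nbh V E y))" by simp
  have "degsum V E = degsum ?W E + degsum U E + 2 * (\<Sum>v\<in>U. card (nbh ?W E v))"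
    using degsum_Un[OF fin(1,2,3) V(2)] fin(4) by simp
  moreover have "degsum V ?E = degsum ?W ?E + degsum U ?E + 2 * (\<Sum>v\<in>U. card (nbh ?W ?E v))"
    using degsum_Un[OF fin(1,2,3) graph_rel_clone[OF V(2)]] fin(4) by simp
  moreover have "degsum ?W ?E = degsum ?W E" by (rule degsum_cong) (simp add: clone_def)
  moreover have "(\<Sum>v\<in>U. card (nbh ?W ?E v)) = (\<Sum>v\<in>U. card (nbh V E y))"
  proof (intro sum.cong refl arg_cong[of _ _ card])
    fix v assume "v \<in> U"
    then show "nbh ?W ?E v = nbh V E y" using V(4) by (auto simp: nbh_def clone_def)
  qed
  ultimately show ?thesis using 1 by linarith
qed

text \<open>The recursion reflects one step of the search for a rich vertex: fewer than
  \<open>2 * k\<close> candidates are common neighbours, and the others are distributed over at most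
  \<open>k\<close> sets, one of which retains \<open>rich_bound k c\<close> candidates.\<close>

fun rich_bound :: "nat \<Rightarrow> nat \<Rightarrow> nat" where
  "rich_bound k 0 = 2 * k + 1"
| "rich_bound k (Suc c) = k * rich_bound k c + 2 * k + 1"

text \<open>If \<open>y\<close> is not rich, a bounded set \<open>Q\<close> of neighbours of \<open>y\<close> has few common neighbours; so
  one of them is missed by a positive proportion of \<open>C\<close>. Restricting to these vertices increases
  the number of commonly missed vertices, which is bounded.\<close>

lemma exists_rich:
  assumes V: "finite V" "graph_rel E" and k: "1 \<le> k" and C: "C \<subseteq> V" "rich_bound k c \<le> card C"
    and nb: "\<And>y. y \<in> C \<Longrightarrow> nbh V E y \<subseteq> Z \<union> W"
    and Z: "\<And>x y y'. x \<in> Z \<Longrightarrow> y \<in> C \<Longrightarrow> y' \<in> C \<Longrightarrow> E y x \<Longrightarrow> E y' x"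
    and miss: "finite W" "\<And>y. y \<in> C \<Longrightarrow> card (W - nbh V E y) \<le> c"
  shows "\<exists>y\<in>C. rich k V E y"
  using C nb Z miss
proof (induction c arbitrary: C W)
  case (0 C W)
  then have "C \<noteq> {}" by auto
  then obtain y where y: "y \<in> C" by auto
  have "rich k V E y" unfolding rich_def
  proof (intro allI impI)
    fix Q assume Q: "Q \<subseteq> nbh V E y" "card Q \<le> k"
    have "E q x" if "q \<in> Q" "x \<in> C" for q x
    proof -
      have yq: "E y q" "q \<in> Z \<union> W" using Q 0(3)[OF y] that by (auto simp: nbh_def)
      have "E x q"
      proof (cases "q \<in> Z")
        case True then show ?thesis using 0(4)[OF True y that(2)] yq by simp
      next
        case False
        then have "q \<in> W" using yq by simp
        moreover have "W - nbh V E x = {}" using 0(5) 0(6)[OF that(2)] by simp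
        ultimately show ?thesis by (auto simp: nbh_def)
      qed
      then show ?thesis using graph_relD(1)[OF V(2)] by blast
    qed
    then have "C \<subseteq> {x \<in> V. \<forall>q\<in>Q. E q x}" using 0(1) by auto
    then have "card C \<le> card {x \<in> V. \<forall>q\<in>Q. E q x}" using V by (intro card_mono) auto
    then show "2 * k \<le> card {x \<in> V. \<forall>q\<in>Q. E q x}" using 0(2) by simp
  qed
  then show ?case using y by blast
next
  case (Suc c C W)
  have finC: "finite C" using Suc(2) V finite_subset by blast
  show ?case
  proof (cases "\<exists>y\<in>C. rich k V E y")
    case False
    have "C \<noteq> {}" using Suc(3) by auto
    then obtain y where y: "y \<in> C" by auto
    then have "\<not> rich k V E y" using False by blast
    then obtain Q where Q: "Q \<subseteq> nbh V E y" "card Q \<le> k" "card {x \<in> V. \<forall>q\<in>Q. E q x} < 2 * k"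
      unfolding rich_def by (auto simp: not_le)
    have finQ: "finite Q" by (rule finite_subset[OF Q(1) finite_nbh[OF V(1)]])
    define D where "D = {x \<in> C. \<exists>q\<in>Q. \<not> E q x}"
    define M where "M q = {x \<in> C. \<not> E x q}" for q
    have "C \<subseteq> D \<union> {x \<in> V. \<forall>q\<in>Q. E q x}" using Suc(2) by (auto simp: D_def)
    then have "card C \<le> card (D \<union> {x \<in> V. \<forall>q\<in>Q. E q x})" using V finC by (intro card_mono) (auto simp: D_def)
    also have "\<dots> \<le> card D + card {x \<in> V. \<forall>q\<in>Q. E q x}" by (rule card_Un_le)
    finally have "k * rich_bound k c < card D" using Suc(3) Q(3) by simp
    also have "card D \<le> card (\<Union>q\<in>Q. M q)" using finC finQ graph_relD(1)[OF V(2)]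
      by (intro card_mono) (auto simp: D_def M_def)
    also have "\<dots> \<le> (\<Sum>q\<in>Q. card (M q))" by (rule card_UN_le[OF finQ])
    finally have big: "k * rich_bound k c < (\<Sum>q\<in>Q. card (M q))" .
    have "\<exists>q\<in>Q. rich_bound k c \<le> card (M q)"
    proof (rule ccontr)
      assume "\<not> ?thesis"
      then have "(\<Sum>q\<in>Q. card (M q)) \<le> card Q * rich_bound k c"
        using sum_bounded_above[of Q "\<lambda>q. card (M q)" "rich_bound k c"] by force
      also have "\<dots> \<le> k * rich_bound k c" using Q(2) by simp
      finally show False using big by simp
    qed
    then obtain q where q: "q \<in> Q" "rich_bound k c \<le> card (M q)" by blast
    have "M q \<noteq> {}" using q(2) by (cases c) auto
    then obtain x0 where x0: "x0 \<in> C" "\<not> E x0 q" by (auto simp: M_def)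
    have "E y q" "q \<in> Z \<union> W" using q Q(1) Suc(4)[OF y] by (auto simp: nbh_def)
    \<comment> \<open>All of \<open>C\<close> agrees on \<open>Z\<close>, while \<open>y\<close> is
      adjacent to \<open>q\<close> and \<open>x0\<close> is not; so \<open>q\<close> lies in
      \<open>W\<close> and can be charged to the missed vertices.\<close>
    then have qW: "q \<in> W" using Suc(5)[OF _ y x0(1)] x0 by blast
    have "\<exists>y\<in>M q. rich k V E y"
    proof (rule Suc.IH[of "M q" "W - {q}"])
      show "M q \<subseteq> V" "rich_bound k c \<le> card (M q)" using Suc(2) q by (auto simp: M_def)
      show "nbh V E x \<subseteq> Z \<union> (W - {q})" if "x \<in> M q" for x
        using Suc(4)[of x] that by (auto simp: M_def nbh_def)
      show "E y' x" if "x \<in> Z" "y \<in> M q" "y' \<in> M q" "E y x" for x y y'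
        using Suc(5)[of x y y'] that by (auto simp: M_def)
      show "finite (W - {q})" using Suc(6) by simp
      fix x assume x: "x \<in> M q"
      have "W - nbh V E x = insert q (W - {q} - nbh V E x)" using x qW by (auto simp: M_def nbh_def)
      then have "card (W - nbh V E x) = Suc (card (W - {q} - nbh V E x))" using Suc(6) by simp
      then show "card (W - {q} - nbh V E x) \<le> c" using Suc(7)[of x] x by (simp add: M_def)
    qed
    then show ?thesis by (auto simp: M_def)
  qed simp
qed

text \<open>Induction on the number of hubs, the vertices of \<open>Hb\<close>. A hub with fewer
  than \<open>s + 2 ^ s * B\<close> neighbours in \<open>Y\<close> is discarded together with these
  neighbours. If there is none, take a longest path starting in \<open>Y\<close>; its second vertex
  is a hub, and each neighbour of that hub in \<open>Y\<close> off the path sees only hubs on the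
  path. So at most \<open>2 ^ s\<close> neighbourhoods occur there, and the pigeonhole principle
  applies.\<close>

lemma exists_same_nbh:
  assumes E: "graph_rel E" and s: "\<And>xs. gpath (Y \<union> Hb) E xs \<Longrightarrow> length xs < s"
    and fin: "finite Y" "finite Hb" "Y \<inter> Hb = {}" and ind: "\<And>x y. x \<in> Y \<Longrightarrow> y \<in> Y \<Longrightarrow> \<not> E x y"
    and big: "(s + 2 ^ s * B) * card Hb + (s + 2 ^ s * B) \<le> card Y"
  shows "\<exists>C\<subseteq>Y. B \<le> card C \<and> (\<forall>y\<in>C. card (nbh Hb E y) \<le> s) \<and> (\<forall>x\<in>C. \<forall>y\<in>C. nbh Hb E x = nbh Hb E y)"
  using s fin ind big
proof (induction "card Hb" arbitrary: Hb Y)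
  case 0
  then have "Hb = {}" by simp
  moreover have "1 * B \<le> 2 ^ s * B" by (rule mult_le_mono1) simp
  then have "B \<le> card Y" using 0(7) by linarith
  ultimately show ?case by (intro exI[of _ Y]) (simp add: nbh_def)
next
  case (Suc n Hb Y)
  define D where "D = s + 2 ^ s * B"
  note path = Suc(3) and fin = Suc(4-6) and ind = Suc(7) and big = Suc(8)
  show ?case
  proof (cases "\<exists>h\<in>Hb. card (nbh Y E h) < D")
    case True
    then obtain h where h: "h \<in> Hb" "card (nbh Y E h) < D" by blast
    let ?Y = "Y - nbh Y E h" and ?H = "Hb - {h}"
    have cH: "n = card ?H" using Suc(2) h fin by simp
    have "D * card Hb + D \<le> card Y" using big by (simp add: D_def)
    moreover have "card Hb = Suc n" using Suc(2) by simp
    moreover have "card Y - card (nbh Y E h) \<le> card ?Y" by (rule diff_card_le_card_Diff) (use fin in simp)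
    ultimately have "D * card ?H + D \<le> card ?Y" using h(2) cH by simp
    then have "\<exists>C\<subseteq>?Y. B \<le> card C \<and> (\<forall>y\<in>C. card (nbh ?H E y) \<le> s) \<and> (\<forall>x\<in>C. \<forall>y\<in>C. nbh ?H E x = nbh ?H E y)"
    proof (intro Suc(1)[OF cH])
      show "length xs < s" if "gpath (?Y \<union> ?H) E xs" for xs
        by (rule path, rule gpath_mono[OF that]) auto
    qed (use fin ind in \<open>auto simp: D_def\<close>)
    then obtain C where C: "C \<subseteq> ?Y" "B \<le> card C" "\<forall>y\<in>C. card (nbh ?H E y) \<le> s" "\<forall>x\<in>C. \<forall>y\<in>C. nbh ?H E x = nbh ?H E y" by blast
    have "nbh Hb E y = nbh ?H E y" if "y \<in> C" for y
      using C(1) that graph_relD(1)[OF E, of y h] by (auto simp: nbh_def)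
    then have "\<forall>y\<in>C. card (nbh Hb E y) \<le> s" "\<forall>x\<in>C. \<forall>y\<in>C. nbh Hb E x = nbh Hb E y"
      using C(3,4) by metis+
    moreover have "C \<subseteq> Y" using C(1) by blast
    ultimately show ?thesis using C(2) by blast
  next
    case False
    then have hub: "D \<le> card (nbh Y E h)" if "h \<in> Hb" for h using that by force
    have D1: "s \<le> D" by (simp add: D_def)
    have s0: "0 < s" using path[of "[]"] by (simp add: gpath_def)
    obtain h0 where h0: "h0 \<in> Hb" using Suc(2) by fastforce
    define L where "L = {xs. gpath (Y \<union> Hb) E xs \<and> xs \<noteq> [] \<and> hd xs \<in> Y \<and> 2 \<le> length xs}"
    have finL: "finite (length ` L)" by (rule finite_subset[of _ "{..<s}"]) (use path in \<open>auto simp: L_def\<close>)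
    have "nbh Y E h0 \<noteq> {}" using hub[OF h0] D1 s0 by auto
    then obtain y0 where y0: "y0 \<in> Y" "E h0 y0" by (auto simp: nbh_def)
    have "[y0, h0] \<in> L" using y0 h0 graph_relD[OF E] fin by (auto simp: L_def gpath_def)
    then have "Max (length ` L) \<in> length ` L" using finL by (intro Max_in) auto
    then obtain xs where xs: "xs \<in> L" "length xs = Max (length ` L)" by auto
    have max: "length zs \<le> length xs" if "zs \<in> L" for zs using that xs(2) finL by simp
    obtain y h rest where yh: "xs = y # h # rest" using xs(1)
      by (cases xs; cases "tl xs") (auto simp: L_def)
    have gp: "gpath (Y \<union> Hb) E xs" "y \<in> Y" using xs(1) yh by (auto simp: L_def)
    have hE: "E y h" "h \<in> Y \<union> Hb" using gp yh by (auto simp: gpath_def)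
    then have hH: "h \<in> Hb" using ind gp(2) by auto
    have onpath: "nbh Hb E y' \<subseteq> set (h # rest)" if zs: "gpath (Y \<union> Hb) E (y' # h # rest)" "y' \<in> Y" for y'
    proof
      fix h' assume h': "h' \<in> nbh Hb E y'"
      then have h'H: "h' \<in> Hb" "E y' h'" by (auto simp: nbh_def)
      show "h' \<in> set (h # rest)"
      proof (rule ccontr)
        assume notin: "h' \<notin> set (h # rest)"
        have "h' \<noteq> y'" using h'H zs(2) fin(3) by auto
        then have g1: "gpath (Y \<union> Hb) E (h' # y' # h # rest)"
          using zs notin h'H graph_relD(1)[OF E] by (auto simp: gpath_def)
        then have "length (h' # y' # h # rest) < s" by (rule path)
        then have "card (set (h' # y' # h # rest)) < card (nbh Y E h')"
          using hub[OF h'H(1)] D1 card_length[of "h' # y' # h # rest"] by linarith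
        then have "\<not> nbh Y E h' \<subseteq> set (h' # y' # h # rest)" by (meson List.finite_set card_mono not_le)
        then obtain z where z: "z \<in> nbh Y E h'" "z \<notin> set (h' # y' # h # rest)" by blast
        then have "z # h' # y' # h # rest \<in> L" using g1 graph_relD(1)[OF E]
          by (auto simp: L_def gpath_def nbh_def)
        then show False using max yh by fastforce
      qed
    qed
    define C1 where "C1 = nbh Y E h - set xs"
    define Hx where "Hx = Hb \<inter> set xs"
    have ls: "length xs < s" by (rule path[OF gp(1)])
    have inC1: "nbh Hb E y' \<in> Pow Hx" if "y' \<in> C1" for y'
    proof -
      have "y' \<in> Y" "E h y'" "y' \<notin> set xs" using that by (auto simp: C1_def nbh_def)
      then have "gpath (Y \<union> Hb) E (y' # h # rest)" using gp yh graph_relD(1)[OF E] by (auto simp: gpath_def)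
      then have "nbh Hb E y' \<subseteq> set (h # rest)" using onpath \<open>y' \<in> Y\<close> by blast
      then show ?thesis using yh by (auto simp: Hx_def nbh_def)
    qed
    have cHx: "card Hx \<le> s"
    proof -
      have "card Hx \<le> card (set xs)" unfolding Hx_def by (intro card_mono) auto
      then show ?thesis using card_length[of xs] ls by linarith
    qed
    have "card (nbh Y E h) - card (set xs) \<le> card C1" unfolding C1_def by (rule diff_card_le_card_Diff) simp
    then have cC1: "2 ^ s * B \<le> card C1" using hub[OF hH] card_length[of xs] ls by (simp add: D_def)
    have finC1: "finite C1" using fin by (simp add: C1_def)
    have "\<exists>Z\<in>Pow Hx. card C1 \<le> card ((\<lambda>y'. nbh Hb E y') -` {Z} \<inter> C1) * card (Pow Hx)"
      using pigeonhole_card[of "\<lambda>y'. nbh Hb E y'" C1 "Pow Hx"] inC1 finC1 by (auto simp: Hx_def)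
    then obtain Z where Z: "Z \<in> Pow Hx" "card C1 \<le> card ((\<lambda>y'. nbh Hb E y') -` {Z} \<inter> C1) * card (Pow Hx)" by blast
    define C where "C = (\<lambda>y'. nbh Hb E y') -` {Z} \<inter> C1"
    have "card (Pow Hx) = 2 ^ card Hx" by (rule card_Pow) (simp add: Hx_def)
    also have "\<dots> \<le> 2 ^ s" by (rule power_increasing[OF cHx]) simp
    finally have "card (Pow Hx) \<le> 2 ^ s" .
    then have "card C * card (Pow Hx) \<le> card C * 2 ^ s" by (rule mult_le_mono2)
    then have "2 ^ s * B \<le> card C * 2 ^ s" using Z(2) cC1 unfolding C_def[symmetric] by linarith
    then have "2 ^ s * B \<le> 2 ^ s * card C" by (simp only: mult.commute)
    then have "B \<le> card C" by simp
    moreover have "C \<subseteq> Y" by (auto simp: C_def C1_def nbh_def)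
    moreover have "card (nbh Hb E y) \<le> s" if "y \<in> C" for y
    proof -
      have "nbh Hb E y \<subseteq> Hx" using that inC1 by (auto simp: C_def)
      then have "card (nbh Hb E y) \<le> card Hx" by (intro card_mono) (auto simp: Hx_def)
      then show ?thesis using cHx by simp
    qed
    ultimately show ?thesis by (intro exI[of _ C]) (auto simp: C_def)
  qed
qed

text \<open>Used with degrees: if the vertex to be cloned is taken from the top vertices, turning
  the others into clones loses no edges.\<close>

lemma exists_top_subset:
  fixes f :: "'a \<Rightarrow> nat"
  assumes "finite A" "n \<le> card A"
  shows "\<exists>Y\<subseteq>A. card Y = n \<and> (\<forall>y\<in>Y. \<forall>u\<in>A - Y. f u \<le> f y)"
  using assms(2)
proof (induction n)
  case 0 then show ?case by (intro exI[of _ "{}"]) auto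
next
  case (Suc n)
  then obtain Y where Y: "Y \<subseteq> A" "card Y = n" "\<forall>y\<in>Y. \<forall>u\<in>A - Y. f u \<le> f y" by auto
  have "A - Y \<noteq> {}" using Y Suc(2) card_mono[of Y A] assms(1) finite_subset[OF Y(1)] by auto
  then have "Max (f ` (A - Y)) \<in> f ` (A - Y)" using assms(1) by (intro Max_in) auto
  then obtain y where y: "y \<in> A - Y" "f y = Max (f ` (A - Y))" by auto
  have "f u \<le> f y" if "u \<in> A - Y" for u unfolding y(2) using assms(1) that by (intro Max_ge) auto
  then have "\<forall>z\<in>insert y Y. \<forall>u\<in>A - insert y Y. f u \<le> f z" using Y(3) by auto
  moreover have "card (insert y Y) = Suc n" using Y y finite_subset[OF Y(1) assms(1)] by simp
  ultimately show ?case using Y(1) y by (intro exI[of _ "insert y Y"]) auto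
qed

text \<open>A bounded multiple of \<open>card (U - Y) + 1\<close> vertices of largest degree in
  \<open>Y\<close> is set aside. Many of them have the same neighbours in \<open>U - Y\<close>, and
  outside \<open>U\<close> they miss boundedly many vertices, so one of them is a rich vertex
  \<open>y\<close>. The rest of \<open>Y\<close> becomes clones of \<open>y\<close>: the degrees
  ensure that no edge is lost and richness that no power arises. Twins disjoint from
  \<open>U\<close> stay twins, since their adjacency to the clones is decided by their common
  adjacency to \<open>y\<close>.\<close>

lemma symmetrise_class:
  fixes V :: "nat set"
  assumes ex: "extremal p k V E" and k: "1 \<le> k" and UV: "U \<subseteq> V" "Y \<subseteq> U"
    and md: "\<And>v. v \<in> V \<Longrightarrow> (p - 1) * (card V - 1) \<le> p * card (nbh V E v)" and p: "1 \<le> p"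
    and size: "card V \<le> p * card U + c"
    and path: "\<And>xs. gpath U E xs \<Longrightarrow> length xs < s" and ind: "\<And>x y. x \<in> Y \<Longrightarrow> y \<in> Y \<Longrightarrow> \<not> E x y"
    and D: "D = s + 2 ^ s * rich_bound k (c + s + 1)"
  shows "\<exists>E' T. extremal p k V E' \<and> T \<subseteq> Y \<and> card Y \<le> card T + (D * card (U - Y) + D) \<and> twins V E' T \<and>
    (\<forall>u v. u \<notin> U \<longrightarrow> v \<notin> U \<longrightarrow> E' u v = E u v) \<and> (\<forall>A. A \<inter> U = {} \<longrightarrow> twins V E A \<longrightarrow> twins V E' A)"
proof (cases "D * card (U - Y) + D \<le> card Y")
  case False
  then have "card Y \<le> card ({} :: nat set) + (D * card (U - Y) + D)" by simp
  moreover have "twins V E {}" by (simp add: twins_def)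
  ultimately show ?thesis using ex by blast
next
  case True
  have V: "finite V" "graph_rel E" "\<not> has_power p k V E" "degsum V E = 2 * exn p k (card V)"
    using ex by (auto simp: extremal_def)
  have finU: "finite U" "finite Y"
    by (rule finite_subset[OF UV(1) V(1)]) (rule finite_subset[OF UV(2) finite_subset[OF UV(1) V(1)]])
  obtain Y' where Y': "Y' \<subseteq> Y" "card Y' = D * card (U - Y) + D" "\<forall>y\<in>Y'. \<forall>u\<in>Y - Y'. card (nbh V E u) \<le> card (nbh V E y)"
    using exists_top_subset[OF finU(2) True, of "\<lambda>v. card (nbh V E v)"] by blast
  let ?H = "U - Y"
  have "\<exists>C\<subseteq>Y'. rich_bound k (c + s + 1) \<le> card C \<and> (\<forall>y\<in>C. card (nbh ?H E y) \<le> s) \<and> (\<forall>x\<in>C. \<forall>y\<in>C. nbh ?H E x = nbh ?H E y)"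
  proof -
    have 1: "length xs < s" if "gpath (Y' \<union> ?H) E xs" for xs
      using gpath_mono[OF that, of U] Y'(1) UV(2) path by blast
    have 2: "\<not> E x y" if "x \<in> Y'" "y \<in> Y'" for x y using ind Y'(1) that by blast
    have 3: "Y' \<inter> ?H = {}" using Y'(1) by blast
    have 4: "(s + 2 ^ s * rich_bound k (c + s + 1)) * card ?H + (s + 2 ^ s * rich_bound k (c + s + 1)) \<le> card Y'"
      by (simp only: Y'(2) D order_refl)
    have 5: "finite Y'" "finite ?H" using finite_subset[OF Y'(1) finU(2)] finU(1) by simp_all
    show ?thesis by (rule exists_same_nbh[OF V(2) 1 5 3 2 4])
  qed
  then obtain C where C: "C \<subseteq> Y'" "rich_bound k (c + s + 1) \<le> card C" "\<forall>y\<in>C. card (nbh ?H E y) \<le> s"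
    "\<forall>x\<in>C. \<forall>y\<in>C. nbh ?H E x = nbh ?H E y" by blast
  let ?W = "V - U"
  have CY: "C \<subseteq> Y" "C \<subseteq> V" using C(1) Y'(1) UV by blast+
  have "\<exists>y\<in>C. rich k V E y"
  proof (rule exists_rich[OF V(1,2) k CY(2) C(2), where Z = ?H and W = ?W])
    fix y assume y: "y \<in> C"
    show "nbh V E y \<subseteq> ?H \<union> ?W" using y CY ind by (auto simp: nbh_def)
    have "nbh V E y = nbh ?H E y \<union> nbh ?W E y" using y CY ind UV by (auto simp: nbh_def)
    then have "card (nbh V E y) \<le> card (nbh ?H E y) + card (nbh ?W E y)" using card_Un_le by metis
    then have 1: "card (nbh V E y) \<le> s + card (nbh ?W E y)" using C(3) y by fastforce
    have "card (?W - nbh V E y) + card (nbh ?W E y) = card ?W"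
    proof -
      have "?W - nbh V E y = ?W - nbh ?W E y" by (auto simp: nbh_def)
      then show ?thesis using V(1) card_Diff_subset[of "nbh ?W E y" ?W] card_mono[of ?W "nbh ?W E y"] nbh_subset[of ?W E y] by simp
    qed
    moreover have "card ?W + card U = card V" using UV(1) V(1) finU card_mono[of V U] by (simp add: card_Diff_subset)
    ultimately have "card (?W - nbh V E y) + card (nbh V E y) + card U \<le> card V + s" using 1 by linarith
    then have "p * (card (?W - nbh V E y) + card (nbh V E y) + card U) \<le> p * (card V + s)" by (rule mult_le_mono2)
    then have 2: "p * card (?W - nbh V E y) + p * card (nbh V E y) + p * card U \<le> p * card V + p * s"
      by (simp add: distrib_left)
    have "p * card V \<le> (p - 1) * (card V - 1) + card V + p"
    proof -
      have "y \<in> V" using y CY by blast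
      then have "card V \<noteq> 0" using V(1) by auto
      then obtain m' where "card V = Suc m'" using not0_implies_Suc by blast
      moreover obtain p' where "p = Suc p'" using p not0_implies_Suc by fastforce
      ultimately show ?thesis by simp
    qed
    then have "p * card (?W - nbh V E y) \<le> p + c + p * s" using 2 md[of y] size y CY(2) by fastforce
    also have "\<dots> \<le> p * (c + s + 1)" using p by (simp add: algebra_simps)
    finally show "card (?W - nbh V E y) \<le> c + s + 1" by (rule mult_left_le_imp_le) (use p in simp)
  next
    fix x y y' assume "x \<in> ?H" "y \<in> C" "y' \<in> C" "E y x"
    then show "E y' x" using C(4) by (auto simp: nbh_def)
  qed (use V in simp)
  then obtain y where y: "y \<in> C" "rich k V E y" by blast
  define T where "T = Y - Y'"
  define E' where "E' = clone E T y"
  have yV: "y \<in> V" "y \<in> Y" "y \<in> Y'" using y(1) CY C(1) by blast+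
  have TV: "T \<subseteq> V" using UV by (auto simp: T_def)
  have disj: "T \<inter> nbh V E y = {}" using ind yV by (auto simp: T_def nbh_def)
  have no: "\<not> has_power p k V E'" unfolding E'_def by (rule clone_no_power[OF V(1,2) TV yV(1) y(2) V(3)])
  have ge: "graph_rel E'" unfolding E'_def by (rule graph_rel_clone[OF V(2)])
  have "degsum V E \<le> degsum V E'" unfolding E'_def
    using Y'(3) yV by (intro degsum_clone_ge[OF V(1,2) TV disj]) (auto simp: T_def)
  then have "extremal p k V E'" using degsum_le_exn[OF V(1) ge no] V ge no by (simp add: extremal_def)
  moreover have "card Y \<le> card T + (D * card (U - Y) + D)"
    using Y'(1,2) finU finite_subset[OF Y'(1)] by (simp add: T_def card_Diff_subset)
  moreover have "twins V E' T" by (auto simp: twins_def nbh_def E'_def clone_def)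
  moreover have "E' u v = E u v" if "u \<notin> U" "v \<notin> U" for u v
    using that UV(2) by (auto simp: E'_def clone_def T_def)
  moreover have "twins V E' A" if A: "A \<inter> U = {}" "twins V E A" for A
    unfolding twins_def
  proof (intro ballI)
    fix x x' assume x: "x \<in> A" "x' \<in> A"
    have xT: "x \<notin> T" "x' \<notin> T" using x A UV by (auto simp: T_def)
    have eq: "nbh V E x = nbh V E x'" using A(2) x unfolding twins_def by blast
    then have "E x v = E x' v" if "v \<in> V" for v using that by (auto simp: nbh_def)
    moreover have "E y x = E y x'" using calculation[OF yV(1)] graph_rel_sym[OF V(2)] by metis
    ultimately show "nbh V E' x = nbh V E' x'" using xT by (auto simp: nbh_def E'_def clone_def)
  qed
  ultimately show ?thesis by (intro exI[of _ E'] exI[of _ T]) (auto simp: T_def)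
qed

subsection \<open>The approximate structure\<close>

definition min_deg :: "nat \<Rightarrow> 'a set \<Rightarrow> ('a \<Rightarrow> 'a \<Rightarrow> bool) \<Rightarrow> bool" where
  "min_deg p V E \<longleftrightarrow> (\<forall>v\<in>V. (p - 1) * (card V - 1) \<le> p * card (nbh V E v))"

text \<open>Union bound: at most \<open>k\<close> vertices exclude at most
  \<open>k * \<mu> i\<close> elements of \<open>F i\<close>.\<close>

lemma richsys_of_misses:
  assumes F: "\<And>i. i < c \<Longrightarrow> F i \<subseteq> V i" "\<And>i. i < c \<Longrightarrow> finite (F i)"
    and disj: "\<And>i j. i < c \<Longrightarrow> j < c \<Longrightarrow> i \<noteq> j \<Longrightarrow> V i \<inter> V j = {}"
    and miss: "\<And>i j q. i < c \<Longrightarrow> j < c \<Longrightarrow> i \<noteq> j \<Longrightarrow> q \<in> V j \<Longrightarrow> card (F i - nbh (F i) E q) \<le> \<mu> i"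
    and big: "\<And>i. i < c \<Longrightarrow> k * \<mu> i + k \<le> card (F i)"
  shows "richsys E c k V F"
  unfolding richsys_def
proof (intro conjI allI impI)
  fix i assume i: "i < c"
  show "F i \<subseteq> V i" "finite (F i)" using F i by auto
  show "V i \<inter> V j = {}" if "j < c" "i \<noteq> j" for j using disj i that by blast
  fix Q assume Q: "finite Q" "card Q \<le> k" "\<forall>q\<in>Q. \<exists>j<c. j \<noteq> i \<and> q \<in> V j"
  let ?M = "\<lambda>q. F i - nbh (F i) E q"
  have "card (\<Union>q\<in>Q. ?M q) \<le> (\<Sum>q\<in>Q. card (?M q))" using Q(1) by (rule card_UN_le)
  also have "\<dots> \<le> card Q * \<mu> i"
  proof -
    have "card (?M q) \<le> \<mu> i" if q: "q \<in> Q" for q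
    proof -
      obtain j where "j < c" "j \<noteq> i" "q \<in> V j" using Q(3)[rule_format, OF q] by blast
      then show ?thesis using miss[of i j q] i by auto
    qed
    then show ?thesis using sum_bounded_above[of Q "\<lambda>q. card (?M q)" "\<mu> i"] by simp
  qed
  also have "\<dots> \<le> k * \<mu> i" using Q(2) by simp
  finally have "card (\<Union>q\<in>Q. ?M q) \<le> k * \<mu> i" .
  moreover have "card (F i) - card (\<Union>q\<in>Q. ?M q) \<le> card (F i - (\<Union>q\<in>Q. ?M q))"
    using Q(1) F(2)[OF i] by (intro diff_card_le_card_Diff) auto
  moreover have "card (F i - (\<Union>q\<in>Q. ?M q)) \<le> card {x \<in> F i. \<forall>q\<in>Q. E q x}"
    using F(2)[OF i] by (intro card_mono) (auto simp: nbh_def)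
  ultimately show "k \<le> card {x \<in> F i. \<forall>q\<in>Q. E q x}" using big[OF i] by linarith
qed

lemma complete_multipartite_has_power:
  assumes E: "graph_rel E" and C: "\<And>i. i < p + 1 \<Longrightarrow> finite (C i) \<and> k \<le> card (C i)"
    and comp: "\<And>i j x y. i < p + 1 \<Longrightarrow> j < p + 1 \<Longrightarrow> i \<noteq> j \<Longrightarrow> x \<in> C i \<Longrightarrow> y \<in> C j \<Longrightarrow> E x y"
  shows "has_power p k (\<Union>i<p+1. C i) E"
proof (rule richsys_Suc_has_power[OF E])
  show "richsys E (p + 1) k C C"
  proof (rule richsys_of_misses[where \<mu> = "\<lambda>_. 0"])
    fix i j assume ij: "i < p + 1" "j < p + 1" "i \<noteq> j"
    show "C i \<inter> C j = {}" using comp[OF ij] graph_relD(2)[OF E] by blast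
    fix q assume "q \<in> C j"
    then have e: "C i - nbh (C i) E q = {}" using comp[OF ij(2,1)] ij by (auto simp: nbh_def)
    show "card (C i - nbh (C i) E q) \<le> 0" unfolding e by simp
  qed (use C in auto)
qed

text \<open>Pigeonhole over the \<open>2 ^ card K\<close> possible neighbourhoods in
  \<open>K\<close>.\<close>

lemma exists_same_type:
  assumes "finite S" "finite K" "2 ^ card K * r \<le> card S"
  shows "\<exists>F\<subseteq>S. r \<le> card F \<and> (\<forall>x\<in>F. \<forall>y\<in>F. nbh K E x = nbh K E y)"
proof -
  have "\<exists>Z\<in>Pow K. card S \<le> card ((\<lambda>x. nbh K E x) -` {Z} \<inter> S) * card (Pow K)"
    using pigeonhole_card[of "\<lambda>x. nbh K E x" S "Pow K"] assms(1,2) nbh_subset[of K E] by auto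
  then obtain Z where Z: "card S \<le> card ((\<lambda>x. nbh K E x) -` {Z} \<inter> S) * card (Pow K)" by blast
  define F where "F = (\<lambda>x. nbh K E x) -` {Z} \<inter> S"
  have "2 ^ card K * r \<le> card F * 2 ^ card K" using Z assms(3) unfolding card_Pow[OF assms(2)] F_def by linarith
  then have "2 ^ card K * r \<le> 2 ^ card K * card F" by (simp only: mult.commute)
  then have "r \<le> card F" by simp
  then show ?thesis by (intro exI[of _ F]) (auto simp: F_def)
qed

section \<open>Complete multipartite subgraphs and an approximate partition\<close>

definition complete_parts :: "'a set \<Rightarrow> ('a \<Rightarrow> 'a \<Rightarrow> bool) \<Rightarrow> nat \<Rightarrow> nat \<Rightarrow> (nat \<Rightarrow> 'a set) \<Rightarrow> bool" where
  "complete_parts V E c T B \<longleftrightarrow> (\<forall>i<c. B i \<subseteq> V \<and> card (B i) = T) \<and>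
     (\<forall>i<c. \<forall>j<c. i \<noteq> j \<longrightarrow> (\<forall>x\<in>B i. \<forall>y\<in>B j. E x y))"

lemma complete_parts_disjoint:
  assumes "graph_rel E" "complete_parts V E c T B" "i < c" "j < c" "i \<noteq> j"
  shows "B i \<inter> B j = {}"
  using assms graph_relD(2)[OF assms(1)] unfolding complete_parts_def by blast

lemma card_nbh_UN:
  fixes c :: nat
  assumes "\<And>i. i < c \<Longrightarrow> finite (B i)" "\<And>i j. i < c \<Longrightarrow> j < c \<Longrightarrow> i \<noteq> j \<Longrightarrow> B i \<inter> B j = {}"
  shows "card (nbh (\<Union>i<c. B i) E v) = (\<Sum>i<c. card (nbh (B i) E v))"
proof -
  have "nbh (\<Union>i<c. B i) E v = (\<Union>i<c. nbh (B i) E v)" by (auto simp: nbh_def)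
  also have "card \<dots> = (\<Sum>i<c. card (nbh (B i) E v))"
    using assms by (intro card_UN_disjoint) (auto simp: nbh_def)
  finally show ?thesis .
qed

lemma sum_nbh_min_deg:
  assumes "finite V" "graph_rel E" "min_deg p V E" "K \<subseteq> V"
  shows "card K * ((p - 1) * (card V - 1)) \<le> p * (\<Sum>v\<in>V. card (nbh K E v))"
proof -
  have "finite K" using assms finite_subset by blast
  have "card K * ((p - 1) * (card V - 1)) \<le> (\<Sum>x\<in>K. p * card (nbh V E x))"
    using sum_bounded_below[of K "(p - 1) * (card V - 1)" "\<lambda>x. p * card (nbh V E x)"] assms(3,4)
    by (auto simp: min_deg_def)
  also have "\<dots> = p * (\<Sum>v\<in>V. card (nbh K E v))"
    using sum_card_nbh_swap[OF assms(1) \<open>finite K\<close> assms(2)] by (simp add: sum_distrib_left)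
  finally show ?thesis .
qed

text \<open>Induction on the number of parts in the manner of Erdos and Stone. Let \<open>K\<close>
  be the union of \<open>c < p\<close> complete parts of size \<open>T' = 2 * p * T\<close>. The
  minimum degree gives an average of nearly \<open>c * T' * (p - 1) / p\<close> neighbours in
  \<open>K\<close>, whereas a vertex with fewer than \<open>T\<close> neighbours in some part has
  fewer than \<open>(c - 1) * T' + T\<close>. The former is larger by at least about
  \<open>T' / p - T = T\<close>, so many vertices have \<open>T\<close> neighbours in every part,
  and \<open>T\<close> of them of the same type form the new part.\<close>

lemma exists_complete_parts:
  assumes "n < p" "2 \<le> p"
  shows "\<exists>M. \<forall>V E. finite V \<longrightarrow> graph_rel E \<longrightarrow> min_deg p V E \<longrightarrow> M \<le> card (V :: 'a set) \<longrightarrow>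
    (\<exists>B. complete_parts V E (Suc n) T B)"
  using assms(1)
proof (induction n arbitrary: T)
  case 0
  show ?case
  proof (intro exI[of _ T] allI impI)
    fix V :: "'a set" and E assume "finite V" "T \<le> card V"
    then obtain B where "B \<subseteq> V" "card B = T" by (meson obtain_subset_with_card_n)
    then show "\<exists>B. complete_parts V E (Suc 0) T B" by (intro exI[of _ "\<lambda>_. B"]) (auto simp: complete_parts_def)
  qed
next
  case (Suc n)
  define c where "c = Suc n"
  have cp: "c < p" using Suc.prems by (simp add: c_def)
  show ?case unfolding c_def[symmetric]
  proof (cases "T = 0")
    case True
    then show "\<exists>M. \<forall>V E. finite V \<longrightarrow> graph_rel E \<longrightarrow> min_deg p V E \<longrightarrow> M \<le> card (V :: 'a set) \<longrightarrow>
      (\<exists>B. complete_parts V E (Suc c) T B)"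
      by (intro exI[of _ 0] allI impI exI[of _ "\<lambda>_. {}"]) (simp add: complete_parts_def)
  next
    case False
    define T' where "T' = 2 * p * T"
    define N where "N = 2 ^ (c * T') * T"
    define K0 where "K0 = c * T' * (p - 1) + p * ((c * T' + N) * (c * T'))"
    obtain M where M: "\<forall>V E. finite V \<longrightarrow> graph_rel E \<longrightarrow> min_deg p V E \<longrightarrow> M \<le> card (V :: 'a set) \<longrightarrow>
      (\<exists>B. complete_parts V E c T' B)" unfolding c_def using Suc.IH[of T'] Suc.prems Suc_lessD by blast
    show "\<exists>M. \<forall>V E. finite V \<longrightarrow> graph_rel E \<longrightarrow> min_deg p V E \<longrightarrow> M \<le> card (V :: 'a set) \<longrightarrow>
      (\<exists>B. complete_parts V E (Suc c) T B)"
    proof (intro exI[of _ "M + K0 + 1"] allI impI)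
      fix V :: "'a set" and E assume V: "finite V" "graph_rel E" "min_deg p V E" "M + K0 + 1 \<le> card V"
      have "M \<le> card V" using V(4) by simp
      then obtain B where B: "complete_parts V E c T' B" using M V(1-3) by blast
      have Bi: "B i \<subseteq> V" "card (B i) = T'" "finite (B i)" if "i < c" for i
        using B that V(1) finite_subset[of "B i" V] by (auto simp: complete_parts_def)
      note Bd = complete_parts_disjoint[OF V(2) B]
      define K where "K = (\<Union>i<c. B i)"
      have KV: "K \<subseteq> V" "finite K" using Bi by (auto simp: K_def)
      have "card K = (\<Sum>i<c. card (B i))" unfolding K_def using Bi Bd by (intro card_UN_disjoint) auto
      then have cK: "card K = c * T'" using Bi by simp
      define S where "S = {v \<in> V - K. \<forall>i<c. T \<le> card (nbh (B i) E v)}"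
      have finS: "finite S" using V by (simp add: S_def)
      have nbK: "card (nbh K E v) = (\<Sum>i<c. card (nbh (B i) E v))" for v
        unfolding K_def by (rule card_nbh_UN) (use Bi Bd in auto)
      have nbT: "card (nbh (B i) E v) \<le> T'" if "i < c" for i v
        using card_mono[OF Bi(3)[OF that] nbh_subset] Bi(2)[OF that] by simp
      have "N \<le> card S"
      proof (rule ccontr)
        assume "\<not> ?thesis"
        then have cS: "card S \<le> N" by simp
        define c' where "c' = n"
        have c': "c = Suc c'" by (simp add: c_def c'_def)
        define KS where "KS = K \<union> S"
        have "(\<Sum>v\<in>V. card (nbh K E v)) \<le> (\<Sum>v\<in>V. (if v \<in> KS then c * T' else 0) + (c' * T' + T))"
        proof (rule sum_mono)
          fix v assume v: "v \<in> V"
          show "card (nbh K E v) \<le> (if v \<in> KS then c * T' else 0) + (c' * T' + T)"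
          proof (cases "v \<in> KS")
            case True
            have "card (nbh K E v) \<le> c * T'" using card_mono[OF KV(2) nbh_subset] cK by simp
            then show ?thesis using True by simp
          next
            case nS: False
            then obtain i where i: "i < c" "card (nbh (B i) E v) < T" using v by (auto simp: S_def KS_def not_le)
            have "(\<Sum>i<c. card (nbh (B i) E v)) = card (nbh (B i) E v) + (\<Sum>l\<in>{..<c}-{i}. card (nbh (B l) E v))"
              using i by (intro sum.remove) auto
            also have "(\<Sum>l\<in>{..<c}-{i}. card (nbh (B l) E v)) \<le> card ({..<c}-{i}) * T'"
              using sum_bounded_above[of "{..<c}-{i}" "\<lambda>l. card (nbh (B l) E v)" T'] nbT by simp
            also have "card ({..<c}-{i}) = c'" using i c' by simp
            finally show ?thesis using nS i nbK by simp
          qed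
        qed
        also have "\<dots> = card (V \<inter> (KS)) * (c * T') + card V * (c' * T' + T)"
          using V(1) by (simp add: sum.distrib sum.If_cases)
        also have "card (V \<inter> (KS)) \<le> c * T' + N"
        proof -
          have "card (V \<inter> (KS)) \<le> card KS" using KV finS by (intro card_mono) (auto simp: KS_def)
          also have "\<dots> \<le> card K + card S" unfolding KS_def by (rule card_Un_le)
          finally show ?thesis using cK cS by simp
        qed
        finally have up: "(\<Sum>v\<in>V. card (nbh K E v)) \<le> (c * T' + N) * (c * T') + card V * (c' * T' + T)" by simp
        have "c * T' * ((p - 1) * (card V - 1)) \<le> p * (\<Sum>v\<in>V. card (nbh K E v))"
          using sum_nbh_min_deg[OF V(1-3) KV(1)] cK by simp
        also have "\<dots> \<le> p * ((c * T' + N) * (c * T')) + p * (card V * (c' * T' + T))"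
          using mult_le_mono2[OF up, of p] by (simp only: distrib_left)
        finally have 1: "c * T' * ((p - 1) * (card V - 1)) \<le> p * ((c * T' + N) * (c * T')) + p * (card V * (c' * T' + T))" .
        have "card V \<noteq> 0" using V(4) by simp
        then have "c * T' * ((p - 1) * card V) = c * T' * ((p - 1) * (card V - 1)) + c * T' * (p - 1)"
        proof -
          obtain m' where "card V = Suc m'" using \<open>card V \<noteq> 0\<close> not0_implies_Suc by blast
          moreover have "x * (y * Suc m) = x * (y * m) + x * y" for x y m :: nat by (simp add: distrib_left)
          ultimately show ?thesis by simp
        qed
        then have 2: "c * T' * ((p - 1) * card V) \<le> K0 + p * (card V * (c' * T' + T))" using 1 by (simp add: K0_def)
        obtain e where e: "p = c + Suc e" using less_imp_Suc_add[OF cp] by auto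
        have "c * T' * ((p - 1) * card V) = p * (card V * (c' * T')) + Suc e * (T' * card V)"
          unfolding e c' by (simp add: algebra_simps)
        then have "Suc e * (T' * card V) \<le> K0 + p * (card V * T)" using 2 by (simp add: distrib_left)
        moreover have "T' * card V = 2 * (p * (card V * T))" by (simp add: T'_def)
        moreover have "1 * (T' * card V) \<le> Suc e * (T' * card V)" by (rule mult_le_mono1) simp
        ultimately have "p * (card V * T) \<le> K0" by linarith
        moreover have "card V \<le> p * (card V * T)" using False assms(2) by simp
        ultimately show False using V(4) by simp
      qed
      then have "2 ^ card K * T \<le> card S" by (simp add: N_def cK)
      then obtain F where F: "F \<subseteq> S" "T \<le> card F" "\<forall>x\<in>F. \<forall>y\<in>F. nbh K E x = nbh K E y"
        using exists_same_type[OF finS KV(2), of T E] by blast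
      obtain F' where F': "F' \<subseteq> F" "card F' = T" using obtain_subset_with_card_n[OF F(2)] by blast
      obtain f where f: "f \<in> F'" using F' False by fastforce
      have "\<exists>D. D \<subseteq> nbh (B i) E f \<and> card D = T" if "i < c" for i
      proof -
        have "T \<le> card (nbh (B i) E f)" using f F' F that by (auto simp: S_def)
        then show ?thesis by (meson obtain_subset_with_card_n)
      qed
      then obtain D where D: "\<And>i. i < c \<Longrightarrow> D i \<subseteq> nbh (B i) E f \<and> card (D i) = T" by metis
      have DE: "E x y" if "i < c" "x \<in> D i" "y \<in> F'" for i x y
      proof -
        have "x \<in> nbh K E f" using D[OF that(1)] that by (auto simp: K_def nbh_def)
        moreover have "nbh K E f = nbh K E y" using F(3) F'(1) f that(3) by blast
        ultimately show ?thesis using graph_relD(1)[OF V(2)] by (auto simp: nbh_def)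
      qed
      have FV: "F' \<subseteq> V" using F' F by (auto simp: S_def)
      have DB: "D i \<subseteq> B i" if "i < c" for i using D[OF that] by (auto simp: nbh_def)
      show "\<exists>B. complete_parts V E (Suc c) T B"
      proof (intro exI[of _ "\<lambda>i. if i < c then D i else F'"])
        show "complete_parts V E (Suc c) T (\<lambda>i. if i < c then D i else F')"
          unfolding complete_parts_def
        proof (intro conjI allI impI ballI)
          fix i assume "i < Suc c"
          show "(if i < c then D i else F') \<subseteq> V" using DB[of i] Bi(1)[of i] FV by auto
          show "card (if i < c then D i else F') = T" using D F' by auto
        next
          fix i j x y assume ij: "i < Suc c" "j < Suc c" "i \<noteq> j"
            and x: "x \<in> (if i < c then D i else F')" and y: "y \<in> (if j < c then D j else F')"
          consider "i < c" "j < c" | "i < c" "j = c" | "i = c" "j < c" using ij by linarith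
          then show "E x y"
          proof cases
            case 1
            then have "x \<in> B i" "y \<in> B j" using x y DB by auto
            then show ?thesis using B 1 ij(3) unfolding complete_parts_def by blast
          next
            case 2 then show ?thesis using x y DE by auto
          next
            case 3 then show ?thesis using x y DE[of j y x] graph_relD(1)[OF V(2)] by auto
          qed
        qed
      qed
    qed
  qed
qed

text \<open>Fix \<open>p\<close> complete parts \<open>B i\<close> of bounded size. Too many
  vertices with \<open>k\<close> neighbours in every \<open>B i\<close> would include
  \<open>k\<close> of the same type, hence a complete \<open>(p + 1)\<close>-partite graph
  containing the power. Every other vertex has fewer than \<open>k\<close> neighbours in some
  \<open>B i\<close>, and by the minimum degree most of them see almost all of the other parts; this
  index \<open>i\<close> defines the class. The \<open>B i\<close> then serve as reservoirs which
  turn a long path inside a class into a power.\<close>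

lemma exists_approx_partition:
  fixes z :: nat
  assumes p: "2 \<le> p" and q: "1 \<le> q" and b: "b \<le> 1" and k: "k + 1 = q * (p + 1) + p + b" and s: "s = 2 * q + b"
  shows "\<exists>M. \<forall>V E. finite V \<longrightarrow> graph_rel E \<longrightarrow> min_deg p V E \<longrightarrow> \<not> has_power p k V E \<longrightarrow> M \<le> card (V :: 'a set) \<longrightarrow>
    (\<exists>A. (\<forall>i<p. A i \<subseteq> V \<and> (\<forall>xs. gpath (A i) E xs \<longrightarrow> length xs < s)) \<and>
       (\<forall>i<p. \<forall>j<p. i \<noteq> j \<longrightarrow> A i \<inter> A j = {}) \<and> z * card (V - (\<Union>i<p. A i)) \<le> card V)"
proof -
  \<comment> \<open>Vertices outside \<open>K\<close> and \<open>S\<close> see at most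
    \<open>(p - 1) * T + k\<close> vertices of \<open>K\<close>, and the average is close to
    \<open>(p - 1) * T\<close>; so those falling short of the latter by more than \<open>L\<close>
    make up at most a share \<open>1 / (2 * z)\<close>. The size \<open>T\<close> lets a reservoir
    survive \<open>k\<close> vertices missing \<open>L + k\<close> elements each and keeps the
    classes disjoint.\<close>
  define L where "L = (k + 1) * (2 * z)"
  define T where "T = k * (L + k) + k + L + 2 * k"
  define R0 where "R0 = 2 ^ (p * T) * k"
  obtain M where M: "\<forall>V E. finite V \<longrightarrow> graph_rel E \<longrightarrow> min_deg p V E \<longrightarrow> M \<le> card (V :: 'a set) \<longrightarrow>
    (\<exists>B. complete_parts V E p T B)"
  proof -
    have "p - 1 < p" "Suc (p - 1) = p" using p by auto
    then show thesis using exists_complete_parts[of "p - 1" p T] p that by metis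
  qed
  define M' where "M' = M + T * p + (R0 + p * T) * (p * T) + 2 * z * (R0 + p * T) + 1"
  show ?thesis
  proof (intro exI[of _ M'] allI impI)
    fix V :: "'a set" and E assume V: "finite V" "graph_rel E" "min_deg p V E" "\<not> has_power p k V E" "M' \<le> card V"
    have "M \<le> card V" using V(5) by (simp add: M'_def)
    then obtain B where B: "complete_parts V E p T B" using M V(1-3) by blast
    have Bi: "B i \<subseteq> V" "card (B i) = T" "finite (B i)" if "i < p" for i
      using B that V(1) finite_subset[of "B i" V] by (auto simp: complete_parts_def)
    note Bd = complete_parts_disjoint[OF V(2) B]
    define K where "K = (\<Union>i<p. B i)"
    have KV: "K \<subseteq> V" "finite K" using Bi by (auto simp: K_def)
    have "card K = (\<Sum>i<p. card (B i))" unfolding K_def using Bi Bd by (intro card_UN_disjoint) auto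
    then have cK: "card K = p * T" using Bi by simp
    define S where "S = {v \<in> V - K. \<forall>i<p. k \<le> card (nbh (B i) E v)}"
    have finS: "finite S" using V by (simp add: S_def)
    have nbK: "card (nbh K E v) = (\<Sum>i<p. card (nbh (B i) E v))" for v
      unfolding K_def by (rule card_nbh_UN) (use Bi Bd in auto)
    have nbT: "card (nbh (B i) E v) \<le> T" if "i < p" for i v
      using card_mono[OF Bi(3)[OF that] nbh_subset] Bi(2)[OF that] by simp
    have cS: "card S \<le> R0"
    proof (rule ccontr)
      assume "\<not> ?thesis"
      then have "2 ^ card K * k \<le> card S" by (simp add: R0_def cK)
      then obtain F where F: "F \<subseteq> S" "k \<le> card F" "\<forall>x\<in>F. \<forall>y\<in>F. nbh K E x = nbh K E y"
        using exists_same_type[OF finS KV(2), of k E] by blast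
      have "k \<noteq> 0" using k p by auto
      then obtain f where f: "f \<in> F" using F(2) by fastforce
      define C where "C i = (if i < p then nbh (B i) E f else F)" for i
      have FE: "E x y" if "i < p" "x \<in> C i" "y \<in> F" for i x y
      proof -
        have "x \<in> nbh K E f" using that by (auto simp: K_def nbh_def C_def)
        moreover have "nbh K E f = nbh K E y" using F(3) f that(3) by blast
        ultimately show ?thesis using graph_relD(1)[OF V(2)] by (auto simp: nbh_def)
      qed
      have "has_power p k (\<Union>i<p+1. C i) E"
      proof (rule complete_multipartite_has_power[OF V(2)])
        fix i assume "i < p + 1"
        show "finite (C i) \<and> k \<le> card (C i)"
          using F f Bi(3) finite_subset[OF F(1) finS] by (auto simp: C_def S_def)
      next
        fix i j x y assume ij: "i < p + 1" "j < p + 1" "i \<noteq> j" and x: "x \<in> C i" and y: "y \<in> C j"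
        consider "i < p" "j < p" | "i < p" "j = p" | "i = p" "j < p" using ij by linarith
        then show "E x y"
        proof cases
          case 1
          then have "x \<in> B i" "y \<in> B j" using x y by (auto simp: C_def nbh_def)
          then show ?thesis using B 1 ij(3) unfolding complete_parts_def by blast
        next
          case 2 then show ?thesis using x y FE[of i x y] by (simp add: C_def)
        next
          case 3 then show ?thesis using x y FE[of j y x] graph_relD(1)[OF V(2)] by (simp add: C_def)
        qed
      qed
      moreover have "(\<Union>i<p+1. C i) \<subseteq> V" using Bi(1) F(1) by (auto simp: C_def S_def nbh_def split: if_splits)
      ultimately show False using V(4) has_power_mono[of p k _ E V k] by blast
    qed
    define D where "D = {v \<in> V - K - S. card (nbh K E v) + L < (p - 1) * T}"
    define Ex where "Ex = K \<union> S \<union> D"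
    have ExV: "Ex \<subseteq> V" "finite Ex" using KV finS V(1) by (auto simp: Ex_def S_def D_def)
    define A where "A i = {v \<in> V - Ex. card (nbh (B i) E v) < k}" for i
    have lowB: "card (nbh K E v) \<le> (p - 1) * T + k" if vS: "v \<in> V - K - S" for v
    proof -
      obtain i where i: "i < p" "card (nbh (B i) E v) < k" using vS by (auto simp: S_def not_le)
      have "(\<Sum>i<p. card (nbh (B i) E v)) = card (nbh (B i) E v) + (\<Sum>l\<in>{..<p}-{i}. card (nbh (B l) E v))"
        using i by (intro sum.remove) auto
      also have "(\<Sum>l\<in>{..<p}-{i}. card (nbh (B l) E v)) \<le> card ({..<p}-{i}) * T"
        using sum_bounded_above[of "{..<p}-{i}" "\<lambda>l. card (nbh (B l) E v)" T] nbT by simp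
      also have "card ({..<p}-{i}) = p - 1" using i by simp
      finally show ?thesis using i nbK by simp
    qed
    have cD: "2 * z * card D \<le> card V"
    proof -
      have DV: "D \<subseteq> V" by (auto simp: D_def)
      define KS where "KS = K \<union> S"
      have "(\<Sum>v\<in>V. card (nbh K E v) + (if v \<in> D then L + k else 0)) \<le> (\<Sum>v\<in>V. ((p - 1) * T + k) + (if v \<in> KS then p * T else 0))"
      proof (rule sum_mono)
        fix v assume v: "v \<in> V"
        show "card (nbh K E v) + (if v \<in> D then L + k else 0) \<le> ((p - 1) * T + k) + (if v \<in> KS then p * T else 0)"
        proof (cases "v \<in> KS")
          case True
          have "card (nbh K E v) \<le> p * T" using card_mono[OF KV(2) nbh_subset] cK by simp
          then show ?thesis using True by (auto simp: D_def KS_def)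
        next
          case False
          then show ?thesis using lowB[of v] v by (auto simp: D_def KS_def)
        qed
      qed
      then have "(\<Sum>v\<in>V. card (nbh K E v)) + card D * (L + k) \<le> card V * ((p - 1) * T + k) + card (V \<inter> (KS)) * (p * T)"
        using V(1) DV by (simp add: sum.distrib sum.If_cases Int_absorb1)
      moreover have "card (V \<inter> (KS)) \<le> R0 + p * T"
      proof -
        have "card (V \<inter> (KS)) \<le> card KS" using KV finS by (intro card_mono) (auto simp: KS_def)
        also have "\<dots> \<le> card K + card S" unfolding KS_def by (rule card_Un_le)
        finally show ?thesis using cK cS by simp
      qed
      then have "card (V \<inter> (KS)) * (p * T) \<le> (R0 + p * T) * (p * T)" by (rule mult_le_mono1)
      moreover have low: "T * ((p - 1) * (card V - 1)) \<le> (\<Sum>v\<in>V. card (nbh K E v))"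
      proof -
        have "p * (T * ((p - 1) * (card V - 1))) \<le> p * (\<Sum>v\<in>V. card (nbh K E v))"
          using sum_nbh_min_deg[OF V(1-3) KV(1)] cK by (simp add: mult.assoc)
        then show ?thesis by (rule mult_left_le_imp_le) (use p in simp)
      qed
      moreover have "card V * ((p - 1) * T) \<le> T * ((p - 1) * (card V - 1)) + T * p"
      proof -
        have "card V \<noteq> 0" using V(5) by (simp add: M'_def)
        then obtain m' where "card V = Suc m'" using not0_implies_Suc by blast
        moreover obtain p' where "p = Suc p'" using p not0_implies_Suc by fastforce
        ultimately show ?thesis by (simp add: algebra_simps)
      qed
      ultimately have "card D * (L + k) \<le> card V * k + T * p + (R0 + p * T) * (p * T)" unfolding distrib_left by linarith
      also have "\<dots> \<le> card V * k + card V" using V(5) by (simp add: M'_def)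
      finally have "card D * L + card D * k \<le> card V * (k + 1)" by (simp add: distrib_left)
      then have "card D * L \<le> card V * (k + 1)" by linarith
      then have "(k + 1) * (2 * z * card D) \<le> (k + 1) * card V" unfolding L_def by (simp only: mult.commute mult.left_commute)
      then show ?thesis by (rule mult_left_le_imp_le) simp
    qed
    have cEx: "z * card Ex \<le> card V"
    proof -
      have "card Ex \<le> card (K \<union> S) + card D" unfolding Ex_def by (rule card_Un_le)
      also have "card (K \<union> S) \<le> card K + card S" by (rule card_Un_le)
      finally have "card Ex \<le> p * T + R0 + card D" using cK cS by simp
      then have "2 * z * card Ex \<le> 2 * z * (p * T + R0 + card D)" by (rule mult_le_mono2)
      also have "\<dots> = 2 * z * (R0 + p * T) + 2 * z * card D" by (simp add: algebra_simps)
      also have "\<dots> \<le> 2 * card V" using cD V(5) by (simp add: M'_def)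
      finally show ?thesis by simp
    qed
    have Amiss: "card (B j - nbh (B j) E v) \<le> L + k" if "i < p" "j < p" "i \<noteq> j" "v \<in> A i" for i j v
    proof -
      have v: "v \<in> V" "v \<notin> K" "v \<notin> S" "v \<notin> D" "card (nbh (B i) E v) < k" using that by (auto simp: A_def Ex_def)
      then have "(p - 1) * T \<le> card (nbh K E v) + L" by (auto simp: D_def)
      also have "card (nbh K E v) = card (nbh (B i) E v) + (\<Sum>l\<in>{..<p}-{i}. card (nbh (B l) E v))"
        unfolding nbK using that by (intro sum.remove) auto
      also have "(\<Sum>l\<in>{..<p}-{i}. card (nbh (B l) E v)) = card (nbh (B j) E v) + (\<Sum>l\<in>{..<p}-{i}-{j}. card (nbh (B l) E v))"
        using that by (intro sum.remove) auto
      also have "(\<Sum>l\<in>{..<p}-{i}-{j}. card (nbh (B l) E v)) \<le> card ({..<p}-{i}-{j}) * T"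
        using sum_bounded_above[of "{..<p}-{i}-{j}" "\<lambda>l. card (nbh (B l) E v)" T] nbT by simp
      also have "card ({..<p}-{i}-{j}) = p - 2" using that by simp
      finally have 1: "(p - 1) * T \<le> card (nbh (B i) E v) + (card (nbh (B j) E v) + (p - 2) * T) + L" by simp
      have "(p - 1) * T = T + (p - 2) * T"
      proof -
        have "p - 1 = Suc (p - 2)" using p by simp
        then show ?thesis by simp
      qed
      then have "T \<le> card (nbh (B j) E v) + L + k" using 1 v(5) by linarith
      moreover have "card (B j - nbh (B j) E v) = T - card (nbh (B j) E v)"
        using Bi[OF that(2)] nbh_subset[of "B j" E v] by (simp add: card_Diff_subset)
      ultimately show ?thesis by simp
    qed
    have AA: "A i \<inter> A j = {}" if "i < p" "j < p" "i \<noteq> j" for i j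
    proof (rule ccontr)
      assume "A i \<inter> A j \<noteq> {}"
      then obtain v where v: "v \<in> A i" "v \<in> A j" by auto
      have "card (B j) \<le> card (B j - nbh (B j) E v) + card (nbh (B j) E v)"
        using Bi(3)[OF that(2)] by (metis card_Un_le Un_Diff_cancel2 Un_absorb2 nbh_subset)
      moreover have "card (nbh (B j) E v) < k" using v by (simp add: A_def)
      ultimately show False using Amiss[OF that v(1)] Bi(2)[OF that(2)] by (simp add: T_def)
    qed
    have AB: "A i \<inter> B j = {}" if "j < p" for i j using that by (auto simp: A_def Ex_def K_def)
    have rs: "richsys E p k (\<lambda>i. A i \<union> B i) B"
    proof (rule richsys_of_misses[where \<mu> = "\<lambda>_. L + k"])
      fix i j assume ij: "i < p" "j < p" "i \<noteq> j"
      show "(A i \<union> B i) \<inter> (A j \<union> B j) = {}" using AA[OF ij] AB ij Bd[OF ij] by blast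
      fix q assume "q \<in> A j \<union> B j"
      then show "card (B i - nbh (B i) E q) \<le> L + k"
      proof
        assume "q \<in> A j" then show ?thesis using Amiss[of j i q] ij by auto
      next
        assume "q \<in> B j"
        then have e: "B i - nbh (B i) E q = {}" using B ij by (auto simp: complete_parts_def nbh_def)
        show ?thesis unfolding e by simp
      qed
    qed (use Bi in \<open>auto simp: T_def\<close>)
    have nopath: "length xs < s" if i: "i < p" and xs: "gpath (A i) E xs" for i xs
    proof (rule ccontr)
      assume "\<not> ?thesis"
      then have len: "length (take s xs) = 2 * q + b" using s by simp
      have "gpath (A i \<union> B i) E (take s xs)" using gpath_mono[OF gpath_take[OF xs]] by blast
      then have "has_power p k (\<Union>i<p. A i \<union> B i) E"
        using richsys_path_has_power[OF V(2) rs p i b k _ len] by blast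
      moreover have "(\<Union>i<p. A i \<union> B i) \<subseteq> V" using Bi(1) by (auto simp: A_def)
      ultimately show False using V(4) has_power_mono[of p k _ E V k] by blast
    qed
    have "V - (\<Union>i<p. A i) \<subseteq> Ex"
    proof
      fix v assume v: "v \<in> V - (\<Union>i<p. A i)"
      show "v \<in> Ex"
      proof (rule ccontr)
        assume "v \<notin> Ex"
        then have "k \<le> card (nbh (B i) E v)" if "i < p" for i using v that by (auto simp: A_def not_less)
        then have "v \<in> S" using v \<open>v \<notin> Ex\<close> by (auto simp: S_def Ex_def)
        then show False using \<open>v \<notin> Ex\<close> by (simp add: Ex_def)
      qed
    qed
    then have "card (V - (\<Union>i<p. A i)) \<le> card Ex" using ExV by (intro card_mono)
    then have "z * card (V - (\<Union>i<p. A i)) \<le> card V" using cEx mult_le_mono2[of _ "card Ex" z] le_trans by blast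
    then show "\<exists>A. (\<forall>i<p. A i \<subseteq> V \<and> (\<forall>xs. gpath (A i) E xs \<longrightarrow> length xs < s)) \<and>
       (\<forall>i<p. \<forall>j<p. i \<noteq> j \<longrightarrow> A i \<inter> A j = {}) \<and> z * card (V - (\<Union>i<p. A i)) \<le> card V"
      using nopath AA by (intro exI[of _ A]) (auto simp: A_def)
  qed
qed

section \<open>Sizes of the classes and edges missing between them\<close>

lemma degsum_le_of_paths_bounded:
  assumes "finite A" "graph_rel E" "\<And>xs. gpath A E xs \<Longrightarrow> length xs < s"
  shows "degsum A E \<le> card A * s"
proof -
  have "degsum A E \<le> (\<Sum>v\<in>A. path_order A E v - 1)" by (rule degsum_le_path_order[OF assms(1,2)])
  also have "\<dots> \<le> (\<Sum>v\<in>A. s)"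
  proof (rule sum_mono)
    fix v assume "v \<in> A"
    then have "path_order A E v < s"
      using assms(3) by (intro path_order_bound[OF assms(1)]) (auto simp: less_le)
    then show "path_order A E v - 1 \<le> s" by simp
  qed
  finally show ?thesis by simp
qed

text \<open>Markov's inequality for the degrees inside \<open>A\<close>, whose sum is at most
  \<open>card A * s\<close>.\<close>

lemma card_large_degree:
  assumes "finite A" "graph_rel E" "\<And>xs. gpath A E xs \<Longrightarrow> length xs < s"
    and "\<And>v. v \<in> B \<Longrightarrow> m \<le> z * card (nbh A E v)" "B \<subseteq> A"
  shows "card B * m \<le> z * (card A * s)"
proof -
  have "card B * m \<le> (\<Sum>v\<in>B. z * card (nbh A E v))"
    using sum_bounded_below[of B m "\<lambda>v. z * card (nbh A E v)"] assms(4) by simp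
  also have "\<dots> \<le> (\<Sum>v\<in>A. z * card (nbh A E v))" using assms(1,5) by (intro sum_mono2) auto
  also have "\<dots> = z * degsum A E" by (simp add: degsum_def sum_distrib_left)
  also have "\<dots> \<le> z * (card A * s)"
    by (rule mult_le_mono2[OF degsum_le_of_paths_bounded[OF assms(1-3)]])
  finally show ?thesis .
qed

lemma card_split_nbh:
  assumes "finite V" "A \<subseteq> V"
  shows "card (V - A - nbh V E v) + card A + card (nbh V E v) = card V + card (nbh A E v)"
proof -
  have fin: "finite A" using assms finite_subset by blast
  have 1: "card V = card (V - A) + card A" using assms fin card_mono[of V A] by (simp add: card_Diff_subset)
  have "A \<union> (V - A) = V" using assms(2) by blast
  then have 2: "card (nbh V E v) = card (nbh A E v) + card (nbh (V - A) E v)"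
    using card_nbh_Un[of A "V - A" E v] fin assms(1) by simp
  have "V - A - nbh V E v = (V - A) - nbh (V - A) E v" by (auto simp: nbh_def)
  then have "card (V - A - nbh V E v) + card (nbh (V - A) E v) = card (V - A)"
    using assms(1) nbh_subset[of "V - A" E v] card_mono[of "V - A" "nbh (V - A) E v"]
    by (simp add: card_Diff_subset)
  with 1 2 show ?thesis by simp
qed

lemma mult_pred_pred:
  fixes p m :: nat
  assumes "1 \<le> p" "1 \<le> m"
  shows "p * m + 1 = (p - 1) * (m - 1) + m + p"
proof -
  obtain m' p' where "m = Suc m'" "p = Suc p'" using assms by (metis Suc_pred' less_eq_Suc_le One_nat_def)
  then show ?thesis by simp
qed

text \<open>A vertex may have about \<open>card V / p\<close> non-neighbours, and \<open>A\<close>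
  alone has about that many vertices. So every neighbour of \<open>v\<close> inside \<open>A\<close>
  permits one more non-neighbour outside, up to the error \<open>e + 1\<close>.\<close>

lemma class_miss:
  assumes "finite V" "min_deg p V E" "1 \<le> p" "A \<subseteq> V" "v \<in> V" "card V \<le> p * card A + p * e"
  shows "card (V - A - nbh V E v) \<le> card (nbh A E v) + e + 1"
proof -
  have "1 \<le> card V" using assms(1,5) by (metis One_nat_def Suc_leI card_gt_0_iff empty_iff)
  note pm = mult_pred_pred[OF assms(3) this]
  have "p * (card (V - A - nbh V E v) + card A + card (nbh V E v)) = p * (card V + card (nbh A E v))"
    using card_split_nbh[OF assms(1,4), of E v] by simp
  then have "p * card (V - A - nbh V E v) + p * card A + p * card (nbh V E v) = p * card V + p * card (nbh A E v)"
    by (simp add: distrib_left)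
  moreover have "(p - 1) * (card V - 1) \<le> p * card (nbh V E v)" using assms(2,5) by (simp add: min_deg_def)
  ultimately have "p * card (V - A - nbh V E v) \<le> p * card (nbh A E v) + p * e + p" using pm assms(6) by linarith
  also have "\<dots> = p * (card (nbh A E v) + e + 1)" by (simp add: distrib_left)
  finally show ?thesis by (rule mult_left_le_imp_le) (use assms(3) in simp)
qed

text \<open>Some vertex of \<open>A\<close> has at most \<open>s\<close> neighbours in
  \<open>A\<close>, so \<open>A\<close> exceeds a permitted set of non-neighbours by at most
  \<open>s\<close>.\<close>

lemma class_size_upper:
  assumes "finite V" "graph_rel E" "min_deg p V E" "1 \<le> p" "A \<subseteq> V" "\<And>xs. gpath A E xs \<Longrightarrow> length xs < s"
  shows "p * card A \<le> card V + p * (s + 1)"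
proof (cases "A = {}")
  case False
  have fin: "finite A" using assms finite_subset by blast
  have "1 \<le> card V" using False assms(1,5) by (metis One_nat_def Suc_leI card_gt_0_iff subset_empty)
  note pm = mult_pred_pred[OF assms(4) this]
  have "\<exists>v\<in>A. card (nbh A E v) \<le> s"
  proof (rule ccontr)
    assume "\<not> ?thesis"
    then have "(\<Sum>v\<in>A. s) < (\<Sum>v\<in>A. card (nbh A E v))" using fin False by (intro sum_strict_mono) (auto simp: not_le)
    then show False using degsum_le_of_paths_bounded[OF fin assms(2,6)] by (simp add: degsum_def)
  qed
  then obtain v where v: "v \<in> A" "card (nbh A E v) \<le> s" by blast
  have "card A + card (nbh V E v) \<le> card V + s" using card_split_nbh[OF assms(1,5), of E v] v(2) by linarith
  then have "p * (card A + card (nbh V E v)) \<le> p * (card V + s)" by (rule mult_le_mono2)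
  then have "p * card A + p * card (nbh V E v) \<le> p * card V + p * s" by (simp add: distrib_left)
  moreover have "(p - 1) * (card V - 1) \<le> p * card (nbh V E v)" using assms(3,5) v by (auto simp: min_deg_def)
  ultimately have "p * card A \<le> card V + p + p * s" using pm by linarith
  then show ?thesis by (simp add: distrib_left)
qed simp

text \<open>The other classes have at most about \<open>card V / p\<close> vertices each by
  \<open>class_size_upper\<close>, and this class must make up the rest.\<close>

lemma class_size_lower:
  assumes V: "finite V" "graph_rel E" "min_deg p V E" "1 \<le> p"
    and A: "\<And>i. i < p \<Longrightarrow> A i \<subseteq> V" "\<And>i xs. i < p \<Longrightarrow> gpath (A i) E xs \<Longrightarrow> length xs < s"
      "\<And>i j. i < p \<Longrightarrow> j < p \<Longrightarrow> i \<noteq> j \<Longrightarrow> A i \<inter> A j = {}" and i: "i < p"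
  shows "card V \<le> p * card (A i) + p * (card (V - (\<Union>j<p. A j)) + p * (s + 1))"
proof -
  have fin: "finite (A j)" if "j < p" for j using A(1)[OF that] V(1) finite_subset by blast
  have "card V = card (\<Union>j<p. A j) + card (V - (\<Union>j<p. A j))"
  proof -
    have sub: "(\<Union>j<p. A j) \<subseteq> V" using A(1) by auto
    show ?thesis using V(1) card_mono[OF V(1) sub] by (simp add: card_Diff_subset[OF finite_subset[OF sub V(1)] sub])
  qed
  also have "card (\<Union>j<p. A j) = (\<Sum>j<p. card (A j))"
    using fin A(3) by (intro card_UN_disjoint) auto
  also have "\<dots> = card (A i) + (\<Sum>j\<in>{..<p}-{i}. card (A j))" using i by (intro sum.remove) auto
  finally have "p * card V = p * card (A i) + (\<Sum>j\<in>{..<p}-{i}. p * card (A j)) + p * card (V - (\<Union>j<p. A j))"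
    by (simp add: distrib_left sum_distrib_left)
  moreover have "(\<Sum>j\<in>{..<p}-{i}. p * card (A j)) \<le> card ({..<p}-{i}) * (card V + p * (s + 1))"
  proof -
    have "p * card (A j) \<le> card V + p * (s + 1)" if j: "j < p" for j
      by (rule class_size_upper[OF V A(1)[OF j]]) (rule A(2)[OF j])
    then show ?thesis using sum_bounded_above[of "{..<p}-{i}" "\<lambda>j. p * card (A j)" "card V + p * (s + 1)"] by simp
  qed
  moreover have "card ({..<p}-{i}) * (card V + p * (s + 1)) = (p - 1) * card V + (p - 1) * (p * (s + 1))"
    using i by (simp add: distrib_left)
  moreover have "(p - 1) * (p * (s + 1)) \<le> p * (p * (s + 1))" by (rule mult_le_mono1) simp
  moreover have "p * card V = (p - 1) * card V + card V" using V(4) by (cases p) auto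
  ultimately show ?thesis unfolding distrib_left[of p "card (V - (\<Union>j<p. A j))"] by linarith
qed

text \<open>With \<open>card W = 2 * z * r\<close>, vertices of \<open>A\<close> having fewer than
  \<open>r\<close> neighbours in \<open>W\<close> account for at most half of the adjacent pairs; so
  at least \<open>a / 2\<close> vertices have \<open>r\<close> or more. Sorting these by their
  neighbourhood in \<open>W\<close> leaves at most \<open>2 ^ (2 * z * r)\<close> types, and the
  most frequent one is \<open>W'\<close>.\<close>

lemma exists_common_nbhs:
  assumes W: "finite W" "finite A" "graph_rel E" "card W = 2 * z * r" "1 \<le> z" "1 \<le> r"
    and a: "card A \<le> z * a" "\<And>w. w \<in> W \<Longrightarrow> a \<le> card (nbh A E w)"
  shows "\<exists>W'\<subseteq>W. r \<le> card W' \<and> a \<le> 2 ^ (2 * z * r + 1) * card {x \<in> A. \<forall>w\<in>W'. E w x}"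
proof (cases "a = 0")
  case True
  have "r \<le> 2 * z * r" using W(5) by simp
  then show ?thesis using True W(4) by (intro exI[of _ W]) simp
next
  case False
  define n where "n = 2 * z * r"
  have n: "card W = n" "1 \<le> n" using W(4-6) by (simp_all add: n_def)
  define X where "X = {x \<in> A. r \<le> card (nbh W E x)}"
  have finX: "finite X" using W by (simp add: X_def)
  have "n * a \<le> (\<Sum>w\<in>W. card (nbh A E w))" using sum_bounded_below[of W a "\<lambda>w. card (nbh A E w)"] a(2) n by simp
  also have "\<dots> = (\<Sum>x\<in>A. card (nbh W E x))" by (rule sum_card_nbh_swap[OF W(1-3)])
  also have "\<dots> \<le> (\<Sum>x\<in>A. r + (if x \<in> X then n else 0))"
  proof (rule sum_mono)
    fix x assume x: "x \<in> A"
    show "card (nbh W E x) \<le> r + (if x \<in> X then n else 0)"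
    proof (cases "x \<in> X")
      case True
      then show ?thesis using card_mono[OF W(1) nbh_subset, of E x] n by simp
    next
      case False then show ?thesis using x by (simp add: X_def)
    qed
  qed
  also have "\<dots> = card A * r + card X * n"
  proof -
    have "A \<inter> X = X" by (auto simp: X_def)
    then show ?thesis using W(2) by (simp add: sum.distrib sum.If_cases)
  qed
  also have "\<dots> \<le> z * a * r + card X * n" using a(1) by simp
  finally have "2 * (z * a * r) \<le> z * a * r + card X * n" by (simp add: n_def algebra_simps)
  then have "n * a \<le> n * (2 * card X)" by (simp add: n_def algebra_simps)
  then have aX: "a \<le> 2 * card X" by (rule mult_left_le_imp_le) (use n in simp)
  then have "X \<noteq> {}" using False by auto
  have "\<exists>Z\<in>Pow W. card X \<le> card ((\<lambda>x. nbh W E x) -` {Z} \<inter> X) * card (Pow W)"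
    using pigeonhole_card[of "\<lambda>x. nbh W E x" X "Pow W"] W(1) finX nbh_subset[of W E] by auto
  then obtain Z where Z: "Z \<subseteq> W" "card X \<le> card ((\<lambda>x. nbh W E x) -` {Z} \<inter> X) * card (Pow W)" by blast
  define F where "F = (\<lambda>x. nbh W E x) -` {Z} \<inter> X"
  have FX: "card X \<le> card F * 2 ^ n" using Z(2) unfolding F_def[symmetric] card_Pow[OF W(1)] n(1) .
  then have "F \<noteq> {}" using \<open>X \<noteq> {}\<close> finX by (auto simp: card_eq_0_iff)
  then obtain x where x: "x \<in> F" by auto
  have "r \<le> card Z" using x by (auto simp: F_def X_def)
  moreover have "F \<subseteq> {x \<in> A. \<forall>w\<in>Z. E w x}" using graph_relD(1)[OF W(3)] by (auto simp: F_def X_def nbh_def)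
  then have "card F \<le> card {x \<in> A. \<forall>w\<in>Z. E w x}" using W(2) by (intro card_mono) auto
  then have "card F * 2 ^ n \<le> card {x \<in> A. \<forall>w\<in>Z. E w x} * 2 ^ n" by (rule mult_le_mono1)
  then have "a \<le> 2 * (card {x \<in> A. \<forall>w\<in>Z. E w x} * 2 ^ n)" using aX FX by linarith
  then have "a \<le> 2 ^ (2 * z * r + 1) * card {x \<in> A. \<forall>w\<in>Z. E w x}"
    unfolding n_def[symmetric] by (simp add: mult.commute mult.left_commute)
  ultimately show ?thesis using Z(1) by blast
qed

text \<open>The sets \<open>A i\<close> are treated one at a time. Each step passes to a subset of
  \<open>W\<close>, which can only enlarge common neighbourhoods already secured; the required size
  \<open>R\<close> therefore grows by a recursion from \<open>k\<close>.\<close>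

lemma exists_common_nbhs_multi:
  fixes z k c :: nat
  assumes "1 \<le> z" "1 \<le> k"
  shows "\<exists>R \<alpha>. 1 \<le> \<alpha> \<and> k \<le> R \<and> (\<forall>W A E a. finite (W :: 'a set) \<longrightarrow> graph_rel E \<longrightarrow> R \<le> card W \<longrightarrow>
    (\<forall>i<c. finite (A i) \<and> card (A i) \<le> z * a \<and> (\<forall>w\<in>W. a \<le> card (nbh (A i) E w))) \<longrightarrow>
    (\<exists>W'\<subseteq>W. k \<le> card W' \<and> (\<forall>i<c. a \<le> \<alpha> * card {x \<in> A i. \<forall>w\<in>W'. E w x})))"
proof (induction c)
  case 0
  show ?case by (rule exI[of _ k], rule exI[of _ 1]) auto
next
  case (Suc c)
  then obtain r \<alpha> where r: "1 \<le> \<alpha>" "k \<le> r" "\<forall>W A E a. finite (W :: 'a set) \<longrightarrow> graph_rel E \<longrightarrow> r \<le> card W \<longrightarrow>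
    (\<forall>i<c. finite (A i) \<and> card (A i) \<le> z * a \<and> (\<forall>w\<in>W. a \<le> card (nbh (A i) E w))) \<longrightarrow>
    (\<exists>W'\<subseteq>W. k \<le> card W' \<and> (\<forall>i<c. a \<le> \<alpha> * card {x \<in> A i. \<forall>w\<in>W'. E w x}))" by blast
  define \<beta> where "\<beta> = \<alpha> + 2 ^ (2 * z * r + 1)"
  have r1: "1 \<le> r" using r(2) assms(2) by simp
  show ?case
  proof (rule exI[of _ "2 * z * r"], rule exI[of _ \<beta>], intro conjI allI impI)
    show "1 \<le> \<beta>" using r(1) by (simp add: \<beta>_def)
    have "r \<le> 2 * z * r" using assms(1) by simp
    then show "k \<le> 2 * z * r" using r(2) by linarith
  next
    fix W :: "'a set" and A E a
    assume W: "finite W" "graph_rel E" "2 * z * r \<le> card W"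
      and A: "\<forall>i<Suc c. finite (A i) \<and> card (A i) \<le> z * a \<and> (\<forall>w\<in>W. a \<le> card (nbh (A i) E w))"
    obtain W0 where W0: "W0 \<subseteq> W" "card W0 = 2 * z * r" using obtain_subset_with_card_n[OF W(3)] by blast
    have fin0: "finite W0" using W0 W finite_subset by blast
    have Ac: "finite (A c)" "card (A c) \<le> z * a" "\<And>w. w \<in> W0 \<Longrightarrow> a \<le> card (nbh (A c) E w)"
      using A W0(1) by auto
    obtain W1 where W1: "W1 \<subseteq> W0" "r \<le> card W1" "a \<le> 2 ^ (2 * z * r + 1) * card {x \<in> A c. \<forall>w\<in>W1. E w x}"
      using exists_common_nbhs[OF fin0 Ac(1) W(2) W0(2) assms(1) r1 Ac(2,3)] by blast
    have fin1: "finite W1" using W1(1) fin0 finite_subset by blast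
    have "\<forall>i<c. finite (A i) \<and> card (A i) \<le> z * a \<and> (\<forall>w\<in>W1. a \<le> card (nbh (A i) E w))"
      using A W1(1) W0(1) by auto
    then have "\<exists>W'\<subseteq>W1. k \<le> card W' \<and> (\<forall>i<c. a \<le> \<alpha> * card {x \<in> A i. \<forall>w\<in>W'. E w x})"
      by (intro r(3)[THEN spec[of _ W1], THEN spec[of _ A], THEN spec[of _ E], THEN spec[of _ a],
            THEN mp, THEN mp, THEN mp, THEN mp, OF fin1 W(2) W1(2)])
    then obtain W' where W': "W' \<subseteq> W1" "k \<le> card W'" "\<forall>i<c. a \<le> \<alpha> * card {x \<in> A i. \<forall>w\<in>W'. E w x}"
      by (elim exE conjE) (rule that)
    have "a \<le> \<beta> * card {x \<in> A i. \<forall>w\<in>W'. E w x}" if "i < Suc c" for i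
    proof (cases "i = c")
      case True
      have "{x \<in> A c. \<forall>w\<in>W1. E w x} \<subseteq> {x \<in> A c. \<forall>w\<in>W'. E w x}" using W'(1) by blast
      then have "card {x \<in> A c. \<forall>w\<in>W1. E w x} \<le> card {x \<in> A c. \<forall>w\<in>W'. E w x}"
        using Ac(1) by (intro card_mono) auto
      then have "2 ^ (2 * z * r + 1) * card {x \<in> A c. \<forall>w\<in>W1. E w x} \<le> \<beta> * card {x \<in> A c. \<forall>w\<in>W'. E w x}"
        unfolding \<beta>_def by (intro mult_le_mono) simp
      then show ?thesis using True W1(3) by simp
    next
      case False
      then have "a \<le> \<alpha> * card {x \<in> A i. \<forall>w\<in>W'. E w x}" using W'(3) that by simp
      also have "\<dots> \<le> \<beta> * card {x \<in> A i. \<forall>w\<in>W'. E w x}" unfolding \<beta>_def by (rule mult_le_mono1) simp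
      finally show ?thesis .
    qed
    moreover have "W' \<subseteq> W" using W'(1) W1(1) W0(1) by blast
    ultimately show "\<exists>W'\<subseteq>W. k \<le> card W' \<and> (\<forall>i<Suc c. a \<le> \<beta> * card {x \<in> A i. \<forall>w\<in>W'. E w x})"
      using W'(2) by blast
  qed
qed

text \<open>The exceptional set shrinks from a small proportion to a bounded number of vertices.
  \<open>U i\<close> collects the vertices with fewer than \<open>m / z\<close> neighbours in
  \<open>A i\<close>. A vertex in no \<open>U i\<close> is adjacent to a positive proportion of
  every \<open>A i\<close>; among too many of these, \<open>k\<close> have linearly many common
  neighbours in each \<open>A i\<close> and would act as an additional class number
  \<open>p + 1\<close>.\<close>

lemma exists_partition:
  assumes p: "2 \<le> p" and q: "1 \<le> q" and b: "b \<le> 1" and k: "k + 1 = q * (p + 1) + p + b" and s: "s = 2 * q + b"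
  shows "\<exists>R M. \<forall>V E. finite V \<longrightarrow> graph_rel E \<longrightarrow> min_deg p V E \<longrightarrow> \<not> has_power p k V E \<longrightarrow> M \<le> card (V :: 'a set) \<longrightarrow>
    (\<exists>U. (\<forall>i<p. U i \<subseteq> V \<and> card V \<le> 2 * p * card (U i)) \<and> (\<forall>i<p. \<forall>j<p. i \<noteq> j \<longrightarrow> U i \<inter> U j = {}) \<and>
       card (V - (\<Union>i<p. U i)) \<le> R \<and>
       (\<forall>i<p. \<forall>j<p. i \<noteq> j \<longrightarrow> (\<forall>v\<in>U i. 4 * k * p * card (U j - nbh V E v) \<le> card V)))"
proof -
  have k1: "1 \<le> k" using k p by linarith
  have p1: "1 \<le> p" using p by simp
  define z where "z = 32 * k * p"
  have z1: "1 \<le> 4 * z" "1 \<le> z" using k1 p by (auto simp: z_def)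
  have zp: "32 * p \<le> z" using mult_le_mono1[OF k1, of "32 * p"] by (simp add: z_def)
  obtain R \<alpha> where R: "1 \<le> \<alpha>" "k \<le> R" "\<forall>W A E a. finite (W :: 'a set) \<longrightarrow> graph_rel E \<longrightarrow> R \<le> card W \<longrightarrow>
    (\<forall>i<p. finite (A i) \<and> card (A i) \<le> 4 * z * a \<and> (\<forall>w\<in>W. a \<le> card (nbh (A i) E w))) \<longrightarrow>
    (\<exists>W'\<subseteq>W. k \<le> card W' \<and> (\<forall>i<p. a \<le> \<alpha> * card {x \<in> A i. \<forall>w\<in>W'. E w x}))"
    using exists_common_nbhs_multi[OF z1(1) k1, of p] by blast
  \<comment> \<open>A finer threshold than \<open>z\<close>. Vertices of degree below
    \<open>m / y\<close> in their class miss at most \<open>3 * m / y\<close> vertices outside it;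
    even \<open>k\<close> times this must stay below common neighbourhoods of about
    \<open>m / (2 * z * \<alpha>)\<close> vertices.\<close>
  define y where "y = 24 * z * \<alpha> * k"
  have zy: "z \<le> y" using R(1) k1 mult_le_mono[OF order_refl[of z], of 1 "24 * \<alpha> * k"] by (simp add: y_def mult.assoc mult.left_commute)
  have y1: "1 \<le> y" using zy z1 by simp
  define c1 where "c1 = p * (s + 1) + 1"
  obtain M where M: "\<forall>V E. finite V \<longrightarrow> graph_rel E \<longrightarrow> min_deg p V E \<longrightarrow> \<not> has_power p k V E \<longrightarrow> M \<le> card (V :: 'a set) \<longrightarrow>
    (\<exists>A. (\<forall>i<p. A i \<subseteq> V \<and> (\<forall>xs. gpath (A i) E xs \<longrightarrow> length xs < s)) \<and>
       (\<forall>i<p. \<forall>j<p. i \<noteq> j \<longrightarrow> A i \<inter> A j = {}) \<and> y * card (V - (\<Union>i<p. A i)) \<le> card V)"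
    using exists_approx_partition[OF assms, where z = y and 'a = 'a] by (elim exE) (rule that)
  define M' where "M' = M + y * c1 + 8 * (p * (p * (s + 1)) + p * (z * s)) + 4 * p * s * z + 2 * z * (y * s) + 8 * (z * \<alpha> * k) + 8 * z + 1"
  show ?thesis
  proof (rule exI[of _ R], rule exI[of _ M'], intro allI impI)
    fix V :: "'a set" and E assume V: "finite V" "graph_rel E" "min_deg p V E" "\<not> has_power p k V E" "M' \<le> card V"
    define m where "m = card V"
    have "M \<le> card V" using V(5) by (simp add: M'_def)
    from M[rule_format, OF V(1-4) this] obtain A where A0: "(\<forall>i<p. A i \<subseteq> V \<and> (\<forall>xs. gpath (A i) E xs \<longrightarrow> length xs < s)) \<and>
       (\<forall>i<p. \<forall>j<p. i \<noteq> j \<longrightarrow> A i \<inter> A j = {}) \<and> y * card (V - (\<Union>i<p. A i)) \<le> card V" by (elim exE) (rule that)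
    have A: "\<And>i. i < p \<Longrightarrow> A i \<subseteq> V" "\<And>i xs. i < p \<Longrightarrow> gpath (A i) E xs \<Longrightarrow> length xs < s"
      "\<And>i j. i < p \<Longrightarrow> j < p \<Longrightarrow> i \<noteq> j \<Longrightarrow> A i \<inter> A j = {}" "y * card (V - (\<Union>i<p. A i)) \<le> card V"
      using A0 by simp_all
    define e where "e = card (V - (\<Union>i<p. A i))"
    have big: "y * c1 \<le> m" "8 * (p * (p * (s + 1)) + p * (z * s)) \<le> m" "4 * p * s * z \<le> m" "2 * z * (y * s) \<le> m"
       "8 * (z * \<alpha> * k) \<le> m" "8 * z \<le> m" "1 \<le> m"
      using V(5) unfolding m_def M'_def by linarith+
    have ye: "y * e \<le> m" using A(4) by (simp add: e_def m_def)
    have ze: "z * e \<le> m" using mult_le_mono1[OF zy, of e] ye by linarith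
    have zc: "z * c1 \<le> m" using mult_le_mono1[OF zy, of c1] big(1) by linarith
    have finA: "finite (A i)" if "i < p" for i using A(1)[OF that] V(1) finite_subset by blast
    have Am: "card (A i) \<le> m" if "i < p" for i unfolding m_def using A(1)[OF that] V(1) by (intro card_mono)
    have low: "m \<le> p * card (A i) + p * (e + p * (s + 1))" if "i < p" for i
      unfolding m_def e_def by (rule class_size_lower[OF V(1-3) p1 A(1,2,3) that]) auto
    \<comment> \<open>With all paths shorter than \<open>s\<close>, only boundedly many vertices of
      a class can have linear degree inside it.\<close>
    have few: "card B \<le> t * s" if "i < p" "B \<subseteq> A i" "\<And>v. v \<in> B \<Longrightarrow> m \<le> t * card (nbh (A i) E v)" for i B t
    proof -
      have "card B * m \<le> t * (card (A i) * s)"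
        using that A(2)[OF that(1)] by (intro card_large_degree[OF finA V(2)]) auto
      also have "\<dots> \<le> t * (m * s)" using Am[OF that(1)] by simp
      finally have "m * card B \<le> m * (t * s)" by (simp add: mult.commute mult.left_commute)
      then show ?thesis using big(7) by simp
    qed
    have miss: "card (V - A i - nbh V E v) \<le> card (nbh (A i) E v) + e + c1" if "i < p" "v \<in> V" for i v
      using class_miss[OF V(1,3) p1 A(1)[OF that(1)] that(2), of "e + p * (s + 1)"] low[OF that(1)]
      by (simp add: m_def c1_def)
    \<comment> \<open>\<open>U i\<close> need not lie in \<open>A i\<close>: it may take in
      exceptional vertices and a bounded number of vertices of other classes, which
      \<open>UA\<close> estimates.\<close>
    define U where "U i = {v \<in> V. z * card (nbh (A i) E v) < m}" for i
    have missU: "z * card (V - A i - nbh V E v) \<le> 3 * m" if "i < p" "v \<in> U i" for i v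
    proof -
      have v: "v \<in> V" "z * card (nbh (A i) E v) < m" using that(2) by (auto simp: U_def)
      have "z * card (V - A i - nbh V E v) \<le> z * (card (nbh (A i) E v) + e + c1)"
        by (rule mult_le_mono2[OF miss[OF that(1) v(1)]])
      then show ?thesis using v(2) ze zc by (simp add: distrib_left)
    qed
    have arith: "m \<le> 2 * x \<and> 3 * m \<le> 4 * x" if "32 * x1 \<le> m" "8 * x2 \<le> m" "m \<le> x + (x1 + x2)" for x x1 x2 :: nat
      using that by linarith
    have arith2: "m \<le> 2 * x" if "y' \<le> x + x2" "8 * x2 \<le> m" "3 * m \<le> 4 * y'" for x x2 y' :: nat
      using that by linarith
    have lowA: "m \<le> 2 * p * card (A i)" "3 * m \<le> 4 * p * card (A i)" if "i < p" for i
    proof -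
      have 1: "32 * (p * e) \<le> m" using mult_le_mono1[OF zp, of e] ze by linarith
      have 2: "8 * (p * (p * (s + 1))) \<le> m" using big(2) by simp
      have 3: "m \<le> p * card (A i) + (p * e + p * (p * (s + 1)))" using low[OF that] by (simp only: distrib_left)
      have "m \<le> 2 * (p * card (A i)) \<and> 3 * m \<le> 4 * (p * card (A i))" using 1 2 3
        by (rule arith)
      then show "m \<le> 2 * p * card (A i)" "3 * m \<le> 4 * p * card (A i)" by simp_all
    qed
    have AU: "z * card (A j) \<le> z * card (nbh (A j) E v) + 3 * m" if "i < p" "j < p" "i \<noteq> j" "v \<in> U i" for i j v
    proof -
      have "A j \<subseteq> nbh (A j) E v \<union> (V - A i - nbh V E v)" using A(1)[OF that(2)] A(3)[OF that(1-3)] by (auto simp: nbh_def)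
      then have "card (A j) \<le> card (nbh (A j) E v \<union> (V - A i - nbh V E v))" using finA[OF that(2)] V(1) by (intro card_mono) auto
      also have "\<dots> \<le> card (nbh (A j) E v) + card (V - A i - nbh V E v)" by (rule card_Un_le)
      finally have "z * card (A j) \<le> z * (card (nbh (A j) E v) + card (V - A i - nbh V E v))" by (rule mult_le_mono2)
      then show ?thesis using missU[OF that(1,4)] by (simp add: distrib_left)
    qed
    have zA: "16 * m \<le> z * card (A i)" if "i < p" for i
    proof -
      have "16 * m \<le> 16 * (2 * p * card (A i))" using lowA(1)[OF that] by (rule mult_le_mono2)
      also have "\<dots> = 32 * p * card (A i)" by simp
      also have "\<dots> \<le> z * card (A i)" by (rule mult_le_mono1[OF zp])
      finally show ?thesis .
    qed
    have UU: "U i \<inter> U j = {}" if "i < p" "j < p" "i \<noteq> j" for i j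
    proof (rule ccontr)
      assume "U i \<inter> U j \<noteq> {}"
      then obtain v where v: "v \<in> U i" "v \<in> U j" by auto
      then have "z * card (nbh (A j) E v) < m" by (simp add: U_def)
      then show False using AU[OF that v(1)] zA[OF that(2)] big(7) by linarith
    qed
    have UA: "card (U j \<inter> A i) \<le> 4 * p * s" if "i < p" "j < p" "i \<noteq> j" for i j
    proof (rule few[OF that(1)])
      fix v assume v: "v \<in> U j \<inter> A i"
      have "z * card (A i) \<le> z * card (nbh (A i) E v) + 3 * m" using AU[of j i v] that v by auto
      show "m \<le> 4 * p * card (nbh (A i) E v)"
      proof -
        have "13 * m \<le> z * card (nbh (A i) E v)" using \<open>z * card (A i) \<le> z * card (nbh (A i) E v) + 3 * m\<close> zA[OF that(1)] by linarith
        have "4 * (z * card (A i)) \<le> 5 * (z * card (nbh (A i) E v))" using \<open>13 * m \<le> z * card (nbh (A i) E v)\<close> \<open>z * card (A i) \<le> z * card (nbh (A i) E v) + 3 * m\<close> by linarith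
        then have "z * (4 * card (A i)) \<le> z * (5 * card (nbh (A i) E v))" by simp
        then have "4 * card (A i) \<le> 5 * card (nbh (A i) E v)" by (rule mult_left_le_imp_le) (use z1 in simp)
        then have "p * (4 * card (A i)) \<le> p * (5 * card (nbh (A i) E v))" by (rule mult_le_mono2)
        then show ?thesis using lowA(2)[OF that(1)] by linarith
      qed
    qed auto
    have Umiss: "4 * k * p * card (U j - nbh V E v) \<le> card V" if "i < p" "j < p" "i \<noteq> j" "v \<in> U i" for i j v
    proof -
      have "U j - nbh V E v \<subseteq> (V - A i - nbh V E v) \<union> (U j \<inter> A i)" by (auto simp: U_def)
      then have "card (U j - nbh V E v) \<le> card ((V - A i - nbh V E v) \<union> (U j \<inter> A i))" using V(1) finA[OF that(1)] by (intro card_mono) auto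
      also have "\<dots> \<le> card (V - A i - nbh V E v) + card (U j \<inter> A i)" by (rule card_Un_le)
      finally have "z * card (U j - nbh V E v) \<le> z * (card (V - A i - nbh V E v) + 4 * p * s)"
        using UA[OF that(1-3)] by (intro mult_le_mono2) linarith
      also have "\<dots> \<le> 4 * m" using missU[OF that(1,4)] big(3) by (simp add: distrib_left mult.commute mult.left_commute)
      finally have "8 * (4 * k * p * card (U j - nbh V E v)) \<le> 4 * m" by (simp add: z_def)
      then show ?thesis by (simp add: m_def)
    qed
    have Usize: "card V \<le> 2 * p * card (U i)" if i: "i < p" for i
    proof -
      define B where "B = {v \<in> A i. m \<le> z * card (nbh (A i) E v)}"
      have "A i - B \<subseteq> U i" using A(1)[OF i] by (auto simp: B_def U_def)
      then have "card (A i - B) \<le> card (U i)" using V(1) by (intro card_mono) (auto simp: U_def)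
      moreover have "card (A i) - card B \<le> card (A i - B)" using finA[OF i] by (intro diff_card_le_card_Diff) (simp add: B_def)
      moreover have "card B \<le> z * s" by (rule few[OF i]) (auto simp: B_def)
      ultimately have "card (A i) \<le> card (U i) + z * s" by linarith
      then have "p * card (A i) \<le> p * (card (U i) + z * s)" by (rule mult_le_mono2)
      then have "p * card (A i) \<le> p * card (U i) + p * (z * s)" by (simp add: distrib_left)
      moreover have "8 * (p * (z * s)) \<le> m" using big(2) by simp
      moreover have "3 * m \<le> 4 * (p * card (A i))" using lowA(2)[OF i] by simp
      ultimately have "m \<le> 2 * (p * card (U i))" by (rule arith2)
      then show ?thesis by (simp add: m_def)
    qed
    define W where "W = V - (\<Union>i<p. U i)"
    have cW: "card W \<le> R"
    proof (rule ccontr)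
      assume "\<not> card W \<le> R"
      then have cW: "R \<le> card W" by simp
      have finW: "finite W" using V(1) by (simp add: W_def)
      define At where "At i = {v \<in> A i. y * card (nbh (A i) E v) < m}" for i
      define a where "a = m div (2 * z)"
      have a2: "2 * z * a \<le> m" "m < 2 * z * a + 2 * z"
      proof -
        show "2 * z * a \<le> m" by (simp add: a_def)
        have "m mod (2 * z) < 2 * z" using z1 by simp
        moreover have "m = 2 * z * a + m mod (2 * z)" unfolding a_def by (rule mult_div_mod_eq[symmetric])
        ultimately show "m < 2 * z * a + 2 * z" by linarith
      qed
      have m4: "m \<le> 4 * z * a"
      proof -
        have "2 * z * 1 < 2 * z * a" using a2(2) big(6) z1 by linarith
        then show ?thesis using a2(2) by linarith
      qed
      have AtA: "At i \<subseteq> A i" for i by (auto simp: At_def)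
      have few': "card (A i - At i) \<le> y * s" if "i < p" for i by (rule few[OF that]) (auto simp: At_def)
      have "\<forall>i<p. finite (At i) \<and> card (At i) \<le> 4 * z * a \<and> (\<forall>w\<in>W. a \<le> card (nbh (At i) E w))"
      proof (intro allI impI conjI ballI)
        fix i assume i: "i < p"
        show fAt: "finite (At i)" using finA[OF i] AtA finite_subset by blast
        have "card (At i) \<le> card (A i)" by (rule card_mono[OF finA[OF i] AtA])
        then show "card (At i) \<le> 4 * z * a" using Am[OF i] m4 by linarith
        fix w assume w: "w \<in> W"
        then have "m \<le> z * card (nbh (A i) E w)" using i by (auto simp: W_def U_def not_less)
        moreover have "nbh (A i) E w \<subseteq> nbh (At i) E w \<union> (A i - At i)" by (auto simp: nbh_def)
        then have "card (nbh (A i) E w) \<le> card (nbh (At i) E w \<union> (A i - At i))" using finA[OF i] fAt by (intro card_mono) auto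
        then have "card (nbh (A i) E w) \<le> card (nbh (At i) E w) + y * s" using few'[OF i] card_Un_le[of "nbh (At i) E w" "A i - At i"] by linarith
        then have "z * card (nbh (A i) E w) \<le> z * (card (nbh (At i) E w) + y * s)" by (rule mult_le_mono2)
        ultimately have "m \<le> z * card (nbh (At i) E w) + z * (y * s)" by (simp add: distrib_left)
        moreover have "2 * (z * (y * s)) \<le> m" using big(4) by simp
        ultimately have "2 * z * a \<le> 2 * z * card (nbh (At i) E w)" using a2(1) by linarith
        then show "a \<le> card (nbh (At i) E w)" by (rule mult_left_le_imp_le) (use z1 in simp)
      qed
      then have "\<exists>W'\<subseteq>W. k \<le> card W' \<and> (\<forall>i<p. a \<le> \<alpha> * card {x \<in> At i. \<forall>w\<in>W'. E w x})"
        by (intro R(3)[THEN spec[of _ W], THEN spec[of _ At], THEN spec[of _ E], THEN spec[of _ a],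
              THEN mp, THEN mp, THEN mp, THEN mp, OF finW V(2) cW])
      then obtain W' where W': "W' \<subseteq> W" "k \<le> card W'" "\<forall>i<p. a \<le> \<alpha> * card {x \<in> At i. \<forall>w\<in>W'. E w x}"
        by (elim exE conjE) (rule that)
      \<comment> \<open>The first \<open>p\<close> classes are common neighbourhoods of
        \<open>W'\<close>, and the last one is \<open>W'\<close> itself, completely joined to all of
        them.\<close>
      define C where "C i = (if i < p then {x \<in> At i. \<forall>w\<in>W'. E w x} else W')" for i
      define \<mu> where "\<mu> i = (if i < p then 3 * m div y else 0)" for i
      have "has_power p k (\<Union>i<p+1. C i) E"
      proof (rule richsys_Suc_has_power[OF V(2)])
        show "richsys E (p + 1) k C C"
        proof (rule richsys_of_misses[where \<mu> = \<mu>])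
          fix i assume i: "i < p + 1"
          show "finite (C i)" using i finA finite_subset[OF AtA] finW finite_subset[OF W'(1)] by (auto simp: C_def)
          show "k * \<mu> i + k \<le> card (C i)"
          proof (cases "i < p")
            case True
            have "y * (3 * m div y) \<le> 3 * m" by simp
            moreover have "y * (3 * m div y) = 24 * (z * \<alpha> * k * (3 * m div y))" unfolding y_def by (simp only: mult.assoc)
            ultimately have "8 * (z * \<alpha> * k * (3 * m div y)) \<le> m" by linarith
            moreover have "2 * z * (\<alpha> * (k * (3 * m div y) + k)) = 2 * (z * \<alpha> * k * (3 * m div y)) + 2 * (z * \<alpha> * k)"
              by (simp add: distrib_left mult.assoc)
            ultimately have "2 * z * (\<alpha> * (k * (3 * m div y) + k)) \<le> 2 * z * a" using big(5,6) a2(2) by linarith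
            then have "\<alpha> * (k * (3 * m div y) + k) \<le> a" by (rule mult_left_le_imp_le) (use z1 in simp)
            also have "a \<le> \<alpha> * card (C i)" using W'(3) True by (simp add: C_def)
            finally have "k * (3 * m div y) + k \<le> card (C i)" by (rule mult_left_le_imp_le) (use R(1) in simp)
            then show ?thesis using True by (simp add: \<mu>_def)
          next
            case False then show ?thesis using W'(2) by (simp add: \<mu>_def C_def)
          qed
        next
          fix i j assume ij: "i < p + 1" "j < p + 1" "i \<noteq> j"
          have CW: "C l \<inter> W' = {}" if "l < p" for l
            using that graph_relD(2)[OF V(2)] by (auto simp: C_def)
          consider "i < p" "j < p" | "i < p" "j = p" | "i = p" "j < p" using ij by linarith
          then show "C i \<inter> C j = {}"
          proof cases
            case 1 then show ?thesis using A(3)[of i j] AtA ij(3) unfolding C_def by fastforce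
          next
            case 2 then show ?thesis using CW[of i] by (simp add: C_def)
          next
            case 3 then show ?thesis using CW[of j] by (auto simp: C_def)
          qed
        next
          fix i j x assume ij: "i < p + 1" "j < p + 1" "i \<noteq> j" and x: "x \<in> C j"
          consider "i < p" "j < p" | "i < p" "j = p" | "i = p" "j < p" using ij by linarith
          then show "card (C i - nbh (C i) E x) \<le> \<mu> i"
          proof cases
            case 1
            then have xA: "x \<in> A j" "x \<in> V" "y * card (nbh (A j) E x) < m" using x A(1)[of j] by (auto simp: C_def At_def)
            have "C i - nbh (C i) E x \<subseteq> V - A j - nbh V E x"
              using 1 A(1)[of i] A(3)[of i j] ij(3) by (auto simp: C_def At_def nbh_def)
            then have "card (C i - nbh (C i) E x) \<le> card (V - A j - nbh V E x)" using V(1) by (intro card_mono) auto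
            also have "\<dots> \<le> card (nbh (A j) E x) + e + c1" by (rule miss[OF 1(2) xA(2)])
            finally have "y * card (C i - nbh (C i) E x) \<le> y * (card (nbh (A j) E x) + e + c1)" by (rule mult_le_mono2)
            also have "\<dots> \<le> 3 * m" using xA(3) ye big(1) by (simp add: distrib_left)
            finally have "card (C i - nbh (C i) E x) \<le> 3 * m div y" using y1 by (simp add: less_eq_div_iff_mult_less_eq mult.commute)
            then show ?thesis using 1 by (simp add: \<mu>_def)
          next
            case 2
            then have e: "C i - nbh (C i) E x = {}" using x by (auto simp: C_def nbh_def)
            show ?thesis unfolding e by simp
          next
            case 3
            then have e: "C i - nbh (C i) E x = {}" using x graph_relD(1)[OF V(2)] by (auto simp: C_def nbh_def)
            show ?thesis unfolding e by simp
          qed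
        qed simp
      qed
      moreover have "(\<Union>i<p+1. C i) \<subseteq> V"
      proof (rule UN_least)
        fix i assume "i \<in> {..<p+1}"
        show "C i \<subseteq> V"
        proof (cases "i < p")
          case True
          then have "C i \<subseteq> A i" using AtA by (auto simp: C_def)
          then show ?thesis using A(1)[OF True] by (rule subset_trans)
        next
          case False
          then have "C i = W'" by (simp add: C_def)
          then show ?thesis using W'(1) by (auto simp: W_def)
        qed
      qed
      ultimately show False using V(4) has_power_mono[of p k _ E V k] by blast
    qed
    show "\<exists>U. (\<forall>i<p. U i \<subseteq> V \<and> card V \<le> 2 * p * card (U i)) \<and> (\<forall>i<p. \<forall>j<p. i \<noteq> j \<longrightarrow> U i \<inter> U j = {}) \<and>
       card (V - (\<Union>i<p. U i)) \<le> R \<and>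
       (\<forall>i<p. \<forall>j<p. i \<noteq> j \<longrightarrow> (\<forall>v\<in>U i. 4 * k * p * card (U j - nbh V E v) \<le> card V))"
      using Usize UU cW Umiss unfolding W_def
      by (intro exI[of _ U] conjI allI impI ballI) (auto simp: U_def)
  qed
qed

subsection \<open>The exact structure\<close>

definition matching :: "'a set \<Rightarrow> ('a \<Rightarrow> 'a \<Rightarrow> bool) \<Rightarrow> nat \<Rightarrow> (nat \<Rightarrow> 'a) \<Rightarrow> (nat \<Rightarrow> 'a) \<Rightarrow> bool" where
  "matching L E K a a' \<longleftrightarrow> (\<forall>n<K. a n \<in> L \<and> a' n \<in> L \<and> E (a n) (a' n)) \<and>
     inj_on a {..<K} \<and> inj_on a' {..<K} \<and> a ` {..<K} \<inter> a' ` {..<K} = {}"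

text \<open>Greedy extension: if no edge avoids the vertices of the matching found so far, these
  vertices meet all edges.\<close>

lemma matching_or_cover:
  assumes "graph_rel E"
  shows "(\<exists>a a'. matching L E K a a') \<or> (\<exists>X\<subseteq>L. card X \<le> 2 * K \<and> (\<forall>x\<in>L - X. \<forall>y\<in>L - X. \<not> E x y))"
proof (induction K)
  case 0
  have "matching L E 0 a a'" for a a' by (simp add: matching_def)
  then show ?case by blast
next
  case (Suc K)
  then show ?case
  proof
    assume "\<exists>X\<subseteq>L. card X \<le> 2 * K \<and> (\<forall>x\<in>L - X. \<forall>y\<in>L - X. \<not> E x y)"
    then obtain X where "X \<subseteq> L" "card X \<le> 2 * K" "\<forall>x\<in>L - X. \<forall>y\<in>L - X. \<not> E x y" by blast
    then show ?thesis by (intro disjI2 exI[of _ X]) simp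
  next
    assume "\<exists>a a'. matching L E K a a'"
    then obtain a a' where a: "matching L E K a a'" by blast
    define X where "X = a ` {..<K} \<union> a' ` {..<K}"
    have "card X \<le> card (a ` {..<K}) + card (a' ` {..<K})" unfolding X_def by (rule card_Un_le)
    also have "\<dots> \<le> K + K" using card_image_le[of "{..<K}" a] card_image_le[of "{..<K}" a'] by simp
    finally have X: "card X \<le> 2 * Suc K" "X \<subseteq> L" using a by (auto simp: X_def matching_def)
    show ?thesis
    proof (cases "\<forall>x\<in>L - X. \<forall>y\<in>L - X. \<not> E x y")
      case True then show ?thesis using X by blast
    next
      case False
      then obtain x y where xy: "x \<in> L" "y \<in> L" "x \<notin> X" "y \<notin> X" "E x y" by blast
      have "x \<noteq> y" using xy(5) graph_relD(2)[OF assms] by auto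
      moreover have "x \<notin> a ` {..<K}" "y \<notin> a ` {..<K}" "x \<notin> a' ` {..<K}" "y \<notin> a' ` {..<K}"
        using xy by (auto simp: X_def)
      moreover have im: "(a(K := x)) ` {..<Suc K} = insert x (a ` {..<K})" "(a'(K := y)) ` {..<Suc K} = insert y (a' ` {..<K})"
        by (auto simp: lessThan_Suc)
      moreover have "inj_on (a(K := x)) {..<Suc K}" "inj_on (a'(K := y)) {..<Suc K}"
        using a calculation by (auto simp: matching_def inj_on_def less_Suc_eq image_iff)
      ultimately have "matching L E (Suc K) (a(K := x)) (a'(K := y))"
        using a xy unfolding matching_def im by (auto simp: less_Suc_eq)
      then show ?thesis by blast
    qed
  qed
qed

lemma obtain_injective_choice:
  fixes K k :: nat
  assumes "card {n. n < K \<and> P n} + k \<le> K"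
  obtains g where "inj_on g {..<k}" "\<And>n. n < k \<Longrightarrow> g n < K \<and> \<not> P (g n)"
proof -
  have "{..<K} = {n. n < K \<and> P n} \<union> {n. n < K \<and> \<not> P n}" by auto
  then have "K \<le> card {n. n < K \<and> P n} + card {n. n < K \<and> \<not> P n}" using card_Un_le by (metis card_lessThan)
  then have "k \<le> card {n. n < K \<and> \<not> P n}" using assms by linarith
  then obtain S where S: "S \<subseteq> {n. n < K \<and> \<not> P n}" "card S = k" by (rule obtain_subset_with_card_n) (rule that)
  have "finite S" by (rule finite_subset[OF S(1)]) simp
  then obtain g where "bij_betw g {0..<k} S" using ex_bij_betw_nat_finite S(2) by blast
  then have "inj_on g {..<k}" "g ` {..<k} = S" by (auto simp: bij_betw_def atLeast0LessThan)
  then show thesis using S(1) by (intro that[of g]) auto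
qed

text \<open>Keep \<open>k\<close> edges of the first matching. Their at most \<open>2 * k\<close>
  ends miss at most \<open>2 * k * d\<close> vertices of \<open>U c'\<close>, which spoil at most
  \<open>2 * k * d\<close> edges through \<open>b\<close> and as many through \<open>b'\<close>; so
  \<open>k\<close> edges of the second matching remain that are completely joined to the chosen
  ones.\<close>

lemma two_matchings_has_power:
  assumes V: "finite V" "graph_rel E" "\<And>i. i < p \<Longrightarrow> U i \<subseteq> V" and rs: "richsys E p k U U" and p: "2 \<le> p"
    and c: "c < p" "c' < p" "c \<noteq> c'" and L: "L \<subseteq> U c" "L' \<subseteq> U c'"
    and d: "\<And>v. v \<in> L \<Longrightarrow> card (U c' - nbh V E v) \<le> d"
    and K: "4 * k * d + k \<le> K" and a: "matching L E K a a'" and b: "matching L' E K b b'"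
  shows "has_power p k (\<Union>i<p. U i) E"
proof -
  have kK: "k \<le> K" using K by linarith
  have kK': "{..<k} \<subseteq> {..<K}" using kK by auto
  have aL: "a n \<in> L" "a' n \<in> L" "E (a n) (a' n)" if "n < k" for n using a that kK by (auto simp: matching_def)
  define Q where "Q = a ` {..<k} \<union> a' ` {..<k}"
  define Z where "Z = (\<Union>v\<in>Q. U c' - nbh V E v)"
  have finU: "finite (U c')" by (rule finite_subset[OF V(3)[OF c(2)] V(1)])
  have cQ: "card Q \<le> 2 * k"
  proof -
    have "card Q \<le> card (a ` {..<k}) + card (a' ` {..<k})" unfolding Q_def by (rule card_Un_le)
    also have "\<dots> \<le> k + k" using card_image_le[of "{..<k}" a] card_image_le[of "{..<k}" a'] by simp
    finally show ?thesis by simp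
  qed
  have finZ: "finite Z" using finU by (simp add: Z_def Q_def)
  have cZ: "card Z \<le> 2 * k * d"
  proof -
    have "card Z \<le> (\<Sum>v\<in>Q. card (U c' - nbh V E v))" unfolding Z_def by (rule card_UN_le) (simp add: Q_def)
    also have "\<dots> \<le> card Q * d" using sum_bounded_above[of Q "\<lambda>v. card (U c' - nbh V E v)" d] d aL by (auto simp: Q_def)
    also have "\<dots> \<le> 2 * k * d" using cQ by (rule mult_le_mono1)
    finally show ?thesis .
  qed
  have hit: "card {n. n < K \<and> f n \<in> Z} \<le> 2 * k * d" if "inj_on f {..<K}" for f
  proof -
    have "inj_on f {n. n < K \<and> f n \<in> Z}" using that by (rule inj_on_subset) auto
    then have "card {n. n < K \<and> f n \<in> Z} = card (f ` {n. n < K \<and> f n \<in> Z})" by (simp add: card_image)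
    also have "\<dots> \<le> card Z" by (rule card_mono[OF finZ]) auto
    finally show ?thesis using cZ by linarith
  qed
  have "{n. n < K \<and> (b n \<in> Z \<or> b' n \<in> Z)} = {n. n < K \<and> b n \<in> Z} \<union> {n. n < K \<and> b' n \<in> Z}" by auto
  then have "card {n. n < K \<and> (b n \<in> Z \<or> b' n \<in> Z)} \<le> card {n. n < K \<and> b n \<in> Z} + card {n. n < K \<and> b' n \<in> Z}"
    using card_Un_le[of "{n. n < K \<and> b n \<in> Z}" "{n. n < K \<and> b' n \<in> Z}"] by (simp only:)
  moreover have "card {n. n < K \<and> b n \<in> Z} \<le> 2 * k * d" "card {n. n < K \<and> b' n \<in> Z} \<le> 2 * k * d"
    using b by (intro hit; simp add: matching_def)+
  ultimately have "card {n. n < K \<and> (b n \<in> Z \<or> b' n \<in> Z)} + k \<le> K" using K by linarith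
  then obtain g where g: "inj_on g {..<k}" "\<And>n. n < k \<Longrightarrow> g n < K \<and> \<not> (b (g n) \<in> Z \<or> b' (g n) \<in> Z)"
    by (rule obtain_injective_choice) (rule that; assumption)
  have gK: "g ` {..<k} \<subseteq> {..<K}" using g(2) by auto
  have bL: "b (g n) \<in> L'" "b' (g n) \<in> L'" "E (b (g n)) (b' (g n))" if "n < k" for n
    using b g(2)[OF that] by (auto simp: matching_def)
  have cross: "E v w" if "v \<in> Q" "w \<in> L'" "w \<notin> Z" for v w
    using that L(2) by (auto simp: Z_def nbh_def)
  have ia: "inj_on a {..<K}" "inj_on a' {..<K}" "a ` {..<K} \<inter> a' ` {..<K} = {}" using a by (auto simp: matching_def)
  have inj: "inj_on a {..<k}" "inj_on a' {..<k}" "a ` {..<k} \<inter> a' ` {..<k} = {}"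
    using inj_on_subset[OF ia(1) kK'] inj_on_subset[OF ia(2) kK'] ia(3) image_mono[OF kK', of a] image_mono[OF kK', of a']
    by blast+
  have ib: "inj_on b {..<K}" "inj_on b' {..<K}" "b ` {..<K} \<inter> b' ` {..<K} = {}" using b by (auto simp: matching_def)
  have inj': "inj_on (b \<circ> g) {..<k}" "inj_on (b' \<circ> g) {..<k}"
    by (intro comp_inj_on g(1) inj_on_subset[OF ib(1) gK] inj_on_subset[OF ib(2) gK])+
  have dis: "(b \<circ> g) ` {..<k} \<inter> (b' \<circ> g) ` {..<k} = {}" using ib(3) gK unfolding image_comp[symmetric] by blast
  show ?thesis
  proof (rule richsys_edges_has_power[OF V(2) rs p c _ _ inj inj' dis])
    fix n assume n: "n < k"
    show "a n \<in> U c \<and> a' n \<in> U c \<and> E (a n) (a' n)" using aL[OF n] L(1) by blast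
    show "(b \<circ> g) n \<in> U c' \<and> (b' \<circ> g) n \<in> U c' \<and> E ((b \<circ> g) n) ((b' \<circ> g) n)" using bL[OF n] L(2) by auto
  next
    fix m n assume mn: "m < k" "n < k"
    have "a m \<in> Q" "a' m \<in> Q" using mn(1) by (auto simp: Q_def)
    then show "E (a m) ((b \<circ> g) n) \<and> E (a m) ((b' \<circ> g) n) \<and> E (a' m) ((b \<circ> g) n) \<and> E (a' m) ((b' \<circ> g) n)"
      using bL[OF mn(2)] g(2)[OF mn(2)] cross by auto
  qed
qed

section \<open>Symmetrising all classes but one, and the contradiction\<close>

lemma gpath_cong:
  assumes "\<And>u v. u \<in> U \<Longrightarrow> v \<in> U \<Longrightarrow> E u v \<longleftrightarrow> E' u v"
  shows "gpath U E xs \<longleftrightarrow> gpath U E' xs"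
proof -
  have "successively E xs \<longleftrightarrow> successively E' xs" if "set xs \<subseteq> U"
    using that assms by (intro successively_cong) auto
  then show ?thesis by (auto simp: gpath_def)
qed

text \<open>One class after the other. Adjacencies inside a class not yet treated are unchanged, so
  its paths are still short and its set \<open>Y i\<close> is still independent; twins made earlier
  lie outside the current class and survive. The intermediate graphs are extremal, so
  \<open>md\<close> supplies their minimum degree.\<close>

lemma symmetrise_classes:
  fixes V :: "nat set"
  assumes I: "finite I" and ex: "extremal p k V E" and k: "1 \<le> k" and p: "1 \<le> p"
    and UV: "\<And>i. i \<in> I \<Longrightarrow> U i \<subseteq> V" "\<And>i. i \<in> I \<Longrightarrow> Y i \<subseteq> U i"
    and disj: "\<And>i j. i \<in> I \<Longrightarrow> j \<in> I \<Longrightarrow> i \<noteq> j \<Longrightarrow> U i \<inter> U j = {}"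
    and md: "\<And>E' v. extremal p k V E' \<Longrightarrow> v \<in> V \<Longrightarrow> (p - 1) * (card V - 1) \<le> p * card (nbh V E' v)"
    and size: "\<And>i. i \<in> I \<Longrightarrow> card V \<le> p * card (U i) + c"
    and path: "\<And>i xs. i \<in> I \<Longrightarrow> gpath (U i) E xs \<Longrightarrow> length xs < s"
    and ind: "\<And>i x y. i \<in> I \<Longrightarrow> x \<in> Y i \<Longrightarrow> y \<in> Y i \<Longrightarrow> \<not> E x y"
    and D: "D = s + 2 ^ s * rich_bound k (c + s + 1)"
  shows "\<exists>E' T. extremal p k V E' \<and>
    (\<forall>i\<in>I. T i \<subseteq> Y i \<and> card (Y i) \<le> card (T i) + (D * card (U i - Y i) + D) \<and> twins V E' (T i)) \<and>
    (\<forall>u v. u \<notin> (\<Union>i\<in>I. U i) \<longrightarrow> v \<notin> (\<Union>i\<in>I. U i) \<longrightarrow> E' u v = E u v)"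
  using I UV disj size path ind
proof (induction I rule: finite_induct)
  case empty
  then show ?case using ex by (intro exI[of _ E] exI[of _ undefined]) simp
next
  case (insert j I)
  have "\<exists>E1 T1. extremal p k V E1 \<and>
    (\<forall>i\<in>I. T1 i \<subseteq> Y i \<and> card (Y i) \<le> card (T1 i) + (D * card (U i - Y i) + D) \<and> twins V E1 (T1 i)) \<and>
    (\<forall>u v. u \<notin> (\<Union>i\<in>I. U i) \<longrightarrow> v \<notin> (\<Union>i\<in>I. U i) \<longrightarrow> E1 u v = E u v)"
  proof (rule insert.IH)
    show "length xs < s" if "i \<in> I" "gpath (U i) E xs" for i xs using insert.prems(5)[OF insertI2[OF that(1)] that(2)] .
    show "\<not> E x y" if "i \<in> I" "x \<in> Y i" "y \<in> Y i" for i x y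
      using insert.prems(6)[OF insertI2[OF that(1)] that(2,3)] .
  qed (simp_all add: insert.prems(1-4))
  then obtain E1 T1 where E1: "extremal p k V E1"
    "\<forall>i\<in>I. T1 i \<subseteq> Y i \<and> card (Y i) \<le> card (T1 i) + (D * card (U i - Y i) + D) \<and> twins V E1 (T1 i)"
    "\<forall>u v. u \<notin> (\<Union>i\<in>I. U i) \<longrightarrow> v \<notin> (\<Union>i\<in>I. U i) \<longrightarrow> E1 u v = E u v" by (elim exE conjE) (rule that)
  have dj: "U j \<inter> U i = {}" if "i \<in> I" for i using insert.prems(3)[of j i] that insert.hyps(2) by auto
  then have jI: "u \<notin> (\<Union>i\<in>I. U i)" if "u \<in> U j" for u using that by blast
  have same: "E1 u v \<longleftrightarrow> E u v" if "u \<in> U j" "v \<in> U j" for u v using E1(3) jI that by blast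
  have YU: "Y j \<subseteq> U j" using insert.prems(2) by simp
  have "\<exists>E' T. extremal p k V E' \<and> T \<subseteq> Y j \<and> card (Y j) \<le> card T + (D * card (U j - Y j) + D) \<and> twins V E' T \<and>
    (\<forall>u v. u \<notin> U j \<longrightarrow> v \<notin> U j \<longrightarrow> E' u v = E1 u v) \<and> (\<forall>A. A \<inter> U j = {} \<longrightarrow> twins V E1 A \<longrightarrow> twins V E' A)"
  proof (rule symmetrise_class[OF E1(1) k _ YU _ p _ _ _ D])
    show "U j \<subseteq> V" "card V \<le> p * card (U j) + c" using insert.prems(1,4) by simp_all
    show "(p - 1) * (card V - 1) \<le> p * card (nbh V E1 v)" if "v \<in> V" for v by (rule md[OF E1(1) that])
    show "length xs < s" if "gpath (U j) E1 xs" for xs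
      using that insert.prems(5)[of j xs] gpath_cong[of "U j" E1 E xs, OF same] by simp
    show "\<not> E1 x y" if "x \<in> Y j" "y \<in> Y j" for x y
      using insert.prems(6)[of j x y] same[of x y] that YU by auto
  qed
  then obtain E' T where E': "extremal p k V E'" "T \<subseteq> Y j" "card (Y j) \<le> card T + (D * card (U j - Y j) + D)"
    "twins V E' T" "\<forall>u v. u \<notin> U j \<longrightarrow> v \<notin> U j \<longrightarrow> E' u v = E1 u v" "\<forall>A. A \<inter> U j = {} \<longrightarrow> twins V E1 A \<longrightarrow> twins V E' A"
    by (elim exE conjE) (rule that)
  show ?case
  proof (rule exI[of _ E'], rule exI[of _ "T1(j := T)"], intro conjI ballI allI impI E'(1))
    fix i assume i: "i \<in> insert j I"
    show "(T1(j := T)) i \<subseteq> Y i" using i E'(2) E1(2) by auto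
    show "card (Y i) \<le> card ((T1(j := T)) i) + (D * card (U i - Y i) + D)" using i E'(3) E1(2) by auto
    show "twins V E' ((T1(j := T)) i)"
    proof (cases "i = j")
      case False
      then have iI: "i \<in> I" using i by simp
      have "T1 i \<subseteq> U i" using E1(2) iI insert.prems(2)[of i] by auto
      then have "T1 i \<inter> U j = {}" using dj[OF iI] by blast
      then show ?thesis using E'(6) E1(2) iI False by auto
    qed (use E'(4) in simp)
  next
    fix u v assume "u \<notin> (\<Union>i\<in>insert j I. U i)" "v \<notin> (\<Union>i\<in>insert j I. U i)"
    then show "E' u v = E u v" using E'(5) E1(3) by simp
  qed
qed

lemma half_add_less:
  fixes m x y z :: nat
  assumes "2 * x \<le> m" "2 * (y + z) < m"
  shows "x + y + z < m"
  using assms by simp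

text \<open>In all classes but one, the vertices of bounded inner degree have no large matching, so
  after removing boundedly many of them they are independent and can be symmetrised. The vertices of
  high inner degree are only known to be a share \<open>1 / N\<close> of all; hence the loss
  \<delta> in the twin classes is linear in the number of vertices, and \<open>N\<close> must make
  its slope small.\<close>

lemma extremal_core:
  assumes p: "2 \<le> p" and q: "1 \<le> q" and b: "b \<le> 1" and k: "k + 1 = q * (p + 1) + p + b" and s: "s = 2 * q + b"
  shows "\<exists>M. \<forall>V E. M \<le> card V \<longrightarrow> extremal p k (V :: nat set) E \<longrightarrow> join_opt p s (card V) < exn p k (card V) \<longrightarrow>
    (\<forall>E' v. extremal p k V E' \<longrightarrow> v \<in> V \<longrightarrow> (p - 1) * (card V - 1) \<le> p * card (nbh V E' v)) \<longrightarrow> False"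
proof -
  have k1: "1 \<le> k" using k p by linarith
  have p1: "1 \<le> p" using p by simp
  have s1: "1 \<le> s" using s q by simp
  obtain R M0 where R: "\<forall>V E. finite V \<longrightarrow> graph_rel E \<longrightarrow> min_deg p V E \<longrightarrow> \<not> has_power p k V E \<longrightarrow> M0 \<le> card (V :: nat set) \<longrightarrow>
    (\<exists>U. (\<forall>i<p. U i \<subseteq> V \<and> card V \<le> 2 * p * card (U i)) \<and> (\<forall>i<p. \<forall>j<p. i \<noteq> j \<longrightarrow> U i \<inter> U j = {}) \<and>
       card (V - (\<Union>i<p. U i)) \<le> R \<and>
       (\<forall>i<p. \<forall>j<p. i \<noteq> j \<longrightarrow> (\<forall>v\<in>U i. 4 * k * p * card (U j - nbh V E v) \<le> card V)))"
    using exists_partition[OF assms, where 'a = nat] by (elim exE) (rule that)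
  define e where "e = R + p * (s + 1)"
  define c where "c = p * e"
  define D where "D = s + 2 ^ s * rich_bound k (c + s + 1)"
  \<comment> \<open>\<open>w\<close> is the total coefficient of \<delta> in the size condition of
    \<open>twin_classes_contradiction\<close>, and \<open>c0\<close> collects its other terms. The
    part of \<delta> that grows with \<open>m\<close> is \<open>p * ((D + 1) * (m div N))\<close>;
    the choice of \<open>N\<close> makes \<open>w\<close> times this at most
    \<open>m / 2\<close>.\<close>
  define w where "w = p * s + k + 2"
  define N where "N = 2 * w * p * (D + 1)"
  \<comment> \<open>\<open>d\<close> bounds the non-neighbours of a vertex of \<open>L i\<close> in
    another class, and \<open>K\<close> is the size of matchings that
    \<open>two_matchings_has_power\<close> requires for this \<open>d\<close>.\<close>
  define d where "d = N * s + e + 1"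
  define K where "K = 4 * k * d + k"
  define c2 where "c2 = p * ((D + 1) * (2 * K) + D) + c"
  define c0 where "c0 = p * p + p * s * p + p * s * s + 2 * k * p + p"
  define M where "M = M0 + 4 * k * p + 2 * (w * c2 + c0) + 1"
  have N1: "1 \<le> N" using p by (simp add: N_def w_def)
  show ?thesis
  proof (rule exI[of _ M], intro allI impI)
    fix V :: "nat set" and E assume M: "M \<le> card V" and ex: "extremal p k V E"
      and less: "join_opt p s (card V) < exn p k (card V)"
      and md0: "\<forall>E' v. extremal p k V E' \<longrightarrow> v \<in> V \<longrightarrow> (p - 1) * (card V - 1) \<le> p * card (nbh V E' v)"
    have md: "\<And>E' v. extremal p k V E' \<Longrightarrow> v \<in> V \<Longrightarrow> (p - 1) * (card V - 1) \<le> p * card (nbh V E' v)" using md0 by blast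
    have V: "finite V" "graph_rel E" "\<not> has_power p k V E" using ex by (auto simp: extremal_def)
    have mdE: "min_deg p V E" using md[OF ex] by (simp add: min_deg_def)
    define m where "m = card V"
    have big: "M0 \<le> card V" "4 * k * p \<le> m" "2 * (w * c2 + c0) < m" using M by (auto simp: M_def m_def)
    from R[rule_format, OF V(1,2) mdE V(3) big(1)] obtain U where
      U0: "(\<forall>i<p. U i \<subseteq> V \<and> card V \<le> 2 * p * card (U i)) \<and> (\<forall>i<p. \<forall>j<p. i \<noteq> j \<longrightarrow> U i \<inter> U j = {}) \<and>
       card (V - (\<Union>i<p. U i)) \<le> R \<and>
       (\<forall>i<p. \<forall>j<p. i \<noteq> j \<longrightarrow> (\<forall>v\<in>U i. 4 * k * p * card (U j - nbh V E v) \<le> card V))" by (elim exE) (rule that)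
    have U: "\<And>i. i < p \<Longrightarrow> U i \<subseteq> V" "\<And>i. i < p \<Longrightarrow> m \<le> 2 * p * card (U i)"
      "\<And>i j. i < p \<Longrightarrow> j < p \<Longrightarrow> i \<noteq> j \<Longrightarrow> U i \<inter> U j = {}" "card (V - (\<Union>i<p. U i)) \<le> R"
      "\<And>i j v. i < p \<Longrightarrow> j < p \<Longrightarrow> i \<noteq> j \<Longrightarrow> v \<in> U i \<Longrightarrow> 4 * k * p * card (U j - nbh V E v) \<le> m"
      using U0 unfolding m_def by simp_all
    have finU: "finite (U i)" if "i < p" for i by (rule finite_subset[OF U(1)[OF that] V(1)])
    have Um: "card (U i) \<le> m" if "i < p" for i unfolding m_def by (rule card_mono[OF V(1) U(1)[OF that]])
    have rs: "richsys E p k U U"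
    proof (rule richsys_of_misses[where \<mu> = "\<lambda>_. m div (4 * k * p)"])
      fix i assume i: "i < p"
      show "finite (U i)" by (rule finU[OF i])
      have "4 * k * p * (m div (4 * k * p)) \<le> m" by simp
      then have "4 * p * (k * (m div (4 * k * p))) \<le> m" by (simp only: mult.assoc mult.commute mult.left_commute)
      then have "4 * p * (k * (m div (4 * k * p)) + k) \<le> m + m" using big(2)
        by (simp add: distrib_left mult.assoc mult.commute mult.left_commute)
      also have "\<dots> \<le> 4 * p * card (U i)" using U(2)[OF i] by simp
      finally show "k * (m div (4 * k * p)) + k \<le> card (U i)" by (rule mult_left_le_imp_le) (use p in simp)
    next
      fix i j v assume ij: "i < p" "j < p" "i \<noteq> j" and v: "v \<in> U j"
      have "U i - nbh (U i) E v = U i - nbh V E v" using U(1)[OF ij(1)] by (auto simp: nbh_def)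
      moreover have "4 * k * p * card (U i - nbh V E v) \<le> m" by (rule U(5)[OF ij(2,1) _ v]) (use ij in simp)
      ultimately show "card (U i - nbh (U i) E v) \<le> m div (4 * k * p)" using k1 p1
        by (simp add: less_eq_div_iff_mult_less_eq mult.commute mult.left_commute)
    next
      show "U i \<inter> U j = {}" if "i < p" "j < p" "i \<noteq> j" for i j by (rule U(3)[OF that])
    qed simp
    have UV: "(\<Union>i<p. U i) \<subseteq> V" using U(1) by auto
    have noU: "\<not> has_power p k (\<Union>i<p. U i) E" using V(3) has_power_mono[of p k _ E V k] UV by blast
    have path: "length xs < s" if "i < p" "gpath (U i) E xs" for i xs
    proof (rule ccontr)
      assume "\<not> length xs < s"
      then have "length (take s xs) = 2 * q + b" using s by simp
      then show False using richsys_path_has_power[OF V(2) rs p that(1) b k gpath_take[OF that(2)]] noU by blast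
    qed
    have size: "m \<le> p * card (U i) + c" if "i < p" for i
    proof -
      have "m \<le> p * card (U i) + p * (card (V - (\<Union>j<p. U j)) + p * (s + 1))"
        unfolding m_def by (rule class_size_lower[OF V(1,2) mdE p1 U(1) path U(3) that])
      moreover have "p * (card (V - (\<Union>j<p. U j)) + p * (s + 1)) \<le> c"
        unfolding c_def e_def using U(4) by (intro mult_le_mono2) simp
      ultimately show ?thesis by linarith
    qed
    \<comment> \<open>Only vertices of bounded degree inside their class have boundedly many
      non-neighbours in the other classes, as is needed to combine two matchings.\<close>
    define L where "L i = {v \<in> U i. card (nbh (U i) E v) < N * s}" for i
    have LU: "L i \<subseteq> U i" for i by (auto simp: L_def)
    have high: "card (U i - L i) \<le> m div N" if i: "i < p" for i
    proof -
      have "card (U i - L i) * (N * s) \<le> 1 * (card (U i) * s)"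
        by (rule card_large_degree[OF finU[OF i] V(2) path[OF i]]) (auto simp: L_def)
      then have "s * (card (U i - L i) * N) \<le> s * card (U i)" by (simp add: mult.commute mult.left_commute)
      then have "card (U i - L i) * N \<le> card (U i)" by (rule mult_left_le_imp_le) (use s1 in simp)
      then have "card (U i - L i) * N \<le> m" using Um[OF i] by linarith
      then show ?thesis using N1 by (simp add: less_eq_div_iff_mult_less_eq)
    qed
    have miss: "card (U j - nbh V E v) \<le> d" if ij: "i < p" "j < p" "i \<noteq> j" and v: "v \<in> L i" for i j v
    proof -
      have vU: "v \<in> U i" "card (nbh (U i) E v) < N * s" using v by (auto simp: L_def)
      have "card (U j - nbh V E v) \<le> card (V - U i - nbh V E v)"
        using V(1) U(1)[OF ij(2)] U(3)[OF ij] by (intro card_mono) auto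
      also have "\<dots> \<le> card (nbh (U i) E v) + e + 1"
        using U(1)[OF ij(1)] vU(1) size[OF ij(1)] by (intro class_miss[OF V(1) mdE p1 U(1)[OF ij(1)]]) (auto simp: m_def c_def)
      finally show ?thesis using vU(2) by (simp add: d_def)
    qed
    \<comment> \<open>Large matchings in two classes would yield the power, so at most one class has
      one. The class found here is left unsymmetrised.\<close>
    have "\<exists>c0<p. \<forall>i<p. i \<noteq> c0 \<longrightarrow> \<not> (\<exists>a a'. matching (L i) E K a a')"
    proof (rule ccontr)
      assume neg: "\<not> ?thesis"
      then obtain i a a' where i: "i < p" "matching (L i) E K a a'" using p by (meson less_le_trans zero_less_numeral)
      then obtain j b b' where j: "j < p" "j \<noteq> i" "matching (L j) E K b b'" using neg by blast
      have "has_power p k (\<Union>i<p. U i) E"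
        by (rule two_matchings_has_power[OF V(1,2) U(1) rs p i(1) j(1) j(2)[symmetric] LU LU miss _ i(2) j(3)])
           (use i(1) j(1,2) in \<open>auto simp: K_def\<close>)
      then show False using noU by blast
    qed
    then obtain c' where c': "c' < p" "\<And>i. i < p \<Longrightarrow> i \<noteq> c' \<Longrightarrow> \<not> (\<exists>a a'. matching (L i) E K a a')" by blast
    define I where "I = {..<p} - {c'}"
    have "\<forall>i\<in>I. \<exists>X\<subseteq>L i. card X \<le> 2 * K \<and> (\<forall>x\<in>L i - X. \<forall>y\<in>L i - X. \<not> E x y)"
    proof
      fix i assume "i \<in> I"
      then show "\<exists>X\<subseteq>L i. card X \<le> 2 * K \<and> (\<forall>x\<in>L i - X. \<forall>y\<in>L i - X. \<not> E x y)"
        using matching_or_cover[OF V(2), of "L i" K] c'(2)[of i] by (simp add: I_def)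
    qed
    then obtain X where X: "\<forall>i\<in>I. X i \<subseteq> L i \<and> card (X i) \<le> 2 * K \<and> (\<forall>x\<in>L i - X i. \<forall>y\<in>L i - X i. \<not> E x y)"
      using bchoice[of I "\<lambda>i X. X \<subseteq> L i \<and> card X \<le> 2 * K \<and> (\<forall>x\<in>L i - X. \<forall>y\<in>L i - X. \<not> E x y)"] by blast
    define Y where "Y i = L i - X i" for i
    have YU: "Y i \<subseteq> U i" for i using LU[of i] by (auto simp: Y_def)
    define h where "h = m div N + 2 * K"
    have UY: "card (U i - Y i) \<le> h" if i: "i \<in> I" for i
    proof -
      have ip: "i < p" using i by (simp add: I_def)
      have "X i \<subseteq> U i" using X i LU[of i] by blast
      then have "finite (X i)" using finU[OF ip] by (rule finite_subset)
      then have "card (U i - Y i) \<le> card ((U i - L i) \<union> X i)" using finU[OF ip] by (intro card_mono) (auto simp: Y_def)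
      also have "\<dots> \<le> card (U i - L i) + card (X i)" by (rule card_Un_le)
      finally show ?thesis using high[OF ip] X i by (fastforce simp: h_def)
    qed
    have "\<exists>E' T. extremal p k V E' \<and>
      (\<forall>i\<in>I. T i \<subseteq> Y i \<and> card (Y i) \<le> card (T i) + (D * card (U i - Y i) + D) \<and> twins V E' (T i)) \<and>
      (\<forall>u v. u \<notin> (\<Union>i\<in>I. U i) \<longrightarrow> v \<notin> (\<Union>i\<in>I. U i) \<longrightarrow> E' u v = E u v)"
    proof (rule symmetrise_classes[OF _ ex k1 p1 _ YU _ md _ _ _ D_def])
      show "finite I" by (simp add: I_def)
      show "U i \<subseteq> V" if "i \<in> I" for i using that U(1) by (simp add: I_def)
      show "U i \<inter> U j = {}" if "i \<in> I" "j \<in> I" "i \<noteq> j" for i j using that U(3) by (simp add: I_def)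
      show "card V \<le> p * card (U i) + c" if "i \<in> I" for i using that size unfolding m_def by (simp add: I_def)
      show "length xs < s" if "i \<in> I" "gpath (U i) E xs" for i xs using path[of i xs] that by (simp add: I_def)
      show "\<not> E x y" if "i \<in> I" "x \<in> Y i" "y \<in> Y i" for i x y using that X by (simp add: Y_def)
    qed
    then obtain E' T where E': "extremal p k V E'"
      and T: "\<forall>i\<in>I. T i \<subseteq> Y i \<and> card (Y i) \<le> card (T i) + (D * card (U i - Y i) + D) \<and> twins V E' (T i)"
      by (elim exE conjE) (rule that)
    define \<delta> where "\<delta> = p * ((D + 1) * h + D) + c"
    have Tsize: "m \<le> p * card (T i) + \<delta>" if i: "i \<in> I" for i
    proof -
      have ip: "i < p" using i by (simp add: I_def)
      have "card (U i) = card (U i - Y i) + card (Y i)"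
        using finU[OF ip] finite_subset[OF YU finU[OF ip]] card_mono[OF finU[OF ip] YU] by (simp add: card_Diff_subset YU)
      moreover have "D * card (U i - Y i) \<le> D * h" by (rule mult_le_mono2[OF UY[OF i]])
      moreover have "card (Y i) \<le> card (T i) + (D * card (U i - Y i) + D)" using T i by blast
      ultimately have "card (U i) \<le> card (T i) + ((D + 1) * h + D)" using UY[OF i] unfolding distrib_right mult_1 by linarith
      then have "p * card (U i) \<le> p * (card (T i) + ((D + 1) * h + D))" by (rule mult_le_mono2)
      then have "p * card (U i) \<le> p * card (T i) + p * ((D + 1) * h + D)" by (simp only: distrib_left)
      then show ?thesis using size[OF ip] unfolding \<delta>_def by linarith
    qed
    \<comment> \<open>The unsymmetrised class gets index 0, the place of the class without twins in
      \<open>twin_classes_contradiction\<close>.\<close>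
    define \<tau> where "\<tau> = transpose 0 c'"
    have \<tau>: "\<tau> j \<in> I" if "j \<in> {1..<p}" for j using that c'(1) by (auto simp: \<tau>_def I_def transpose_def)
    have \<tau>_inj: "\<tau> i \<noteq> \<tau> j" if "i \<noteq> j" for i j using that by (metis \<tau>_def transpose_involutory)
    have V': "graph_rel E'" "\<not> has_power p k V E'" "degsum V E' = 2 * exn p k m" using E' by (auto simp: extremal_def m_def)
    have TU: "T i \<subseteq> U i" if "i \<in> I" for i using T that YU[of i] by blast
    show False
    proof (rule twin_classes_contradiction[OF assms V(1) V'(1,2) md[OF E'], where T = "T \<circ> \<tau>" and \<delta> = \<delta>])
      fix j assume j: "j \<in> {1..<p}"
      note i = \<tau>[OF j]
      have "\<tau> j < p" using i by (simp add: I_def)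
      then show "(T \<circ> \<tau>) j \<subseteq> V" using TU[OF i] U(1)[of "\<tau> j"] by simp
      show "card V \<le> p * card ((T \<circ> \<tau>) j) + \<delta>" using Tsize[OF i] by (simp add: m_def)
      fix x y assume "x \<in> (T \<circ> \<tau>) j" "y \<in> (T \<circ> \<tau>) j"
      moreover have "twins V E' (T (\<tau> j))" using T i by blast
      ultimately show "nbh V E' x = nbh V E' y" unfolding twins_def comp_def by blast
    next
      fix i j assume ij: "i \<in> {1..<p}" "j \<in> {1..<p}" "i \<noteq> j"
      note I = \<tau>[OF ij(1)] \<tau>[OF ij(2)]
      have "U (\<tau> i) \<inter> U (\<tau> j) = {}" using U(3)[OF _ _ \<tau>_inj[OF ij(3)]] I by (simp add: I_def)
      then show "(T \<circ> \<tau>) i \<inter> (T \<circ> \<tau>) j = {}" using TU[OF I(1)] TU[OF I(2)] by auto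
    next
      have "N * (m div N) \<le> m" by simp
      then have 1: "2 * (w * (p * ((D + 1) * (m div N)))) \<le> m" by (simp only: N_def mult.assoc)
      have "\<delta> = p * ((D + 1) * (m div N)) + c2" by (simp add: \<delta>_def h_def c2_def distrib_left)
      then have "w * \<delta> = w * (p * ((D + 1) * (m div N))) + w * c2" by (simp only: distrib_left)
      then have "w * \<delta> + c0 < m" using half_add_less[OF 1 big(3)] by simp
      moreover have "p * p + p * s * (\<delta> + p) + p * s * s + k * (\<delta> + 2 * p) + 2 * \<delta> + p = w * \<delta> + c0"
        by (simp add: w_def c0_def distrib_left distrib_right)
      ultimately show "p * p + p * s * (\<delta> + p) + p * s * s + k * (\<delta> + 2 * p) + 2 * \<delta> + p < card V" by (simp add: m_def)
    next
      show "2 * join_opt p s (card V) < degsum V E'" using less V'(3) by (simp add: m_def)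
    qed
  qed
qed

theorem theorem1p1:
  fixes p k j s :: nat
  assumes "p \<ge> 2" and "k \<ge> p + 1"
    and "j = (if [k = p] (mod (p + 1)) then 1 else 0)"
    and "s = 2 * (k div (p + 1)) + j"
  shows "\<exists>N. \<forall>n\<ge>N. ex_num n (graph_power (path_graph k) p) =
           Max {ex_num a (path_graph s) + a * b + turan_num b (p - 1) | a b. a + b = n}"
proof -
  define q where "q = k div (p + 1)"
  \<comment> \<open>The largest length with the same value of \<open>s\<close>: equal to
    \<open>k\<close> if \<open>j = 1\<close>, and the next length congruent to \<open>p - 1\<close>
    modulo \<open>p + 1\<close>, possibly \<open>k\<close> itself, if \<open>j = 0\<close>.
    Forbidding the shorter power forbids the longer one, so the upper bound for \<open>K\<close>
    carries over to \<open>k\<close>, while the lower bound holds for \<open>k\<close>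
    directly.\<close>
  define K where "K = q * (p + 1) + (p - 1) + j"
  have q: "1 \<le> q" using assms(1,2) by (simp add: q_def Suc_leI div_greater_zero_iff)
  have jm: "j = (if k mod (p + 1) = p then 1 else 0)" using assms(3) by (simp add: cong_def)
  have j: "j \<le> 1" using jm by simp
  have s: "s = 2 * q + j" using assms(4) by (simp add: q_def)
  have K: "K + 1 = q * (p + 1) + p + j" using assms(1) by (simp add: K_def)
  have kK: "k \<le> K"
  proof -
    have "k = q * (p + 1) + k mod (p + 1)" by (simp add: q_def del: mult_Suc_right)
    moreover have "k mod (p + 1) < p + 1" by simp
    moreover have "r \<le> (p - 1) + j" if "r < p + 1" "j = (if r = p then 1 else 0)" for r
      using that assms(1) by (cases "r = p") auto
    ultimately show ?thesis using jm unfolding K_def by (metis add.assoc add_left_mono)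
  qed
  obtain M where M: "\<forall>V E. M \<le> card V \<longrightarrow> extremal p K (V :: nat set) E \<longrightarrow> join_opt p s (card V) < exn p K (card V) \<longrightarrow>
    (\<forall>E' v. extremal p K V E' \<longrightarrow> v \<in> V \<longrightarrow> (p - 1) * (card V - 1) \<le> p * card (nbh V E' v)) \<longrightarrow> False"
    using extremal_core[OF assms(1) q j K s] by (elim exE) (rule that)
  have "\<exists>N. \<forall>n\<ge>N. exn p K n = join_opt p s n"
  proof (rule exn_eq_join_opt_of_core[OF assms(1) q j K s])
    fix V :: "nat set" and E
    assume "M \<le> card V" "extremal p K V E" "join_opt p s (card V) < exn p K (card V)"
      "\<And>E' v. extremal p K V E' \<Longrightarrow> v \<in> V \<Longrightarrow> (p - 1) * (card V - 1) \<le> p * card (nbh V E' v)"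
    then show False using M by blast
  qed
  then obtain N where N: "\<And>n. N \<le> n \<Longrightarrow> exn p K n = join_opt p s n" by blast
  have "exn p k n = join_opt p s n" if "N \<le> n" for n
  proof (rule antisym)
    show "exn p k n \<le> join_opt p s n"
      using exn_antimono_length[of p k K n] N[OF that] kK assms(1,2) by simp
    obtain a b where ab: "a + b = n" "join_opt p s n = exn 1 s a + a * b + turan_num b (p - 1)" using join_opt_attained .
    show "join_opt p s n \<le> exn p k n" unfolding ab(2)
      by (rule exn_join_le[OF assms(1,2) ab(1)]) (simp only: assms(4) jm)
  qed
  moreover have "exn p k n = ex_num n (graph_power (path_graph k) p)" for n by (simp add: exn_def)
  moreover have "exn 1 s a = ex_num a (path_graph s)" for a by (simp only: exn_def path_power_1)
  ultimately have "\<forall>n\<ge>N. ex_num n (graph_power (path_graph k) p) =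
           Max {ex_num a (path_graph s) + a * b + turan_num b (p - 1) | a b. a + b = n}"
    by (simp only: join_opt_def) blast
  then show ?thesis by blast
qed

end
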